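(* Let $R$ be a unital ring and $L=R[x_1^{\pm1},x_2^{\pm1},\dots,x_n^{\pm1}]$. Suppose $D$ is a bounded cochain complex of projective $L$-modules, and suppose further that $D$ is $R$-finitely dominated. Then the induced cochain complex $D\otimes_L R(\!(x_1,x_2,\dots,x_n)\!)$ is acyclic, and thus contractible.
   Context: Modules are right modules. A cochain complex of $L$-modules is called $R$-finitely dominated if, as a complex of $R$-modules, it is homotopy equivalent to a bounded complex of finitely generated projective $R$-modules. For a formal Laurent series $f=\sum_{\mathbf a\in\mathbb Z^n}r_{\mathbf a}\mathbf x^{\mathbf a}$ with $r_{\mathbf a}\in R$ the support is $\mathrm{supp}(f)=\{\mathbf a\in\mathbb Z^n\mid r_{\mathbf a}\ne0\}$. With $\mathbf 1=(1,1,\dots,1)$ and $\mathbb N=\{0,1,2,\dots\}$, the Novikov ring is $$R(\!(x_1,\dots,x_n)\!)=\{f\mid\exists k\in\mathbb N:\ k\mathbf 1+\mathrm{supp}(f)\subseteq\mathbb N^n\}=R[[x_1,\dots,x_n]]\big[1/(x_1x_2\cdots x_n)\big],$$ with the usual multiplication of series; it contains $L$ as a subring. *)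

theory Defs
  imports
    "HOL-Algebra.Module"
    "HOL-Algebra.Free_Abelian_Groups"
    "HOL-Analysis.Finite_Cartesian_Product"
begin

section \<open>Right modules over a unital ring\<close>

text \<open>
  The ring need not be commutative. We reuse the record of the library's modules, whose fields
  \<open>mult\<close> and \<open>one\<close> are irrelevant; \<open>a \<odot>\<^bsub>M\<^esub> x\<close> stands for the right action \<open>x \<cdot> a\<close>,
  so \<open>x \<cdot> (a b) = (x \<cdot> a) \<cdot> b\<close> reads as in \<open>smult_assoc\<close>.
\<close>

locale right_module = R?: ring R + M?: abelian_group M
  for R (structure) and M :: "('a, 'm, 'y) module_scheme" (structure) +
  assumes smult_closed:
      "\<lbrakk>a \<in> carrier R; x \<in> carrier M\<rbrakk> \<Longrightarrow> a \<odot>\<^bsub>M\<^esub> x \<in> carrier M"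
    and smult_l_distr:
      "\<lbrakk>a \<in> carrier R; b \<in> carrier R; x \<in> carrier M\<rbrakk> \<Longrightarrow>
       (a \<oplus>\<^bsub>R\<^esub> b) \<odot>\<^bsub>M\<^esub> x = a \<odot>\<^bsub>M\<^esub> x \<oplus>\<^bsub>M\<^esub> b \<odot>\<^bsub>M\<^esub> x"
    and smult_r_distr:
      "\<lbrakk>a \<in> carrier R; x \<in> carrier M; y \<in> carrier M\<rbrakk> \<Longrightarrow>
       a \<odot>\<^bsub>M\<^esub> (x \<oplus>\<^bsub>M\<^esub> y) = a \<odot>\<^bsub>M\<^esub> x \<oplus>\<^bsub>M\<^esub> a \<odot>\<^bsub>M\<^esub> y"
    and smult_assoc:
      "\<lbrakk>a \<in> carrier R; b \<in> carrier R; x \<in> carrier M\<rbrakk> \<Longrightarrow>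
       (a \<otimes>\<^bsub>R\<^esub> b) \<odot>\<^bsub>M\<^esub> x = b \<odot>\<^bsub>M\<^esub> (a \<odot>\<^bsub>M\<^esub> x)"
    and smult_one:
      "x \<in> carrier M \<Longrightarrow> \<one>\<^bsub>R\<^esub> \<odot>\<^bsub>M\<^esub> x = x"

definition rmod_hom ::
  "('a, 'r) ring_scheme \<Rightarrow> ('a, 'm) module \<Rightarrow> ('a, 'p) module \<Rightarrow> ('m \<Rightarrow> 'p) set" where
  "rmod_hom R M N =
     {h \<in> carrier M \<rightarrow> carrier N.
        (\<forall>x\<in>carrier M. \<forall>y\<in>carrier M. h (x \<oplus>\<^bsub>M\<^esub> y) = h x \<oplus>\<^bsub>N\<^esub> h y) \<and>
        (\<forall>a\<in>carrier R. \<forall>x\<in>carrier M. h (a \<odot>\<^bsub>M\<^esub> x) = a \<odot>\<^bsub>N\<^esub> h x)}"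

definition free_rmodule ::
  "('a, 'r) ring_scheme \<Rightarrow> 'i set \<Rightarrow> ('a, 'i \<Rightarrow> 'a) module" where
  "free_rmodule R X =
     \<lparr>carrier = {f. (\<forall>i\<in>X. f i \<in> carrier R) \<and> (\<forall>i. i \<notin> X \<longrightarrow> f i = \<zero>\<^bsub>R\<^esub>) \<and>
                   finite {i. f i \<noteq> \<zero>\<^bsub>R\<^esub>}},
      monoid.mult = undefined, one = undefined,
      ring.zero = (\<lambda>i. \<zero>\<^bsub>R\<^esub>),
      add = (\<lambda>f g i. f i \<oplus>\<^bsub>R\<^esub> g i),
      smult = (\<lambda>a f i. f i \<otimes>\<^bsub>R\<^esub> a)\<rparr>"

text \<open>
  Projective means direct summand of a free module. It is no restriction to take the basis in the
  element type of \<open>M\<close>, since the free module on \<open>carrier M\<close> always surjects onto \<open>M\<close>.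
\<close>

definition projective_rmodule :: "('a, 'r) ring_scheme \<Rightarrow> ('a, 'm) module \<Rightarrow> bool" where
  "projective_rmodule R M \<longleftrightarrow>
     right_module R M \<and>
     (\<exists>(X :: 'm set) i p.
        i \<in> rmod_hom R M (free_rmodule R X) \<and> p \<in> rmod_hom R (free_rmodule R X) M \<and>
        (\<forall>x\<in>carrier M. p (i x) = x))"

definition fg_rmodule :: "('a, 'r) ring_scheme \<Rightarrow> ('a, 'm) module \<Rightarrow> bool" where
  "fg_rmodule R M \<longleftrightarrow>
     right_module R M \<and>
     (\<exists>S. finite S \<and> S \<subseteq> carrier M \<and>
        (\<forall>x\<in>carrier M. \<exists>c\<in>S \<rightarrow> carrier R. x = (\<Oplus>\<^bsub>M\<^esub>s\<in>S. c s \<odot>\<^bsub>M\<^esub> s)))"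


section \<open>Cochain complexes\<close>

record ('a, 'm) mod_complex =
  obj :: "int \<Rightarrow> ('a, 'm) module"
  differential :: "int \<Rightarrow> 'm \<Rightarrow> 'm"

definition cochain_complex :: "('a, 'r) ring_scheme \<Rightarrow> ('a, 'm) mod_complex \<Rightarrow> bool" where
  "cochain_complex R D \<longleftrightarrow>
     (\<forall>k. right_module R (obj D k)) \<and>
     (\<forall>k. differential D k \<in> rmod_hom R (obj D k) (obj D (k + 1))) \<and>
     (\<forall>k. \<forall>x\<in>carrier (obj D k). differential D (k + 1) (differential D k x) = \<zero>\<^bsub>obj D (k + 1 + 1)\<^esub>)"

definition bounded_complex :: "('a, 'm) mod_complex \<Rightarrow> bool" where
  "bounded_complex D \<longleftrightarrow>
     (\<exists>a b. \<forall>k. k < a \<or> b < k \<longrightarrow> carrier (obj D k) = {\<zero>\<^bsub>obj D k\<^esub>})"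

definition acyclic_complex :: "('a, 'm) mod_complex \<Rightarrow> bool" where
  "acyclic_complex D \<longleftrightarrow>
     (\<forall>k. {x \<in> carrier (obj D k). differential D k x = \<zero>\<^bsub>obj D (k + 1)\<^esub>} =
          differential D (k - 1) ` carrier (obj D (k - 1)))"

definition cochain_map ::
  "('a, 'r) ring_scheme \<Rightarrow> ('a, 'm) mod_complex \<Rightarrow> ('a, 'p) mod_complex \<Rightarrow>
   (int \<Rightarrow> 'm \<Rightarrow> 'p) \<Rightarrow> bool" where
  "cochain_map R C D f \<longleftrightarrow>
     (\<forall>k. f k \<in> rmod_hom R (obj C k) (obj D k)) \<and>
     (\<forall>k. \<forall>x\<in>carrier (obj C k). f (k + 1) (differential C k x) = differential D k (f k x))"

definition cochain_homotopic ::
  "('a, 'r) ring_scheme \<Rightarrow> ('a, 'm) mod_complex \<Rightarrow> ('a, 'p) mod_complex \<Rightarrow>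
   (int \<Rightarrow> 'm \<Rightarrow> 'p) \<Rightarrow> (int \<Rightarrow> 'm \<Rightarrow> 'p) \<Rightarrow> bool" where
  "cochain_homotopic R C D f g \<longleftrightarrow>
     (\<exists>s. (\<forall>k. s k \<in> rmod_hom R (obj C k) (obj D (k - 1))) \<and>
          (\<forall>k. \<forall>x\<in>carrier (obj C k).
             f k x \<ominus>\<^bsub>obj D k\<^esub> g k x =
             differential D (k - 1) (s k x) \<oplus>\<^bsub>obj D k\<^esub> s (k + 1) (differential C k x)))"

definition homotopy_equivalent ::
  "('a, 'r) ring_scheme \<Rightarrow> ('a, 'm) mod_complex \<Rightarrow> ('a, 'p) mod_complex \<Rightarrow> bool" where
  "homotopy_equivalent R C D \<longleftrightarrow>
     (\<exists>f g. cochain_map R C D f \<and> cochain_map R D C g \<and>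
        cochain_homotopic R C C (\<lambda>k. g k \<circ> f k) (\<lambda>k. id) \<and>
        cochain_homotopic R D D (\<lambda>k. f k \<circ> g k) (\<lambda>k. id))"

definition contractible_complex :: "('a, 'r) ring_scheme \<Rightarrow> ('a, 'm) mod_complex \<Rightarrow> bool" where
  "contractible_complex R D \<longleftrightarrow>
     cochain_homotopic R D D (\<lambda>k. id) (\<lambda>k x. \<zero>\<^bsub>obj D k\<^esub>)"


section \<open>Change of rings\<close>

definition restrict_scalars :: "('a \<Rightarrow> 'b) \<Rightarrow> ('b, 'm) module \<Rightarrow> ('a, 'm) module" where
  "restrict_scalars \<phi> M =
     \<lparr>carrier = carrier M, monoid.mult = (\<otimes>\<^bsub>M\<^esub>), one = \<one>\<^bsub>M\<^esub>,
      ring.zero = \<zero>\<^bsub>M\<^esub>, add = (\<oplus>\<^bsub>M\<^esub>),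
      smult = (\<lambda>a x. \<phi> a \<odot>\<^bsub>M\<^esub> x)\<rparr>"

definition restrict_complex :: "('a \<Rightarrow> 'b) \<Rightarrow> ('b, 'm) mod_complex \<Rightarrow> ('a, 'm) mod_complex" where
  "restrict_complex \<phi> D = \<lparr>obj = (\<lambda>k. restrict_scalars \<phi> (obj D k)), differential = differential D\<rparr>"

text \<open>
  For a ring homomorphism \<open>\<phi> : A \<rightarrow> S\<close> and a right \<open>A\<close>-module \<open>M\<close>, the tensor product of \<open>M\<close> and
  \<open>S\<close> over \<open>A\<close> is the quotient of the free Abelian group on \<open>M \<times> S\<close> by the subgroup generated by
  the balanced bilinearity relations. Its elements are cosets, and a map given on representatives
  acts on a coset as the union of the cosets of the images of its elements.
\<close>

definition tensor_gens ::
  "('a, 'm) module \<Rightarrow> ('s, 't) ring_scheme \<Rightarrow> ('m \<times> 's \<Rightarrow>\<^sub>0 int) monoid" where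
  "tensor_gens M S = free_Abelian_group (carrier M \<times> carrier S)"

definition tensor_rels ::
  "('a, 'r) ring_scheme \<Rightarrow> ('s, 't) ring_scheme \<Rightarrow> ('a \<Rightarrow> 's) \<Rightarrow> ('a, 'm) module \<Rightarrow>
   ('m \<times> 's \<Rightarrow>\<^sub>0 int) set" where
  "tensor_rels A S \<phi> M =
     {frag_of (x \<oplus>\<^bsub>M\<^esub> y, s) - frag_of (x, s) - frag_of (y, s) | x y s.
        x \<in> carrier M \<and> y \<in> carrier M \<and> s \<in> carrier S} \<union>
     {frag_of (x, s \<oplus>\<^bsub>S\<^esub> t) - frag_of (x, s) - frag_of (x, t) | x s t.
        x \<in> carrier M \<and> s \<in> carrier S \<and> t \<in> carrier S} \<union>
     {frag_of (a \<odot>\<^bsub>M\<^esub> x, s) - frag_of (x, \<phi> a \<otimes>\<^bsub>S\<^esub> s) | a x s.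
        a \<in> carrier A \<and> x \<in> carrier M \<and> s \<in> carrier S}"

definition tensor_null ::
  "('a, 'r) ring_scheme \<Rightarrow> ('s, 't) ring_scheme \<Rightarrow> ('a \<Rightarrow> 's) \<Rightarrow> ('a, 'm) module \<Rightarrow>
   ('m \<times> 's \<Rightarrow>\<^sub>0 int) set" where
  "tensor_null A S \<phi> M = generate (tensor_gens M S) (tensor_rels A S \<phi> M)"

definition extend_scalars ::
  "('a, 'r) ring_scheme \<Rightarrow> ('s, 't) ring_scheme \<Rightarrow> ('a \<Rightarrow> 's) \<Rightarrow> ('a, 'm) module \<Rightarrow>
   ('s, ('m \<times> 's \<Rightarrow>\<^sub>0 int) set) module" where
  "extend_scalars A S \<phi> M =
     (let F = tensor_gens M S; H = tensor_null A S \<phi> M; Q = F Mod H in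
      \<lparr>carrier = carrier Q, monoid.mult = undefined, one = undefined,
       ring.zero = \<one>\<^bsub>Q\<^esub>, add = (\<otimes>\<^bsub>Q\<^esub>),
       smult = (\<lambda>t U. \<Union>u\<in>U. H #>\<^bsub>F\<^esub> frag_extend (\<lambda>(x, s). frag_of (x, s \<otimes>\<^bsub>S\<^esub> t)) u)\<rparr>)"

definition extend_map ::
  "('a, 'r) ring_scheme \<Rightarrow> ('s, 't) ring_scheme \<Rightarrow> ('a \<Rightarrow> 's) \<Rightarrow> ('a, 'p) module \<Rightarrow>
   ('m \<Rightarrow> 'p) \<Rightarrow> ('m \<times> 's \<Rightarrow>\<^sub>0 int) set \<Rightarrow> ('p \<times> 's \<Rightarrow>\<^sub>0 int) set" where
  "extend_map A S \<phi> N h U =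
     (\<Union>u\<in>U. tensor_null A S \<phi> N #>\<^bsub>tensor_gens N S\<^esub>
               frag_extend (\<lambda>(x, s). frag_of (h x, s)) u)"

definition extend_complex ::
  "('a, 'r) ring_scheme \<Rightarrow> ('s, 't) ring_scheme \<Rightarrow> ('a \<Rightarrow> 's) \<Rightarrow> ('a, 'm) mod_complex \<Rightarrow>
   ('s, ('m \<times> 's \<Rightarrow>\<^sub>0 int) set) mod_complex" where
  "extend_complex A S \<phi> D =
     \<lparr>obj = (\<lambda>k. extend_scalars A S \<phi> (obj D k)),
      differential = (\<lambda>k. extend_map A S \<phi> (obj D (k + 1)) (differential D k))\<rparr>"


section \<open>Laurent polynomials and Novikov rings\<close>

text \<open>
  A formal Laurent series in the variables indexed by \<open>'n\<close> is its coefficient function on exponent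
  vectors. The convolution sum only ranges over the nonzero terms; this set is finite for any two
  elements of the Novikov ring.
\<close>

definition supp :: "('a, 'r) ring_scheme \<Rightarrow> (int ^ 'n \<Rightarrow> 'a) \<Rightarrow> (int ^ 'n) set" where
  "supp R f = {a. f a \<noteq> \<zero>\<^bsub>R\<^esub>}"

definition novikov_ring :: "('a, 'r) ring_scheme \<Rightarrow> (int ^ 'n \<Rightarrow> 'a) ring" where
  "novikov_ring R =
     \<lparr>carrier = {f. range f \<subseteq> carrier R \<and>
                   (\<exists>k::nat. \<forall>a\<in>supp R f. \<forall>i. 0 \<le> int k + a $ i)},
      monoid.mult = (\<lambda>f g a. \<Oplus>\<^bsub>R\<^esub>b\<in>{b. b \<in> supp R f \<and> a - b \<in> supp R g}. f b \<otimes>\<^bsub>R\<^esub> g (a - b)),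
      one = (\<lambda>a. if a = 0 then \<one>\<^bsub>R\<^esub> else \<zero>\<^bsub>R\<^esub>),
      ring.zero = (\<lambda>a. \<zero>\<^bsub>R\<^esub>),
      add = (\<lambda>f g a. f a \<oplus>\<^bsub>R\<^esub> g a)\<rparr>"

definition laurent_ring :: "('a, 'r) ring_scheme \<Rightarrow> (int ^ 'n \<Rightarrow> 'a) ring" where
  "laurent_ring R =
     (novikov_ring R)\<lparr>carrier := {f. range f \<subseteq> carrier R \<and> finite (supp R f)}\<rparr>"

definition laurent_const :: "('a, 'r) ring_scheme \<Rightarrow> 'a \<Rightarrow> (int ^ 'n \<Rightarrow> 'a)" where
  "laurent_const R r = (\<lambda>a. if a = 0 then r else \<zero>\<^bsub>R\<^esub>)"

text \<open>
  The type argument is the element type of the complex of finitely generated projective modules;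
  a statement assuming this for an arbitrary type \<open>'c\<close> covers all such complexes.
\<close>

definition finitely_dominated ::
  "'c itself \<Rightarrow> ('a, 'r) ring_scheme \<Rightarrow> (int ^ 'n \<Rightarrow> 'a, 'm) mod_complex \<Rightarrow> bool" where
  "finitely_dominated (_ :: 'c itself) R D \<longleftrightarrow>
     (\<exists>C :: ('a, 'c) mod_complex.
        cochain_complex R C \<and> bounded_complex C \<and>
        (\<forall>k. fg_rmodule R (obj C k) \<and> projective_rmodule R (obj C k)) \<and>
        homotopy_equivalent R (restrict_complex (laurent_const R) D) C)"

definition novikov_complex ::
  "('a, 'r) ring_scheme \<Rightarrow> (int ^ 'n \<Rightarrow> 'a, 'm) mod_complex \<Rightarrow>
   (int ^ 'n \<Rightarrow> 'a, ('m \<times> (int ^ 'n \<Rightarrow> 'a) \<Rightarrow>\<^sub>0 int) set) mod_complex" where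
  "novikov_complex R D = extend_complex (laurent_ring R) (novikov_ring R) (\<lambda>f. f) D"

end

theory Submission
  imports Defs
begin

text \<open>
  Fix one variable \<open>X\<close>. It suffices to show that the subcomplex of \<open>D \<otimes> R((x\<^sub>1,\<dots>,x\<^sub>n))\<close> spanned over \<open>L\<close>
  by the tensors with second factor in \<open>R((X))\<close> is acyclic: as \<open>D\<close> is bounded and projective over \<open>L\<close>,
  the map \<open>x \<mapsto> x \<otimes> 1\<close> from \<open>D\<close> into this subcomplex is then null homotopic over \<open>L\<close>, and a null
  homotopy extends to a contraction of the Novikov complex.

  For acyclicity compare the Laurent series \<open>D((Y))\<close> with the subcomplex \<open>A\<close> of those series that come
  from \<open>D \<otimes>\<^sub>R R((Y))\<close>. For a finitely generated \<open>R\<close>-module \<open>C\<close> every series in \<open>C((Y))\<close> comes from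
  \<open>C \<otimes>\<^sub>R R((Y))\<close>, so the maps through which \<open>D\<close> is dominated send all of \<open>D((Y))\<close> into \<open>A\<close>, and
  \<open>A \<rightarrow> D((Y))\<close> is a quasi-isomorphism. On \<open>D((Y))\<close> the operator \<open>X - Y\<close> is invertible, hence it is a
  quasi-isomorphism on \<open>A\<close>; and the subcomplex above is the quotient of \<open>A\<close> by \<open>X - Y\<close>.
\<close>

section \<open>Right modules and homomorphisms\<close>

text \<open>The maps and homotopies of the domination are only R-linear, so they induce nothing on a
  tensor product over L. They do act coefficientwise on series in an auxiliary variable Y, where
  they commute with Y but not with X. This is why Y is introduced, and why elements must be carried
  through X - Y, whose inverse on series bounded below is a geometric series.

  Substituting X for Y leads from A to the tensor product. This is the relation \<open>rep\<close>,
  which spares a construction of the tensor product of D with R((Y)) over R. Projectivity over L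
  makes D a direct summand of a free R-module, with coordinates indexed by a generator and an
  exponent vector. These coordinates show that the substitution is well defined
  (\<open>rep_unique\<close>) and that a series of A mapping to zero is X - Y times a series of A
  (\<open>rep_shift_inverse\<close>).

  One variable suffices because only the images of the tensors x \<otimes> 1 have to be contracted
  over L: an L-linear map into any L-submodule of the Novikov tensor product extends by linearity to
  the whole of it.\<close>

lemma rmod_homI:
  assumes "\<And>x. x \<in> carrier M \<Longrightarrow> h x \<in> carrier N"
    and "\<And>x y. \<lbrakk>x \<in> carrier M; y \<in> carrier M\<rbrakk> \<Longrightarrow> h (x \<oplus>\<^bsub>M\<^esub> y) = h x \<oplus>\<^bsub>N\<^esub> h y"
    and "\<And>a x. \<lbrakk>a \<in> carrier R; x \<in> carrier M\<rbrakk> \<Longrightarrow> h (a \<odot>\<^bsub>M\<^esub> x) = a \<odot>\<^bsub>N\<^esub> h x"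
  shows "h \<in> rmod_hom R M N"
  using assms by (auto simp: rmod_hom_def)

lemma rmod_homD:
  assumes "h \<in> rmod_hom R M N"
  shows "x \<in> carrier M \<Longrightarrow> h x \<in> carrier N"
    and "\<lbrakk>x \<in> carrier M; y \<in> carrier M\<rbrakk> \<Longrightarrow> h (x \<oplus>\<^bsub>M\<^esub> y) = h x \<oplus>\<^bsub>N\<^esub> h y"
    and "\<lbrakk>a \<in> carrier R; x \<in> carrier M\<rbrakk> \<Longrightarrow> h (a \<odot>\<^bsub>M\<^esub> x) = a \<odot>\<^bsub>N\<^esub> h x"
  using assms by (auto simp: rmod_hom_def)

text \<open>The maps below are linear over different rings, and some go from a module to a ring.
  Their common part is additivity, stated for ring schemes so that it covers rings and modules
  alike.\<close>

definition additive_map :: "('a, 'm) ring_scheme \<Rightarrow> ('b, 'n) ring_scheme \<Rightarrow> ('a \<Rightarrow> 'b) \<Rightarrow> bool" where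
  "additive_map M N h \<longleftrightarrow> abelian_group M \<and> abelian_group N \<and> h \<in> carrier M \<rightarrow> carrier N \<and>
     (\<forall>x\<in>carrier M. \<forall>y\<in>carrier M. h (x \<oplus>\<^bsub>M\<^esub> y) = h x \<oplus>\<^bsub>N\<^esub> h y)"

lemma rmod_hom_additive:
  "\<lbrakk>h \<in> rmod_hom R M N; right_module R M; right_module R N\<rbrakk> \<Longrightarrow> additive_map M N h"
  by (auto simp: rmod_hom_def additive_map_def right_module_def)

lemma additive_mapI:
  assumes "abelian_group M" "abelian_group N" "\<And>x. x \<in> carrier M \<Longrightarrow> h x \<in> carrier N"
    and "\<And>x y. \<lbrakk>x \<in> carrier M; y \<in> carrier M\<rbrakk> \<Longrightarrow> h (x \<oplus>\<^bsub>M\<^esub> y) = h x \<oplus>\<^bsub>N\<^esub> h y"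
  shows "additive_map M N h"
  using assms by (auto simp: additive_map_def)

context
  fixes M :: "('a, 'm) ring_scheme" and N :: "('b, 'n) ring_scheme" and h
  assumes h: "additive_map M N h"
begin

lemma additive_map_closed: "x \<in> carrier M \<Longrightarrow> h x \<in> carrier N"
  and additive_map_add: "\<lbrakk>x \<in> carrier M; y \<in> carrier M\<rbrakk> \<Longrightarrow> h (x \<oplus>\<^bsub>M\<^esub> y) = h x \<oplus>\<^bsub>N\<^esub> h y"
  using h by (auto simp: additive_map_def)

lemma additive_map_zero: "h \<zero>\<^bsub>M\<^esub> = \<zero>\<^bsub>N\<^esub>"
proof -
  interpret M: abelian_group M using h by (simp add: additive_map_def)
  interpret N: abelian_group N using h by (simp add: additive_map_def)
  have "h \<zero>\<^bsub>M\<^esub> \<oplus>\<^bsub>N\<^esub> h \<zero>\<^bsub>M\<^esub> = h \<zero>\<^bsub>M\<^esub>"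
    using additive_map_add[of "\<zero>\<^bsub>M\<^esub>" "\<zero>\<^bsub>M\<^esub>"] by simp
  then show ?thesis
    using additive_map_closed[OF M.zero_closed] N.add.l_cancel_one by simp
qed

lemma additive_map_neg: "x \<in> carrier M \<Longrightarrow> h (\<ominus>\<^bsub>M\<^esub> x) = \<ominus>\<^bsub>N\<^esub> h x"
proof -
  interpret M: abelian_group M using h by (simp add: additive_map_def)
  interpret N: abelian_group N using h by (simp add: additive_map_def)
  assume x: "x \<in> carrier M"
  then have "h (\<ominus>\<^bsub>M\<^esub> x) \<oplus>\<^bsub>N\<^esub> h x = \<zero>\<^bsub>N\<^esub>"
    using additive_map_add[of "\<ominus>\<^bsub>M\<^esub> x" x] by (simp add: M.l_neg additive_map_zero)
  then show ?thesis
    using x by (metis N.minus_equality additive_map_closed M.a_inv_closed)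
qed

lemma additive_map_diff:
  "\<lbrakk>x \<in> carrier M; y \<in> carrier M\<rbrakk> \<Longrightarrow> h (x \<ominus>\<^bsub>M\<^esub> y) = h x \<ominus>\<^bsub>N\<^esub> h y"
  using h by (simp add: a_minus_def additive_map_add additive_map_neg additive_map_def
      abelian_group.a_inv_closed)

lemma additive_map_finsum:
  assumes "finite I" "f \<in> I \<rightarrow> carrier M"
  shows "h (\<Oplus>\<^bsub>M\<^esub>i\<in>I. f i) = (\<Oplus>\<^bsub>N\<^esub>i\<in>I. h (f i))"
  using assms
proof (induction I rule: finite_induct)
  interpret M: abelian_group M using h by (simp add: additive_map_def)
  interpret N: abelian_group N using h by (simp add: additive_map_def)
  {
    case empty
    show ?case by (simp add: additive_map_zero)
  next
    case (insert i I)
    then have "(\<lambda>i. h (f i)) \<in> I \<rightarrow> carrier N" "h (f i) \<in> carrier N"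
      using additive_map_closed by (auto simp: Pi_iff)
    with insert show ?case
      by (simp add: additive_map_add Pi_iff M.finsum_insert N.finsum_insert)
  }
qed

end

lemma (in right_module) smult_additive: "a \<in> carrier R \<Longrightarrow> additive_map M M (\<lambda>x. a \<odot>\<^bsub>M\<^esub> x)"
  by (rule additive_mapI) (simp_all add: M.abelian_group_axioms smult_closed smult_r_distr)

lemma (in right_module) smult_zero_left: "x \<in> carrier M \<Longrightarrow> \<zero>\<^bsub>R\<^esub> \<odot>\<^bsub>M\<^esub> x = \<zero>\<^bsub>M\<^esub>"
  using additive_map_zero[of R M "\<lambda>a. a \<odot>\<^bsub>M\<^esub> x"]
  by (simp add: additive_mapI M.abelian_group_axioms R.abelian_group_axioms smult_closed smult_l_distr)

section \<open>Extension of scalars\<close>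

text \<open>Used to descend maps to quotients: it reduces the compatibility of a map given on
  representatives to the generating relations.\<close>

lemma frag_map_null:
  assumes gen: "\<And>u. u \<in> K \<Longrightarrow> frag_extend \<kappa> u \<in> L"
    and K: "K \<subseteq> carrier (free_Abelian_group A)"
    and L: "subgroup L (free_Abelian_group B)"
    and u: "u \<in> generate (free_Abelian_group A) K"
  shows "frag_extend \<kappa> u \<in> L"
  using u
proof (induction rule: generate.induct)
  case one
  then show ?case using subgroup.one_closed[OF L] by simp
next
  case (incl h)
  then show ?case by (rule gen)
next
  case (inv h)
  have "frag_extend \<kappa> h \<in> L" using inv gen by blast
  moreover have "Poly_Mapping.keys h \<subseteq> A"
    using subsetD[OF K inv] by simp
  moreover have "Poly_Mapping.keys (frag_extend \<kappa> h) \<subseteq> B"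
    using subsetD[OF subgroup.subset[OF L] \<open>frag_extend \<kappa> h \<in> L\<close>] by simp
  ultimately show ?case
    using subgroup.m_inv_closed[OF L, of "frag_extend \<kappa> h"] by (simp add: frag_extend_minus)
next
  case (eng h1 h2)
  then show ?case using subgroup.m_closed[OF L] by (simp add: frag_extend_add)
qed

lemma tensor_rels_cases [consumes 1, case_names left right balanced]:
  assumes "u \<in> tensor_rels A S \<phi> M"
  obtains x y s where "u = frag_of (x \<oplus>\<^bsub>M\<^esub> y, s) - frag_of (x, s) - frag_of (y, s)"
      "x \<in> carrier M" "y \<in> carrier M" "s \<in> carrier S"
    | x s t where "u = frag_of (x, s \<oplus>\<^bsub>S\<^esub> t) - frag_of (x, s) - frag_of (x, t)"
      "x \<in> carrier M" "s \<in> carrier S" "t \<in> carrier S"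
    | a x s where "u = frag_of (a \<odot>\<^bsub>M\<^esub> x, s) - frag_of (x, \<phi> a \<otimes>\<^bsub>S\<^esub> s)"
      "a \<in> carrier A" "x \<in> carrier M" "s \<in> carrier S"
  using assms unfolding tensor_rels_def by blast

lemma tensor_rels_intros:
  "\<lbrakk>x \<in> carrier M; y \<in> carrier M; s \<in> carrier S\<rbrakk> \<Longrightarrow>
   frag_of (x \<oplus>\<^bsub>M\<^esub> y, s) - frag_of (x, s) - frag_of (y, s) \<in> tensor_rels A S \<phi> M"
  "\<lbrakk>x \<in> carrier M; s \<in> carrier S; t \<in> carrier S\<rbrakk> \<Longrightarrow>
   frag_of (x, s \<oplus>\<^bsub>S\<^esub> t) - frag_of (x, s) - frag_of (x, t) \<in> tensor_rels A S \<phi> M"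
  "\<lbrakk>a \<in> carrier A; x \<in> carrier M; s \<in> carrier S\<rbrakk> \<Longrightarrow>
   frag_of (a \<odot>\<^bsub>M\<^esub> x, s) - frag_of (x, \<phi> a \<otimes>\<^bsub>S\<^esub> s) \<in> tensor_rels A S \<phi> M"
  unfolding tensor_rels_def by blast+

section \<open>The tensor product as a right module, and its universal property\<close>

locale tensor = S: ring S + M: right_module A M
  for A :: "('a, 'r) ring_scheme" and S :: "('s, 't) ring_scheme" and \<phi> :: "'a \<Rightarrow> 's"
    and M :: "('a, 'm) module" +
  assumes phi_closed: "a \<in> carrier A \<Longrightarrow> \<phi> a \<in> carrier S"
begin

abbreviation "F \<equiv> tensor_gens M S"
abbreviation "N \<equiv> tensor_null A S \<phi> M"
abbreviation "T \<equiv> extend_scalars A S \<phi> M"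
abbreviation cls :: "('m \<times> 's \<Rightarrow>\<^sub>0 int) \<Rightarrow> ('m \<times> 's \<Rightarrow>\<^sub>0 int) set" where "cls u \<equiv> N #>\<^bsub>F\<^esub> u"

definition tens :: "'m \<Rightarrow> 's \<Rightarrow> ('m \<times> 's \<Rightarrow>\<^sub>0 int) set" where
  "tens x s = cls (frag_of (x, s))"

lemma F_comm_group: "comm_group F"
  by (simp add: tensor_gens_def abelian_free_Abelian_group)

lemma F_group: "group F"
  by (simp add: tensor_gens_def)

lemma F_simps: "x \<otimes>\<^bsub>F\<^esub> y = x + y" "\<one>\<^bsub>F\<^esub> = 0" "x \<in> carrier F \<Longrightarrow> inv\<^bsub>F\<^esub> x = - x"
  by (simp_all add: tensor_gens_def)

lemma F_closed:
  "0 \<in> carrier F"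
  "\<lbrakk>x \<in> carrier M; s \<in> carrier S\<rbrakk> \<Longrightarrow> frag_of (x, s) \<in> carrier F"
  "\<lbrakk>u \<in> carrier F; v \<in> carrier F\<rbrakk> \<Longrightarrow> u + v \<in> carrier F"
  "u \<in> carrier F \<Longrightarrow> - u \<in> carrier F"
  "\<lbrakk>u \<in> carrier F; v \<in> carrier F\<rbrakk> \<Longrightarrow> u - v \<in> carrier F"
proof -
  interpret group F by (rule F_group)
  show "0 \<in> carrier F" using one_closed by (simp add: F_simps)
  show "\<lbrakk>x \<in> carrier M; s \<in> carrier S\<rbrakk> \<Longrightarrow> frag_of (x, s) \<in> carrier F"
    by (simp add: tensor_gens_def)
  show add: "\<lbrakk>u \<in> carrier F; v \<in> carrier F\<rbrakk> \<Longrightarrow> u + v \<in> carrier F" for u v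
    using m_closed[of u v] by (simp add: F_simps)
  show neg: "u \<in> carrier F \<Longrightarrow> - u \<in> carrier F" for u
    by (simp add: tensor_gens_def)
  show "\<lbrakk>u \<in> carrier F; v \<in> carrier F\<rbrakk> \<Longrightarrow> u - v \<in> carrier F"
    using add[of u "- v"] neg by simp
qed

lemma rels_subset: "tensor_rels A S \<phi> M \<subseteq> carrier F"
  unfolding tensor_rels_def
  by (auto intro!: F_closed M.smult_closed S.add.m_closed M.a_closed S.m_closed phi_closed)

lemma N_subgroup: "subgroup N F"
  unfolding tensor_null_def by (rule group.generate_is_subgroup[OF F_group rels_subset])

lemma N_normal: "N \<lhd> F"
  by (rule comm_group.subgroup_imp_normal[OF F_comm_group N_subgroup])

lemma cls_eq_iff:
  assumes "u \<in> carrier F" "v \<in> carrier F"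
  shows "cls u = cls v \<longleftrightarrow> u - v \<in> N"
proof -
  have "u \<in> cls v \<longleftrightarrow> u - v \<in> N"
    using subgroup.rcos_module[OF N_subgroup F_group assms(2,1)] assms by (simp add: F_simps)
  moreover have "u \<in> cls v \<longleftrightarrow> cls u = cls v"
    using assms group.repr_independence[OF F_group _ _ N_subgroup]
      group.rcos_self[OF F_group _ N_subgroup] by metis
  ultimately show ?thesis by simp
qed

lemma T_simps:
  "carrier T = cls ` carrier F" "\<zero>\<^bsub>T\<^esub> = cls 0"
  "\<lbrakk>u \<in> carrier F; v \<in> carrier F\<rbrakk> \<Longrightarrow> cls u \<oplus>\<^bsub>T\<^esub> cls v = cls (u + v)"
proof -
  show "carrier T = cls ` carrier F"
    by (auto simp: extend_scalars_def Let_def FactGroup_def RCOSETS_def)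
  have "cls 0 = N"
    using group.coset_join2[OF F_group F_closed(1) N_subgroup] subgroup.one_closed[OF N_subgroup]
    by (simp add: F_simps)
  then show "\<zero>\<^bsub>T\<^esub> = cls 0"
    by (simp add: extend_scalars_def Let_def FactGroup_def)
  show "cls u \<oplus>\<^bsub>T\<^esub> cls v = cls (u + v)" if "u \<in> carrier F" "v \<in> carrier F"
    using normal.rcos_sum[OF N_normal that]
    by (simp add: extend_scalars_def Let_def FactGroup_def F_simps)
qed

lemma T_abelian_group: "abelian_group T"
proof (rule abelian_groupI)
  fix x y z assume "x \<in> carrier T" "y \<in> carrier T" "z \<in> carrier T"
  then obtain u v w where *: "x = cls u" "y = cls v" "z = cls w"
    "u \<in> carrier F" "v \<in> carrier F" "w \<in> carrier F"
    by (auto simp: T_simps)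
  show "x \<oplus>\<^bsub>T\<^esub> y \<in> carrier T" "x \<oplus>\<^bsub>T\<^esub> y \<oplus>\<^bsub>T\<^esub> z = x \<oplus>\<^bsub>T\<^esub> (y \<oplus>\<^bsub>T\<^esub> z)"
    "x \<oplus>\<^bsub>T\<^esub> y = y \<oplus>\<^bsub>T\<^esub> x" "\<zero>\<^bsub>T\<^esub> \<oplus>\<^bsub>T\<^esub> x = x"
    using * by (auto simp: T_simps F_closed ac_simps)
  show "\<exists>y\<in>carrier T. y \<oplus>\<^bsub>T\<^esub> x = \<zero>\<^bsub>T\<^esub>"
    using * by (intro bexI[of _ "cls (- u)"]) (auto simp: T_simps F_closed)
qed (use F_closed in \<open>auto simp: T_simps\<close>)

sublocale T: abelian_group T
  by (rule T_abelian_group)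

lemma T_neg: "u \<in> carrier F \<Longrightarrow> \<ominus>\<^bsub>T\<^esub> cls u = cls (- u)"
  by (rule T.minus_equality) (auto simp: T_simps F_closed)

lemma tens_closed [intro]: "\<lbrakk>x \<in> carrier M; s \<in> carrier S\<rbrakk> \<Longrightarrow> tens x s \<in> carrier T"
  by (auto simp: tens_def T_simps F_closed)

lemma rels_in_N: "u \<in> tensor_rels A S \<phi> M \<Longrightarrow> u \<in> N"
  unfolding tensor_null_def by (rule generate.incl)

lemma tens_add_left:
  assumes "x \<in> carrier M" "y \<in> carrier M" "s \<in> carrier S"
  shows "tens (x \<oplus>\<^bsub>M\<^esub> y) s = tens x s \<oplus>\<^bsub>T\<^esub> tens y s"
proof -
  have "frag_of (x \<oplus>\<^bsub>M\<^esub> y, s) - (frag_of (x, s) + frag_of (y, s)) \<in> N"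
    by (rule rels_in_N) (use assms in \<open>fastforce simp: tensor_rels_def algebra_simps\<close>)
  then show ?thesis
    using assms by (simp add: tens_def T_simps F_closed cls_eq_iff)
qed

lemma tens_add_right:
  assumes "x \<in> carrier M" "s \<in> carrier S" "t \<in> carrier S"
  shows "tens x (s \<oplus>\<^bsub>S\<^esub> t) = tens x s \<oplus>\<^bsub>T\<^esub> tens x t"
proof -
  have "frag_of (x, s \<oplus>\<^bsub>S\<^esub> t) - (frag_of (x, s) + frag_of (x, t)) \<in> N"
    by (rule rels_in_N) (use assms in \<open>fastforce simp: tensor_rels_def algebra_simps\<close>)
  then show ?thesis
    using assms by (simp add: tens_def T_simps F_closed cls_eq_iff)
qed

lemma tens_balanced:
  assumes "x \<in> carrier M" "s \<in> carrier S" "a \<in> carrier A"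
  shows "tens (a \<odot>\<^bsub>M\<^esub> x) s = tens x (\<phi> a \<otimes>\<^bsub>S\<^esub> s)"
proof -
  have "frag_of (a \<odot>\<^bsub>M\<^esub> x, s) - frag_of (x, \<phi> a \<otimes>\<^bsub>S\<^esub> s) \<in> N"
    by (rule rels_in_N) (use assms in \<open>fastforce simp: tensor_rels_def\<close>)
  then show ?thesis
    using assms by (simp add: tens_def F_closed cls_eq_iff M.smult_closed phi_closed)
qed

lemma tens_left_additive: "s \<in> carrier S \<Longrightarrow> additive_map M T (\<lambda>x. tens x s)"
  by (rule additive_mapI)
    (auto simp: tens_add_left T_abelian_group M.M.abelian_group_axioms)

lemma tens_right_additive: "x \<in> carrier M \<Longrightarrow> additive_map S T (\<lambda>s. tens x s)"
  by (rule additive_mapI)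
    (auto simp: tens_add_right T_abelian_group S.abelian_group_axioms)

text \<open>Zero is 0 \<otimes> 0 and the negative of x \<otimes> s is (-x) \<otimes> s, so sums of
  elementary tensors exhaust the tensor product and neither zero nor negation needs a case of its
  own.\<close>

lemma T_induct [consumes 1, case_names tens add]:
  assumes U: "U \<in> carrier T"
    and tens: "\<And>x s. \<lbrakk>x \<in> carrier M; s \<in> carrier S\<rbrakk> \<Longrightarrow> P (tens x s)"
    and add: "\<And>U V. \<lbrakk>U \<in> carrier T; V \<in> carrier T; P U; P V\<rbrakk> \<Longrightarrow> P (U \<oplus>\<^bsub>T\<^esub> V)"
  shows "P U"
proof -
  obtain u where u: "u \<in> carrier F" "U = cls u"
    using U by (auto simp: T_simps)
  have neg: "P (\<ominus>\<^bsub>T\<^esub> tens x s)" if "x \<in> carrier M" "s \<in> carrier S" for x s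
    using tens[of "\<ominus>\<^bsub>M\<^esub> x" s] additive_map_neg[OF tens_left_additive] that by simp
  have "Poly_Mapping.keys u \<subseteq> carrier M \<times> carrier S"
    using u by (simp add: tensor_gens_def)
  \<comment> \<open>The induction rule for free Abelian groups builds differences, so the claim is
    carried for u and -u together.\<close>
  then have "u \<in> carrier F \<and> P (cls u) \<and> P (cls (- u))"
  proof (induction u rule: frag_induction)
    case zero
    have "tens \<zero>\<^bsub>M\<^esub> \<zero>\<^bsub>S\<^esub> = \<zero>\<^bsub>T\<^esub>"
      by (rule additive_map_zero[OF tens_left_additive]) simp
    then have "P (cls 0)"
      using tens[of "\<zero>\<^bsub>M\<^esub>" "\<zero>\<^bsub>S\<^esub>"] by (simp add: T_simps)
    then show ?case by (simp add: F_closed)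
  next
    case (diff u v)
    then have "P (cls u \<oplus>\<^bsub>T\<^esub> cls (- v))" "P (cls (- u) \<oplus>\<^bsub>T\<^esub> cls v)"
      by (simp_all add: add T_simps(1) F_closed)
    then show ?case
      using diff by (simp add: T_simps F_closed add.commute)
  next
    case (one a)
    then show ?case
      using tens neg by (cases a) (auto simp: tens_def T_neg F_closed)
  qed
  then show ?thesis using u by simp
qed

text \<open>Representatives of one coset differ by an element of \<open>N\<close>, which is sent
  into L, so their images lie in one coset. The union through which maps act on cosets is therefore
  this single coset.\<close>

lemma cls_map:
  assumes B: "subgroup L (free_Abelian_group B)"
    and \<kappa>: "\<And>x s. \<lbrakk>x \<in> carrier M; s \<in> carrier S\<rbrakk> \<Longrightarrow> \<kappa> (x, s) \<in> carrier (free_Abelian_group B)"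
    and rel: "\<And>u. u \<in> tensor_rels A S \<phi> M \<Longrightarrow> frag_extend \<kappa> u \<in> L"
    and u: "u \<in> carrier F"
  shows "(\<Union>v\<in>cls u. L #>\<^bsub>free_Abelian_group B\<^esub> frag_extend \<kappa> v) =
         L #>\<^bsub>free_Abelian_group B\<^esub> frag_extend \<kappa> u"
proof -
  let ?B = "free_Abelian_group B"
  have closed: "frag_extend \<kappa> v \<in> carrier ?B" if "v \<in> carrier F" for v
  proof -
    have "Poly_Mapping.keys v \<subseteq> carrier M \<times> carrier S"
      using that by (simp add: tensor_gens_def)
    then have "(\<Union>p\<in>Poly_Mapping.keys v. Poly_Mapping.keys (\<kappa> p)) \<subseteq> B"
      using \<kappa> unfolding carrier_free_Abelian_group_iff by blast
    then show ?thesis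
      using keys_frag_extend[of \<kappa> v]
      unfolding carrier_free_Abelian_group_iff by (rule subset_trans[rotated])
  qed
  have "L #>\<^bsub>?B\<^esub> frag_extend \<kappa> v = L #>\<^bsub>?B\<^esub> frag_extend \<kappa> u" if v: "v \<in> cls u" for v
  proof -
    have vF: "v \<in> carrier F"
      using v monoid.r_coset_subset_G[OF group.is_monoid[OF F_group] subgroup.subset[OF N_subgroup] u] by blast
    have "v - u \<in> N"
      using subgroup.rcos_module[OF N_subgroup F_group u vF] v u by (simp add: F_simps)
    then have "frag_extend \<kappa> (v - u) \<in> L"
      using frag_map_null[OF rel _ B] rels_subset
      unfolding tensor_null_def tensor_gens_def by blast
    then have "frag_extend \<kappa> v \<otimes>\<^bsub>?B\<^esub> inv\<^bsub>?B\<^esub> frag_extend \<kappa> u \<in> L"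
      using closed[OF u] by (simp add: frag_extend_diff)
    then have "frag_extend \<kappa> v \<in> L #>\<^bsub>?B\<^esub> frag_extend \<kappa> u"
      using subgroup.rcos_module[OF B _ closed[OF u] closed[OF vF]] by simp
    then show ?thesis
      using group.repr_independence[OF _ _ closed[OF u] B] by simp
  qed
  moreover have "u \<in> cls u"
    by (rule group.rcos_self[OF F_group u N_subgroup])
  ultimately show ?thesis by blast
qed

text \<open>The universal property for balanced biadditive maps: the map from the free Abelian group
  kills the three families of relations and factors through the quotient. Only an additive map
  results; linearity is checked afterwards on elementary tensors.\<close>

lemma tens_lift:
  fixes G :: "('g, 'h) ring_scheme"
  assumes G: "abelian_group G"
    and cl: "\<And>x s. \<lbrakk>x \<in> carrier M; s \<in> carrier S\<rbrakk> \<Longrightarrow> \<beta> x s \<in> carrier G"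
    and l: "\<And>x y s. \<lbrakk>x \<in> carrier M; y \<in> carrier M; s \<in> carrier S\<rbrakk> \<Longrightarrow>
              \<beta> (x \<oplus>\<^bsub>M\<^esub> y) s = \<beta> x s \<oplus>\<^bsub>G\<^esub> \<beta> y s"
    and r: "\<And>x s t. \<lbrakk>x \<in> carrier M; s \<in> carrier S; t \<in> carrier S\<rbrakk> \<Longrightarrow>
              \<beta> x (s \<oplus>\<^bsub>S\<^esub> t) = \<beta> x s \<oplus>\<^bsub>G\<^esub> \<beta> x t"
    and b: "\<And>a x s. \<lbrakk>a \<in> carrier A; x \<in> carrier M; s \<in> carrier S\<rbrakk> \<Longrightarrow>
              \<beta> (a \<odot>\<^bsub>M\<^esub> x) s = \<beta> x (\<phi> a \<otimes>\<^bsub>S\<^esub> s)"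
  obtains h where "additive_map T G h"
    "\<And>x s. \<lbrakk>x \<in> carrier M; s \<in> carrier S\<rbrakk> \<Longrightarrow> h (tens x s) = \<beta> x s"
proof -
  interpret G: abelian_group G by (rule G)
  have comm: "comm_group (add_monoid G)" by (rule G.a_comm_group)
  obtain h where hom: "h \<in> hom F (add_monoid G)"
    and h: "\<And>p. p \<in> carrier M \<times> carrier S \<Longrightarrow> h (frag_of p) = (case p of (x, s) \<Rightarrow> \<beta> x s)"
  proof (rule comm_group.free_Abelian_group_universal
      [OF comm, of "\<lambda>(x, s). \<beta> x s" "carrier M \<times> carrier S"])
    show "(\<lambda>(x, s). \<beta> x s) ` (carrier M \<times> carrier S) \<subseteq> carrier (add_monoid G)"
      using cl by auto
  qed (auto simp: tensor_gens_def)
  interpret h: group_hom F "add_monoid G" h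
    by (simp add: group_hom_def group_hom_axioms_def F_group hom G.a_group)
  have h_add: "h (u + v) = h u \<oplus>\<^bsub>G\<^esub> h v" if "u \<in> carrier F" "v \<in> carrier F" for u v
    using h.hom_mult[OF that] by (simp add: F_simps)
  have h_cl: "h u \<in> carrier G" if "u \<in> carrier F" for u
    using h.hom_closed[OF that] by simp
  have h_0: "h 0 = \<zero>\<^bsub>G\<^esub>"
    using h.hom_one by (simp add: F_simps)
  have h_diff: "h (u - v) = h u \<ominus>\<^bsub>G\<^esub> h v" if "u \<in> carrier F" "v \<in> carrier F" for u v
  proof -
    have "h (u - v) \<oplus>\<^bsub>G\<^esub> h v = h u"
      using h_add[of "u - v" v] that by (simp add: F_closed)
    then have "h u \<ominus>\<^bsub>G\<^esub> h v = h (u - v) \<oplus>\<^bsub>G\<^esub> h v \<ominus>\<^bsub>G\<^esub> h v"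
      by simp
    then show ?thesis
      using h_cl that F_closed(5)[OF that] by (simp add: a_minus_def G.a_assoc G.r_neg)
  qed
  have cancel: "c \<oplus>\<^bsub>G\<^esub> d \<ominus>\<^bsub>G\<^esub> c \<ominus>\<^bsub>G\<^esub> d = \<zero>\<^bsub>G\<^esub>" if "c \<in> carrier G" "d \<in> carrier G" for c d
  proof -
    have "c \<oplus>\<^bsub>G\<^esub> d \<ominus>\<^bsub>G\<^esub> c = d \<oplus>\<^bsub>G\<^esub> (c \<ominus>\<^bsub>G\<^esub> c)"
      using that by (simp add: a_minus_def G.a_ac)
    then show ?thesis
      using that by (simp add: a_minus_def G.r_neg)
  qed
  have "h u = \<zero>\<^bsub>G\<^esub>" if "u \<in> tensor_rels A S \<phi> M" for u
    using that
  proof (cases rule: tensor_rels_cases)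
    case (left x y s)
    then show ?thesis by (simp add: h_diff F_closed h cl l cancel)
  next
    case (right x s t)
    then show ?thesis by (simp add: h_diff F_closed h cl r cancel)
  next
    case (balanced a x s)
    then show ?thesis
      by (simp add: h_diff F_closed h cl b phi_closed M.smult_closed a_minus_def G.r_neg)
  qed
  then have "tensor_rels A S \<phi> M \<subseteq> kernel F (add_monoid G) h"
    using rels_subset by (auto simp: kernel_def)
  then have "N \<subseteq> kernel F (add_monoid G) h"
    unfolding tensor_null_def
    by (rule group.generate_subgroup_incl[OF F_group _ h.subgroup_kernel])
  then obtain g where g: "g \<in> hom (F Mod N) (add_monoid G)" "\<And>u. u \<in> carrier F \<Longrightarrow> g (cls u) = h u"
    using h.FactGroup_universal_kernel[OF N_normal] by metis
  show thesis
  proof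
    show "additive_map T G g"
      by (rule additive_mapI) (auto simp: T_abelian_group G T_simps g F_closed h_cl h_add)
    show "g (tens x s) = \<beta> x s" if "x \<in> carrier M" "s \<in> carrier S" for x s
      using that by (simp add: tens_def g F_closed h)
  qed
qed

text \<open>Multiplying second factors by t from the right turns each relation into a relation of
  the same kind, so \<open>cls_map\<close> applies.\<close>

lemma T_smult_cls:
  assumes "t \<in> carrier S" "u \<in> carrier F"
  shows "t \<odot>\<^bsub>T\<^esub> cls u = cls (frag_extend (\<lambda>(x, s). frag_of (x, s \<otimes>\<^bsub>S\<^esub> t)) u)"
proof -
  let ?\<kappa> = "\<lambda>(x, s). frag_of (x, s \<otimes>\<^bsub>S\<^esub> t)"
  have "frag_extend ?\<kappa> u \<in> N" if "u \<in> tensor_rels A S \<phi> M" for u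
  proof (rule rels_in_N)
    show "frag_extend ?\<kappa> u \<in> tensor_rels A S \<phi> M"
      using that
    proof (cases rule: tensor_rels_cases)
      case (left x y s)
      then show ?thesis
        using assms(1) tensor_rels_intros(1)[of x M y "s \<otimes>\<^bsub>S\<^esub> t" S A \<phi>]
        by (simp add: frag_extend_diff)
    next
      case (right x s s')
      then show ?thesis
        using assms(1) tensor_rels_intros(2)[of x M "s \<otimes>\<^bsub>S\<^esub> t" S "s' \<otimes>\<^bsub>S\<^esub> t" A \<phi>]
        by (simp add: frag_extend_diff S.l_distr)
    next
      case (balanced a x s)
      then show ?thesis
        using assms(1) tensor_rels_intros(3)[of a A x M "s \<otimes>\<^bsub>S\<^esub> t" S \<phi>]
        by (simp add: frag_extend_diff S.m_assoc phi_closed)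
    qed
  qed
  then show ?thesis
    using cls_map[OF N_subgroup[unfolded tensor_gens_def], of ?\<kappa> u] assms
    by (simp add: extend_scalars_def Let_def flip: tensor_gens_def) (simp add: F_closed)
qed

lemma frag_extend_closed:
  assumes "t \<in> carrier S" "u \<in> carrier F"
  shows "frag_extend (\<lambda>(x, s). frag_of (x, s \<otimes>\<^bsub>S\<^esub> t)) u \<in> carrier F"
proof -
  have "Poly_Mapping.keys u \<subseteq> carrier M \<times> carrier S"
    using assms by (simp add: tensor_gens_def)
  then have "(\<Union>p\<in>Poly_Mapping.keys u. Poly_Mapping.keys (case p of (x, s) \<Rightarrow> frag_of (x, s \<otimes>\<^bsub>S\<^esub> t)))
      \<subseteq> carrier M \<times> carrier S"
    using assms(1) by fastforce
  then show ?thesis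
    using keys_frag_extend[of "\<lambda>(x, s). frag_of (x, s \<otimes>\<^bsub>S\<^esub> t)" u]
    unfolding tensor_gens_def carrier_free_Abelian_group_iff by (rule subset_trans[rotated])
qed

lemma T_smult_tens:
  "\<lbrakk>t \<in> carrier S; x \<in> carrier M; s \<in> carrier S\<rbrakk> \<Longrightarrow> t \<odot>\<^bsub>T\<^esub> tens x s = tens x (s \<otimes>\<^bsub>S\<^esub> t)"
  by (simp add: tens_def T_smult_cls F_closed)

lemma T_smult_additive: "t \<in> carrier S \<Longrightarrow> additive_map T T (\<lambda>U. t \<odot>\<^bsub>T\<^esub> U)"
proof (rule additive_mapI)
  assume t: "t \<in> carrier S"
  fix U V assume "U \<in> carrier T" "V \<in> carrier T"
  then obtain u v where "U = cls u" "V = cls v" "u \<in> carrier F" "v \<in> carrier F"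
    by (auto simp: T_simps(1))
  then show "t \<odot>\<^bsub>T\<^esub> U \<in> carrier T" "t \<odot>\<^bsub>T\<^esub> (U \<oplus>\<^bsub>T\<^esub> V) = t \<odot>\<^bsub>T\<^esub> U \<oplus>\<^bsub>T\<^esub> t \<odot>\<^bsub>T\<^esub> V"
    using t
    by (simp_all add: T_simps(1,3) T_smult_cls frag_extend_closed F_closed frag_extend_add)
qed (rule T_abelian_group)+

lemma T_right_module: "right_module S T"
proof (unfold_locales)
  show cl: "a \<odot>\<^bsub>T\<^esub> x \<in> carrier T" if "a \<in> carrier S" "x \<in> carrier T" for a x
    using additive_map_closed[OF T_smult_additive] that by simp
  show add_T: "a \<odot>\<^bsub>T\<^esub> (x \<oplus>\<^bsub>T\<^esub> y) = a \<odot>\<^bsub>T\<^esub> x \<oplus>\<^bsub>T\<^esub> a \<odot>\<^bsub>T\<^esub> y"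
    if "a \<in> carrier S" "x \<in> carrier T" "y \<in> carrier T" for a x y
    using additive_map_add[OF T_smult_additive] that by simp
  show "(a \<oplus>\<^bsub>S\<^esub> b) \<odot>\<^bsub>T\<^esub> x = a \<odot>\<^bsub>T\<^esub> x \<oplus>\<^bsub>T\<^esub> b \<odot>\<^bsub>T\<^esub> x"
    if "a \<in> carrier S" "b \<in> carrier S" "x \<in> carrier T" for a b x
    using that(3)
  proof (induction rule: T_induct)
    case (tens x s)
    then show ?case using that by (simp add: T_smult_tens S.r_distr tens_add_right)
  next
    case (add U V)
    then show ?case using that cl[of a] cl[of b] by (simp add: add_T T.a_ac)
  qed
  show "(a \<otimes>\<^bsub>S\<^esub> b) \<odot>\<^bsub>T\<^esub> x = b \<odot>\<^bsub>T\<^esub> (a \<odot>\<^bsub>T\<^esub> x)"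
    if "a \<in> carrier S" "b \<in> carrier S" "x \<in> carrier T" for a b x
    using that(3)
  proof (induction rule: T_induct)
    case (tens x s)
    then show ?case using that by (simp add: T_smult_tens S.m_assoc)
  next
    case (add U V)
    then show ?case using that cl[of a] cl[of b] by (simp add: add_T)
  qed
  show "\<one>\<^bsub>S\<^esub> \<odot>\<^bsub>T\<^esub> x = x" if "x \<in> carrier T" for x
    using that
  proof (induction rule: T_induct)
    case (tens x s)
    then show ?case by (simp add: T_smult_tens)
  next
    case (add U V)
    then show ?case by (simp add: add_T)
  qed
qed

sublocale T: right_module S T
  by (rule T_right_module)

end

section \<open>Maps induced on tensor products\<close>

locale tensor_map = M: tensor A S \<phi> M + M': tensor A S \<phi> M'
  for A :: "('a, 'r) ring_scheme" and S :: "('s, 't) ring_scheme" and \<phi> :: "'a \<Rightarrow> 's"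
    and M :: "('a, 'm) module" and M' :: "('a, 'p) module" +
  fixes h :: "'m \<Rightarrow> 'p"
  assumes hom: "h \<in> rmod_hom A M M'"
begin

lemma extend_map_cls:
  assumes "u \<in> carrier M.F"
  shows "extend_map A S \<phi> M' h (M.cls u) = M'.cls (frag_extend (\<lambda>(x, s). frag_of (h x, s)) u)"
proof -
  let ?\<kappa> = "\<lambda>(x, s). frag_of (h x, s)"
  have "frag_extend ?\<kappa> u \<in> M'.N" if "u \<in> tensor_rels A S \<phi> M" for u
  proof (rule M'.rels_in_N)
    show "frag_extend ?\<kappa> u \<in> tensor_rels A S \<phi> M'"
      using that
    proof (cases rule: tensor_rels_cases)
      case (left x y s)
      then show ?thesis
        using tensor_rels_intros(1)[of "h x" M' "h y" s S A \<phi>]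
        by (simp add: frag_extend_diff rmod_homD[OF hom])
    next
      case (right x s s')
      then show ?thesis
        using tensor_rels_intros(2)[of "h x" M' s S s' A \<phi>]
        by (simp add: frag_extend_diff rmod_homD[OF hom])
    next
      case (balanced a x s)
      then show ?thesis
        using tensor_rels_intros(3)[of a A "h x" M' s S \<phi>]
        by (simp add: frag_extend_diff rmod_homD[OF hom])
    qed
  qed
  then show ?thesis
    unfolding extend_map_def tensor_gens_def[of M' S]
    by (intro M.cls_map assms M'.N_subgroup[unfolded tensor_gens_def])
      (simp_all add: rmod_homD(1)[OF hom])
qed

lemma extend_map_tens:
  "\<lbrakk>x \<in> carrier M; s \<in> carrier S\<rbrakk> \<Longrightarrow> extend_map A S \<phi> M' h (M.tens x s) = M'.tens (h x) s"
  unfolding M.tens_def M'.tens_def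
  by (subst extend_map_cls) (simp_all add: M.F_closed)

lemma extend_map_additive: "additive_map M.T M'.T (extend_map A S \<phi> M' h)"
proof -
  have cl: "frag_extend (\<lambda>(x, s). frag_of (h x, s)) u \<in> carrier M'.F" if "u \<in> carrier M.F" for u
  proof -
    have "Poly_Mapping.keys u \<subseteq> carrier M \<times> carrier S"
      using that by (simp add: tensor_gens_def)
    then have "Poly_Mapping.keys (case p of (x, s) \<Rightarrow> frag_of (h x, s)) \<subseteq> carrier M' \<times> carrier S"
      if "p \<in> Poly_Mapping.keys u" for p
      using that rmod_homD(1)[OF hom, of "fst p"] by (cases p) auto
    then have "(\<Union>p\<in>Poly_Mapping.keys u. Poly_Mapping.keys (case p of (x, s) \<Rightarrow> frag_of (h x, s)))
        \<subseteq> carrier M' \<times> carrier S"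
      by (rule UN_least)
    then show ?thesis
      using keys_frag_extend[of "\<lambda>(x, s). frag_of (h x, s)" u]
      unfolding tensor_gens_def carrier_free_Abelian_group_iff by (rule subset_trans[rotated])
  qed
  show ?thesis
  proof (rule additive_mapI)
    fix U V assume "U \<in> carrier M.T" "V \<in> carrier M.T"
    then obtain u v where "U = M.cls u" "V = M.cls v" "u \<in> carrier M.F" "v \<in> carrier M.F"
      by (auto simp: M.T_simps(1))
    then show "extend_map A S \<phi> M' h U \<in> carrier M'.T"
      "extend_map A S \<phi> M' h (U \<oplus>\<^bsub>M.T\<^esub> V) = extend_map A S \<phi> M' h U \<oplus>\<^bsub>M'.T\<^esub> extend_map A S \<phi> M' h V"
      by (simp_all add: M.T_simps(3) M'.T_simps(1,3) extend_map_cls cl M.F_closed frag_extend_add)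
  qed (rule M.T_abelian_group M'.T_abelian_group)+
qed

lemma extend_map_hom: "extend_map A S \<phi> M' h \<in> rmod_hom S M.T M'.T"
proof (rule rmod_homI)
  show "extend_map A S \<phi> M' h (a \<odot>\<^bsub>M.T\<^esub> U) = a \<odot>\<^bsub>M'.T\<^esub> extend_map A S \<phi> M' h U"
    if "a \<in> carrier S" "U \<in> carrier M.T" for a U
    using that(2)
  proof (induction rule: M.T_induct)
    case (tens x s)
    then show ?case
      using that(1) rmod_homD(1)[OF hom, of x]
      by (simp add: M.T_smult_tens M'.T_smult_tens extend_map_tens)
  next
    case (add U V)
    then show ?case
      using that(1)
      by (simp add: additive_map_add[OF extend_map_additive] additive_map_closed[OF extend_map_additive]
        M.T.smult_r_distr M'.T.smult_r_distr M.T.smult_closed)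
  qed
qed (simp_all add: additive_map_add[OF extend_map_additive] additive_map_closed[OF extend_map_additive])

end

section \<open>Novikov rings\<close>

text \<open>Boxes serve as the common finite index sets for coefficients of products in the Novikov
  ring.\<close>

lemma finite_vec_box: "finite {b :: int ^ 'n::finite. \<forall>i. lo i \<le> b $ i \<and> b $ i \<le> hi i}"
proof (rule finite_subset)
  show "{b :: int ^ 'n. \<forall>i. lo i \<le> b $ i \<and> b $ i \<le> hi i} \<subseteq>
        vec_lambda ` (\<Pi>\<^sub>E i\<in>UNIV. {lo i..hi i})"
  proof
    fix b :: "int ^ 'n"
    assume "b \<in> {b. \<forall>i. lo i \<le> b $ i \<and> b $ i \<le> hi i}"
    then show "b \<in> vec_lambda ` (\<Pi>\<^sub>E i\<in>UNIV. {lo i..hi i})"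
      by (intro image_eqI[of _ _ "vec_nth b"]) (auto simp: vec_nth_inverse)
  qed
  show "finite (vec_lambda ` (\<Pi>\<^sub>E i\<in>UNIV. {lo i..hi i}) :: (int ^ 'n) set)"
    by (intro finite_imageI finite_PiE) auto
qed

lemma (in abelian_monoid) finsum_swap:
  assumes "finite A" "finite B" "\<And>a b. \<lbrakk>a \<in> A; b \<in> B\<rbrakk> \<Longrightarrow> f a b \<in> carrier G"
  shows "(\<Oplus>a\<in>A. \<Oplus>b\<in>B. f a b) = (\<Oplus>b\<in>B. \<Oplus>a\<in>A. f a b)"
  using assms(1,3)
proof (induction A rule: finite_induct)
  case (insert a A)
  have "(\<Oplus>b\<in>B. \<Oplus>a\<in>insert a A. f a b) = (\<Oplus>b\<in>B. f a b \<oplus> (\<Oplus>a\<in>A. f a b))"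
    using insert by (intro finsum_cong') (auto intro!: finsum_insert finsum_closed)
  also have "\<dots> = (\<Oplus>b\<in>B. f a b) \<oplus> (\<Oplus>b\<in>B. \<Oplus>a\<in>A. f a b)"
    using insert by (intro finsum_addf) (auto intro!: finsum_closed)
  finally show ?case
    using insert by (subst finsum_insert) (auto intro!: finsum_closed)
qed simp

definition supp_bound :: "('a, 'r) ring_scheme \<Rightarrow> int \<Rightarrow> (int ^ 'n \<Rightarrow> 'a) \<Rightarrow> bool" where
  "supp_bound R k f \<longleftrightarrow> (\<forall>a. f a \<noteq> \<zero>\<^bsub>R\<^esub> \<longrightarrow> (\<forall>i. - k \<le> a $ i))"

lemma supp_bound_mono: "\<lbrakk>supp_bound R k f; k \<le> l\<rbrakk> \<Longrightarrow> supp_bound R l f"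
  unfolding supp_bound_def by (meson minus_le_iff neg_le_iff_le order_trans)

definition monomial :: "('a, 'r) ring_scheme \<Rightarrow> int ^ 'n \<Rightarrow> 'a \<Rightarrow> (int ^ 'n \<Rightarrow> 'a)" where
  "monomial R a r = (\<lambda>b. if b = a then r else \<zero>\<^bsub>R\<^esub>)"

text \<open>The coefficient functions of R((Y)). The variable Y is kept apart from the exponent
  vectors; \<open>series_in\<close> substitutes one of the x_i for it.\<close>

definition laurent_series :: "('a, 'r) ring_scheme \<Rightarrow> (int \<Rightarrow> 'a) set" where
  "laurent_series R = {\<phi>. range \<phi> \<subseteq> carrier R \<and> (\<exists>k. \<forall>l<k. \<phi> l = \<zero>\<^bsub>R\<^esub>)}"

text \<open>The substitution of x_i for Y; the test on \<open>a\<close> says that the exponent lies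
  on the axis of x_i.\<close>

definition series_in :: "('a, 'r) ring_scheme \<Rightarrow> 'n \<Rightarrow> (int \<Rightarrow> 'a) \<Rightarrow> (int ^ 'n \<Rightarrow> 'a)" where
  "series_in R i \<phi> = (\<lambda>a. if a = axis i (a $ i) then \<phi> (a $ i) else \<zero>\<^bsub>R\<^esub>)"

context ring
begin

abbreviation "Nov \<equiv> novikov_ring R :: (int ^ 'n::finite \<Rightarrow> 'a) ring"
abbreviation "Lau \<equiv> laurent_ring R :: (int ^ 'n::finite \<Rightarrow> 'a) ring"

lemma Nov_simps:
  "\<one>\<^bsub>Nov\<^esub> = monomial R 0 \<one>" "\<zero>\<^bsub>Nov\<^esub> = (\<lambda>a. \<zero>)" "f \<oplus>\<^bsub>Nov\<^esub> g = (\<lambda>a. f a \<oplus> g a)"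
  by (simp_all add: novikov_ring_def monomial_def)

lemma Lau_simps:
  "\<one>\<^bsub>Lau\<^esub> = \<one>\<^bsub>Nov\<^esub>" "\<zero>\<^bsub>Lau\<^esub> = \<zero>\<^bsub>Nov\<^esub>" "f \<oplus>\<^bsub>Lau\<^esub> g = f \<oplus>\<^bsub>Nov\<^esub> g" "f \<otimes>\<^bsub>Lau\<^esub> g = f \<otimes>\<^bsub>Nov\<^esub> g"
  by (simp_all add: laurent_ring_def)

lemma Nov_carrier_iff:
  fixes f :: "int ^ 'n::finite \<Rightarrow> 'a"
  shows "f \<in> carrier Nov \<longleftrightarrow> (\<forall>a. f a \<in> carrier R) \<and> (\<exists>k. supp_bound R k f)"
proof -
  \<comment> \<open>A negative bound weakens to 0, so integer and natural bounds describe the same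
    series.\<close>
  have "supp_bound R (int (nat k)) f" if "supp_bound R k f" for k
    by (rule supp_bound_mono[OF that]) simp
  moreover have "(\<forall>a\<in>supp R f. \<forall>i. 0 \<le> int k + a $ i) \<longleftrightarrow> supp_bound R (int k) f" for k
  proof -
    have "0 \<le> int k + x \<longleftrightarrow> - int k \<le> x" for x by linarith
    then show ?thesis by (simp add: supp_bound_def supp_def)
  qed
  ultimately have "(\<exists>k::nat. \<forall>a\<in>supp R f. \<forall>i. 0 \<le> int k + a $ i) \<longleftrightarrow> (\<exists>k. supp_bound R k f)"
    by blast
  then show ?thesis
    by (auto simp: novikov_ring_def)
qed

lemma Lau_carrier_iff: "f \<in> carrier Lau \<longleftrightarrow> (\<forall>a. f a \<in> carrier R) \<and> finite {a. f a \<noteq> \<zero>}"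
  by (auto simp: laurent_ring_def supp_def)

lemma Nov_closed: "f \<in> carrier Nov \<Longrightarrow> f a \<in> carrier R"
  by (simp add: Nov_carrier_iff)

lemma Lau_closed: "f \<in> carrier Lau \<Longrightarrow> f a \<in> carrier R"
  by (simp add: Lau_carrier_iff)

lemma Lau_subset_Nov:
  assumes "f \<in> carrier Lau" shows "f \<in> carrier Nov"
proof -
  let ?S = "insert 0 ((\<lambda>(a, i). - a $ i) ` ({a. f a \<noteq> \<zero>} \<times> UNIV))"
  have "finite ?S" using assms by (simp add: Lau_carrier_iff)
  then have "- a $ i \<le> Max ?S" if "f a \<noteq> \<zero>" for a i
    using that by (intro Max_ge) auto
  then have "supp_bound R (Max ?S) f"
    unfolding supp_bound_def by (meson minus_le_iff)
  then show ?thesis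
    using assms by (auto simp: Nov_carrier_iff Lau_carrier_iff)
qed

text \<open>The set over which a product is summed depends on both factors. Replacing it by any
  finite superset allows sums for different factors to be compared term by term.\<close>

lemma Nov_mult_eq:
  fixes f g :: "int ^ 'n::finite \<Rightarrow> 'a"
  assumes f: "\<And>a. f a \<in> carrier R" and g: "\<And>a. g a \<in> carrier R" and B: "finite B"
    and sub: "\<And>b. \<lbrakk>f b \<noteq> \<zero>; g (a - b) \<noteq> \<zero>\<rbrakk> \<Longrightarrow> b \<in> B"
  shows "(f \<otimes>\<^bsub>Nov\<^esub> g) a = (\<Oplus>b\<in>B. f b \<otimes> g (a - b))"
proof -
  have "(f \<otimes>\<^bsub>Nov\<^esub> g) a = (\<Oplus>b\<in>{b. b \<in> supp R f \<and> a - b \<in> supp R g}. f b \<otimes> g (a - b))"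
    by (simp add: novikov_ring_def)
  also have "\<dots> = (\<Oplus>b\<in>B. f b \<otimes> g (a - b))"
  proof (rule add.finprod_mono_neutral_cong_left[OF B])
    show "{b. b \<in> supp R f \<and> a - b \<in> supp R g} \<subseteq> B"
      using sub by (auto simp: supp_def)
    show "f b \<otimes> g (a - b) = \<zero>" if "b \<in> B - {b. b \<in> supp R f \<and> a - b \<in> supp R g}" for b
      using that f[of b] g[of "a - b"] by (auto simp: supp_def)
  qed (auto simp: f g)
  finally show ?thesis .
qed

text \<open>From b \<ge> -m and a - b \<ge> -m follows b \<le> a + m in each coordinate. A bound m
  common to several series gives one box for all their products.\<close>

lemma Nov_mult_box:
  fixes f g :: "int ^ 'n::finite \<Rightarrow> 'a"
  assumes f: "\<And>a. f a \<in> carrier R" "supp_bound R k f" and g: "\<And>a. g a \<in> carrier R" "supp_bound R l g"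
    and "k \<le> m" "l \<le> m"
  shows "(f \<otimes>\<^bsub>Nov\<^esub> g) a = (\<Oplus>b\<in>{b. \<forall>i. - m \<le> b $ i \<and> b $ i \<le> a $ i + m}. f b \<otimes> g (a - b))"
proof (rule Nov_mult_eq[OF f(1) g(1) finite_vec_box])
  fix b assume "f b \<noteq> \<zero>" "g (a - b) \<noteq> \<zero>"
  then have "- k \<le> b $ i" "- l \<le> (a - b) $ i" for i
    using f g by (auto simp: supp_bound_def)
  then show "b \<in> {b. \<forall>i. - m \<le> b $ i \<and> b $ i \<le> a $ i + m}"
    using \<open>k \<le> m\<close> \<open>l \<le> m\<close> by (smt (verit) mem_Collect_eq vector_minus_component)
qed

lemma Nov_mult_bound:
  fixes f g :: "int ^ 'n::finite \<Rightarrow> 'a"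
  assumes f: "\<And>a. f a \<in> carrier R" "supp_bound R k f" and g: "\<And>a. g a \<in> carrier R" "supp_bound R l g"
  shows "(f \<otimes>\<^bsub>Nov\<^esub> g) a \<in> carrier R" "supp_bound R (k + l) (f \<otimes>\<^bsub>Nov\<^esub> g)"
proof -
  note eq = Nov_mult_box[OF f g, of "max k l"]
  show "(f \<otimes>\<^bsub>Nov\<^esub> g) a \<in> carrier R"
    unfolding eq[OF max.cobounded1 max.cobounded2] using f g by (intro finsum_closed) auto
  show "supp_bound R (k + l) (f \<otimes>\<^bsub>Nov\<^esub> g)"
    unfolding supp_bound_def
  proof (intro allI impI)
    fix a i assume nz: "(f \<otimes>\<^bsub>Nov\<^esub> g) a \<noteq> \<zero>"
    have "\<exists>b. f b \<noteq> \<zero> \<and> g (a - b) \<noteq> \<zero>"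
    proof (rule ccontr)
      assume "\<not> ?thesis"
      then have "(f \<otimes>\<^bsub>Nov\<^esub> g) a = (\<Oplus>b\<in>{}. f b \<otimes> g (a - b))"
        by (intro Nov_mult_eq) (auto simp: f g)
      then show False using nz by simp
    qed
    then obtain b where "f b \<noteq> \<zero>" "g (a - b) \<noteq> \<zero>" by blast
    then have "- k \<le> b $ i" "- l \<le> (a - b) $ i"
      using f g by (auto simp: supp_bound_def)
    then show "- (k + l) \<le> a $ i" by simp
  qed
qed

lemma Nov_mult_closed:
  fixes f g :: "int ^ 'n::finite \<Rightarrow> 'a"
  shows "\<lbrakk>f \<in> carrier Nov; g \<in> carrier Nov\<rbrakk> \<Longrightarrow> f \<otimes>\<^bsub>Nov\<^esub> g \<in> carrier Nov"
  unfolding Nov_carrier_iff using Nov_mult_bound by metis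

text \<open>Both bracketings equal the double sum of
  \<open>f c \<otimes> (g (b - c) \<otimes> h (a - b))\<close> over b and c in one finite box, where
  the order of summation can be exchanged.\<close>

lemma Nov_mult_assoc:
  fixes f g h :: "int ^ 'n::finite \<Rightarrow> 'a"
  assumes "f \<in> carrier Nov" "g \<in> carrier Nov" "h \<in> carrier Nov"
  shows "(f \<otimes>\<^bsub>Nov\<^esub> g) \<otimes>\<^bsub>Nov\<^esub> h = f \<otimes>\<^bsub>Nov\<^esub> (g \<otimes>\<^bsub>Nov\<^esub> h)"
proof
  fix a :: "int ^ 'n"
  note cl [simp] = assms[THEN Nov_closed]
  obtain kf kg kh where kk: "supp_bound R kf f" "supp_bound R kg g" "supp_bound R kh h"
    using assms by (auto simp: Nov_carrier_iff)
  define k where "k = max 0 (max kf (max kg kh))"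
  have k: "supp_bound R k f" "supp_bound R k g" "supp_bound R k h" and k0: "0 \<le> k"
    using kk by (auto intro: supp_bound_mono simp: k_def)
  \<comment> \<open>If c, b - c and a - b are all at least -k, then c lies between -k and a + 2k,
    and b between -2k and a + k. As k is nonnegative, 3k is a margin that covers both.\<close>
  define X where "X = {b. \<forall>i. - (3*k) \<le> b $ i \<and> b $ i \<le> a $ i + 3*k}"
  have X: "finite X" unfolding X_def by (rule finite_vec_box)
  have ge: "- k \<le> b $ i" if "f b \<noteq> \<zero> \<or> g b \<noteq> \<zero> \<or> h b \<noteq> \<zero>" for b i
    using that k by (auto simp: supp_bound_def)
  have mem: "c \<in> X \<and> b \<in> X" if "f c \<noteq> \<zero>" "g (b - c) \<noteq> \<zero>" "h (a - b) \<noteq> \<zero>" for b c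
  proof -
    have "- k \<le> c $ i" "- k \<le> b $ i - c $ i" "- k \<le> a $ i - b $ i" for i
      using ge[of c i] ge[of "b - c" i] ge[of "a - b" i] that by auto
    then have "- (3*k) \<le> c $ i \<and> c $ i \<le> a $ i + 3*k \<and> - (3*k) \<le> b $ i \<and> b $ i \<le> a $ i + 3*k" for i
      using k0 by (smt (verit))
    then show ?thesis by (simp add: X_def)
  qed
  have fg: "\<And>b. (f \<otimes>\<^bsub>Nov\<^esub> g) b \<in> carrier R" "\<And>b. (g \<otimes>\<^bsub>Nov\<^esub> h) b \<in> carrier R"
    using Nov_mult_bound(1) cl k by blast+
  have nz: "\<exists>c. f c \<noteq> \<zero> \<and> g (b - c) \<noteq> \<zero>" if "(f \<otimes>\<^bsub>Nov\<^esub> g) b \<noteq> \<zero>" for b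
  proof (rule ccontr)
    assume "\<not> ?thesis"
    then have "(f \<otimes>\<^bsub>Nov\<^esub> g) b = (\<Oplus>c\<in>{}. f c \<otimes> g (b - c))"
      by (intro Nov_mult_eq) auto
    then show False using that by simp
  qed
  have nz': "\<exists>d. g d \<noteq> \<zero> \<and> h (b - d) \<noteq> \<zero>" if "(g \<otimes>\<^bsub>Nov\<^esub> h) b \<noteq> \<zero>" for b
  proof (rule ccontr)
    assume "\<not> ?thesis"
    then have "(g \<otimes>\<^bsub>Nov\<^esub> h) b = (\<Oplus>c\<in>{}. g c \<otimes> h (b - c))"
      by (intro Nov_mult_eq) auto
    then show False using that by simp
  qed
  have "((f \<otimes>\<^bsub>Nov\<^esub> g) \<otimes>\<^bsub>Nov\<^esub> h) a = (\<Oplus>b\<in>X. (f \<otimes>\<^bsub>Nov\<^esub> g) b \<otimes> h (a - b))"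
  proof (rule Nov_mult_eq)
    fix b assume "(f \<otimes>\<^bsub>Nov\<^esub> g) b \<noteq> \<zero>" "h (a - b) \<noteq> \<zero>"
    then show "b \<in> X" using nz mem by blast
  qed (auto simp: X fg)
  also have "\<dots> = (\<Oplus>b\<in>X. \<Oplus>c\<in>X. f c \<otimes> (g (b - c) \<otimes> h (a - b)))"
  proof (rule finsum_cong')
    fix b assume "b \<in> X"
    show "(f \<otimes>\<^bsub>Nov\<^esub> g) b \<otimes> h (a - b) = (\<Oplus>c\<in>X. f c \<otimes> (g (b - c) \<otimes> h (a - b)))"
    \<comment> \<open>For such b the box may miss contributions to the inner product, but both sides
      vanish. The case distinction on \<open>f c\<close> below has the same purpose.\<close>
    proof (cases "h (a - b) = \<zero>")
      case True
      then show ?thesis by (simp add: fg)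
    next
      case False
      then have "(f \<otimes>\<^bsub>Nov\<^esub> g) b = (\<Oplus>c\<in>X. f c \<otimes> g (b - c))"
        using mem by (intro Nov_mult_eq X) auto
      then show ?thesis
        by (simp add: finsum_ldistr[OF X] m_assoc Pi_def)
    qed
  qed (auto intro: finsum_closed)
  also have "\<dots> = (\<Oplus>c\<in>X. \<Oplus>b\<in>X. f c \<otimes> (g (b - c) \<otimes> h (a - b)))"
    by (rule finsum_swap) (auto simp: X)
  also have "\<dots> = (\<Oplus>c\<in>X. f c \<otimes> (g \<otimes>\<^bsub>Nov\<^esub> h) (a - c))"
  proof (rule finsum_cong')
    fix c assume "c \<in> X"
    show "(\<Oplus>b\<in>X. f c \<otimes> (g (b - c) \<otimes> h (a - b))) = f c \<otimes> (g \<otimes>\<^bsub>Nov\<^esub> h) (a - c)"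
    proof (cases "f c = \<zero>")
      case True
      then show ?thesis by (simp add: fg)
    next
      case False
      have "(g \<otimes>\<^bsub>Nov\<^esub> h) (a - c) = (\<Oplus>d\<in>(\<lambda>b. b - c) ` X. g d \<otimes> h (a - c - d))"
      proof (rule Nov_mult_eq)
        fix d assume "g d \<noteq> \<zero>" "h (a - c - d) \<noteq> \<zero>"
        then have "d + c \<in> X"
          using mem[of c "d + c"] False by (simp add: algebra_simps)
        then show "d \<in> (\<lambda>b. b - c) ` X" by (intro image_eqI[of _ _ "d + c"]) auto
      qed (auto simp: X)
      also have "\<dots> = (\<Oplus>b\<in>X. g (b - c) \<otimes> h (a - b))"
        by (subst finsum_reindex) (auto simp: inj_on_def algebra_simps)
      finally show ?thesis
        by (simp add: finsum_rdistr[OF X] Pi_def)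
    qed
  qed (auto intro: finsum_closed simp: fg)
  also have "\<dots> = (f \<otimes>\<^bsub>Nov\<^esub> (g \<otimes>\<^bsub>Nov\<^esub> h)) a"
  proof (rule Nov_mult_eq[symmetric])
    fix c assume c: "f c \<noteq> \<zero>" "(g \<otimes>\<^bsub>Nov\<^esub> h) (a - c) \<noteq> \<zero>"
    then obtain d where "g d \<noteq> \<zero>" "h (a - c - d) \<noteq> \<zero>" using nz' by blast
    then show "c \<in> X" using mem[of c "d + c"] c by (simp add: algebra_simps)
  qed (auto simp: X fg)
  finally show "((f \<otimes>\<^bsub>Nov\<^esub> g) \<otimes>\<^bsub>Nov\<^esub> h) a = (f \<otimes>\<^bsub>Nov\<^esub> (g \<otimes>\<^bsub>Nov\<^esub> h)) a" .
qed

lemma monomial_Lau: "r \<in> carrier R \<Longrightarrow> monomial R a r \<in> carrier Lau"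
  by (auto simp: Lau_carrier_iff monomial_def)

lemma monomial_mult:
  assumes "r \<in> carrier R" "\<And>a. f a \<in> carrier R"
  shows "monomial R a r \<otimes>\<^bsub>Nov\<^esub> f = (\<lambda>b. r \<otimes> f (b - a))"
    and "f \<otimes>\<^bsub>Nov\<^esub> monomial R a r = (\<lambda>b. f (b - a) \<otimes> r)"
proof -
  show "monomial R a r \<otimes>\<^bsub>Nov\<^esub> f = (\<lambda>b. r \<otimes> f (b - a))"
  proof
    fix b
    have "(monomial R a r \<otimes>\<^bsub>Nov\<^esub> f) b = (\<Oplus>c\<in>{a}. monomial R a r c \<otimes> f (b - c))"
      using assms by (intro Nov_mult_eq) (auto simp: monomial_def split: if_splits)
    then show "(monomial R a r \<otimes>\<^bsub>Nov\<^esub> f) b = r \<otimes> f (b - a)"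
      using assms by (simp add: monomial_def)
  qed
  show "f \<otimes>\<^bsub>Nov\<^esub> monomial R a r = (\<lambda>b. f (b - a) \<otimes> r)"
  proof
    fix b
    have "(f \<otimes>\<^bsub>Nov\<^esub> monomial R a r) b = (\<Oplus>c\<in>{b - a}. f c \<otimes> monomial R a r (b - c))"
      using assms by (intro Nov_mult_eq) (auto simp: monomial_def split: if_splits)
    then show "(f \<otimes>\<^bsub>Nov\<^esub> monomial R a r) b = f (b - a) \<otimes> r"
      using assms by (simp add: monomial_def)
  qed
qed

lemma Nov_add_closed:
  assumes "f \<in> carrier Nov" "g \<in> carrier Nov" shows "f \<oplus>\<^bsub>Nov\<^esub> g \<in> carrier Nov"
proof -
  obtain k l where "supp_bound R k f" "supp_bound R l g"
    using assms by (auto simp: Nov_carrier_iff)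
  then have *: "supp_bound R (max k l) f" "supp_bound R (max k l) g"
    by (auto intro: supp_bound_mono)
  have "supp_bound R (max k l) (\<lambda>a. f a \<oplus> g a)"
    unfolding supp_bound_def
  proof (intro allI impI)
    fix a i assume "f a \<oplus> g a \<noteq> \<zero>"
    then have "f a \<noteq> \<zero> \<or> g a \<noteq> \<zero>" by auto
    then show "- max k l \<le> a $ i" using * unfolding supp_bound_def by blast
  qed
  then show ?thesis
    using assms by (auto simp: Nov_carrier_iff Nov_simps)
qed

lemma Nov_ring: "ring (novikov_ring R :: (int ^ 'n::finite \<Rightarrow> 'a) ring)"
proof (rule ringI)
  show "abelian_group Nov"
  proof (rule abelian_groupI)
    fix f assume f: "f \<in> carrier Nov"
    then obtain k where "supp_bound R k f"
      by (auto simp: Nov_carrier_iff)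
    then have "supp_bound R k (\<lambda>a. \<ominus> f a)"
      using Nov_closed[OF f] by (auto simp: supp_bound_def)
    then show "\<exists>g\<in>carrier Nov. g \<oplus>\<^bsub>Nov\<^esub> f = \<zero>\<^bsub>Nov\<^esub>"
      using f by (intro bexI[of _ "\<lambda>a. \<ominus> f a"]) (auto simp: Nov_carrier_iff Nov_simps l_neg)
  qed (auto simp: Nov_add_closed[unfolded Nov_simps] Nov_simps Nov_closed a_ac Nov_carrier_iff[of "\<lambda>a. \<zero>"]
      supp_bound_def)
  show "monoid Nov"
  proof (rule monoidI)
    show "\<one>\<^bsub>Nov\<^esub> \<in> carrier Nov"
      by (simp add: Nov_simps Lau_subset_Nov monomial_Lau)
  qed (auto simp: Nov_mult_closed Nov_mult_assoc Nov_simps monomial_mult Nov_closed)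
  fix f g h :: "int ^ 'n \<Rightarrow> 'a"
  assume *: "f \<in> carrier Nov" "g \<in> carrier Nov" "h \<in> carrier Nov"
  obtain kf kg kh where kk: "supp_bound R kf f" "supp_bound R kg g" "supp_bound R kh h"
    using * by (auto simp: Nov_carrier_iff)
  define k where "k = max kf (max kg kh)"
  have k: "supp_bound R k f" "supp_bound R k g" "supp_bound R k h"
    using kk by (auto intro: supp_bound_mono simp: k_def)
  have k': "supp_bound R k (f \<oplus>\<^bsub>Nov\<^esub> g)"
    using k unfolding supp_bound_def Nov_simps by (metis l_zero zero_closed)
  note cl = *[THEN Nov_closed] Nov_add_closed[OF *(1,2), THEN Nov_closed]
  note fin = finite_vec_box[of "\<lambda>_. - k"]
  show "(f \<oplus>\<^bsub>Nov\<^esub> g) \<otimes>\<^bsub>Nov\<^esub> h = f \<otimes>\<^bsub>Nov\<^esub> h \<oplus>\<^bsub>Nov\<^esub> g \<otimes>\<^bsub>Nov\<^esub> h"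
  proof
    fix a
    show "((f \<oplus>\<^bsub>Nov\<^esub> g) \<otimes>\<^bsub>Nov\<^esub> h) a = (f \<otimes>\<^bsub>Nov\<^esub> h \<oplus>\<^bsub>Nov\<^esub> g \<otimes>\<^bsub>Nov\<^esub> h) a"
      unfolding Nov_mult_box[OF cl(4) k' cl(3) k(3) order_refl order_refl]
      unfolding Nov_simps(3)
      unfolding Nov_mult_box[OF cl(1) k(1) cl(3) k(3) order_refl order_refl]
        Nov_mult_box[OF cl(2) k(2) cl(3) k(3) order_refl order_refl]
      by (subst finsum_addf[symmetric]) (auto simp: cl l_distr intro!: finsum_cong')
  qed
  show "h \<otimes>\<^bsub>Nov\<^esub> (f \<oplus>\<^bsub>Nov\<^esub> g) = h \<otimes>\<^bsub>Nov\<^esub> f \<oplus>\<^bsub>Nov\<^esub> h \<otimes>\<^bsub>Nov\<^esub> g"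
  proof
    fix a
    show "(h \<otimes>\<^bsub>Nov\<^esub> (f \<oplus>\<^bsub>Nov\<^esub> g)) a = (h \<otimes>\<^bsub>Nov\<^esub> f \<oplus>\<^bsub>Nov\<^esub> h \<otimes>\<^bsub>Nov\<^esub> g) a"
      unfolding Nov_mult_box[OF cl(3) k(3) cl(4) k' order_refl order_refl]
      unfolding Nov_simps(3)
      unfolding Nov_mult_box[OF cl(3) k(3) cl(1) k(1) order_refl order_refl]
        Nov_mult_box[OF cl(3) k(3) cl(2) k(2) order_refl order_refl]
      by (subst finsum_addf[symmetric]) (auto simp: cl r_distr intro!: finsum_cong')
  qed
qed

text \<open>Removing one exponent at a time from the finite support reduces claims about L to
  monomials.\<close>

lemma Lau_induct [consumes 1, case_names zero add]:
  assumes "f \<in> carrier Lau"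
    and "P (\<lambda>a. \<zero>)"
    and "\<And>f a r. \<lbrakk>f \<in> carrier Lau; r \<in> carrier R; P f\<rbrakk> \<Longrightarrow> P (f \<oplus>\<^bsub>Lau\<^esub> monomial R a r)"
  shows "P f"
proof -
  have "finite {a. f a \<noteq> \<zero>}" using assms by (simp add: Lau_carrier_iff)
  then show ?thesis
    using assms(1)
  proof (induction "{a. f a \<noteq> \<zero>}" arbitrary: f rule: finite_induct)
    case empty
    then have "f = (\<lambda>a. \<zero>)" by auto
    then show ?case using assms(2) by simp
  next
    case (insert a A)
    let ?g = "f(a := \<zero>)"
    have cl: "\<And>b. f b \<in> carrier R" using insert.prems by (simp add: Lau_carrier_iff)
    have A: "A = {b. ?g b \<noteq> \<zero>}" using insert.hyps by (auto split: if_splits)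
    then have g: "?g \<in> carrier Lau" using insert.hyps cl by (auto simp: Lau_carrier_iff)
    have "f = ?g \<oplus>\<^bsub>Lau\<^esub> monomial R a (f a)"
      by (rule ext) (simp add: Lau_simps Nov_simps monomial_def cl)
    then show ?case
      using assms(3)[OF g cl insert.hyps(3)[OF A g]] by metis
  qed
qed

lemma laurent_series_iff: "\<phi> \<in> laurent_series R \<longleftrightarrow> (\<forall>l. \<phi> l \<in> carrier R) \<and> (\<exists>k. \<forall>l<k. \<phi> l = \<zero>)"
  by (auto simp: laurent_series_def)

lemma series_in_Nov: "\<phi> \<in> laurent_series R \<Longrightarrow> series_in R i \<phi> \<in> carrier Nov"
proof -
  assume \<phi>: "\<phi> \<in> laurent_series R"
  then obtain k where k: "\<And>l. l < k \<Longrightarrow> \<phi> l = \<zero>" by (auto simp: laurent_series_iff)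
  \<comment> \<open>All exponents other than the i-th are 0, hence the 0; the i-th is at least
    k.\<close>
  have "supp_bound R (max 0 (- k)) (series_in R i \<phi>)"
    unfolding supp_bound_def
  proof (intro allI impI)
    fix a j assume nz: "series_in R i \<phi> a \<noteq> \<zero>"
    then have a: "a = axis i (a $ i)" "\<phi> (a $ i) \<noteq> \<zero>"
      by (auto simp: series_in_def split: if_splits)
    then have "k \<le> a $ i" using k by force
    moreover have "a $ j = 0 \<or> a $ j = a $ i"
      using arg_cong[OF a(1), of "\<lambda>v. v $ j"] by (auto simp: axis_def split: if_splits)
    ultimately show "- max 0 (- k) \<le> a $ j" by auto
  qed
  then show ?thesis
    using \<phi> by (auto simp: Nov_carrier_iff laurent_series_iff series_in_def)
qed

lemma series_in_zero: "series_in R i (\<lambda>l. \<zero>) = \<zero>\<^bsub>Nov\<^esub>"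
  by (auto simp: series_in_def Nov_simps)

lemma monomial_zero: "monomial R a \<zero> = \<zero>\<^bsub>Nov\<^esub>"
  by (auto simp: monomial_def Nov_simps)

lemma series_in_add:
  "series_in R i (\<lambda>l. \<phi> l \<oplus> \<psi> l) = series_in R i \<phi> \<oplus>\<^bsub>Nov\<^esub> series_in R i \<psi>"
  by (auto simp: series_in_def Nov_simps)

lemma const_mult_series_in:
  assumes "r \<in> carrier R" "\<phi> \<in> laurent_series R"
  shows "monomial R 0 r \<otimes>\<^bsub>Nov\<^esub> series_in R i \<phi> = series_in R i (\<lambda>l. r \<otimes> \<phi> l)"
  using assms by (subst monomial_mult) (auto simp: series_in_def laurent_series_iff)

text \<open>Multiplication by x_i moves exponents along its own axis, so after the substitution it
  agrees with multiplication by Y. This is what makes X - Y vanish in the tensor product.\<close>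

lemma variable_mult_series_in:
  fixes i :: "'n::finite"
  assumes "\<phi> \<in> laurent_series R"
  shows "monomial R (axis i 1) \<one> \<otimes>\<^bsub>Nov\<^esub> series_in R i \<phi> = series_in R i (\<lambda>l. \<phi> (l - 1))"
proof -
  have "a - axis i 1 = axis i ((a - axis i 1) $ i) \<longleftrightarrow> a = axis i (a $ i)" for a :: "int ^ 'n"
    by (auto simp: vec_eq_iff axis_def)
  then show ?thesis
    using assms
    by (subst monomial_mult) (auto simp: series_in_def laurent_series_iff simp del: vector_minus_component,
      auto simp: axis_def)
qed

text \<open>The variables commute with everything, whereas r has to stay to the right of the
  coefficients. With \<open>x^a\<close> on the left it can be moved across the tensor sign, and a
  series in x_i remains.\<close>

lemma series_in_mult_monomial:
  assumes "r \<in> carrier R" "\<phi> \<in> laurent_series R"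
  shows "series_in R i \<phi> \<otimes>\<^bsub>Nov\<^esub> monomial R a r =
         monomial R a \<one> \<otimes>\<^bsub>Nov\<^esub> series_in R i (\<lambda>l. \<phi> l \<otimes> r)"
  using assms
  by (subst monomial_mult(2), simp, simp add: series_in_def laurent_series_iff,
      subst monomial_mult(1)) (auto simp: series_in_def laurent_series_iff)

text \<open>Only b with a - b on the i-th axis contribute. The set B depends on f and not on \<phi>,
  so it can be enlarged to serve several products at once.\<close>

lemma Lau_mult_series_in:
  assumes f: "f \<in> carrier Lau" and \<phi>: "\<phi> \<in> laurent_series R" and B: "finite B"
    and sub: "\<And>l. f (a - axis i l) \<noteq> \<zero> \<Longrightarrow> l \<in> B"
  shows "(f \<otimes>\<^bsub>Nov\<^esub> series_in R i \<phi>) a = (\<Oplus>l\<in>B. f (a - axis i l) \<otimes> \<phi> l)"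
proof -
  have "(f \<otimes>\<^bsub>Nov\<^esub> series_in R i \<phi>) a =
        (\<Oplus>b\<in>(\<lambda>l. a - axis i l) ` B. f b \<otimes> series_in R i \<phi> (a - b))"
  proof (rule Nov_mult_eq)
    fix b assume b: "f b \<noteq> \<zero>" "series_in R i \<phi> (a - b) \<noteq> \<zero>"
    then have "a - b = axis i ((a - b) $ i)"
      by (auto simp: series_in_def split: if_splits)
    then have "b = a - axis i ((a - b) $ i)"
      by (metis add_diff_cancel_left' diff_add_cancel)
    then show "b \<in> (\<lambda>l. a - axis i l) ` B"
      using sub[of "(a - b) $ i"] b by auto
  qed (use f \<phi> B in \<open>auto simp: Lau_carrier_iff laurent_series_iff series_in_def\<close>)
  also have "\<dots> = (\<Oplus>l\<in>B. f (a - axis i l) \<otimes> series_in R i \<phi> (axis i l))"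
    using f \<phi>
    by (subst finsum_reindex)
      (auto simp: inj_on_def axis_eq_axis Lau_carrier_iff laurent_series_iff series_in_def)
  also have "\<dots> = (\<Oplus>l\<in>B. f (a - axis i l) \<otimes> \<phi> l)"
    using f \<phi>
    by (intro finsum_cong') (auto simp: Lau_carrier_iff laurent_series_iff series_in_def)
  finally show ?thesis .
qed

end

section \<open>Projective modules\<close>

lemma restrict_scalars_simps [simp]:
  "carrier (restrict_scalars \<phi> M) = carrier M" "\<zero>\<^bsub>restrict_scalars \<phi> M\<^esub> = \<zero>\<^bsub>M\<^esub>"
  "x \<oplus>\<^bsub>restrict_scalars \<phi> M\<^esub> y = x \<oplus>\<^bsub>M\<^esub> y" "a \<odot>\<^bsub>restrict_scalars \<phi> M\<^esub> x = \<phi> a \<odot>\<^bsub>M\<^esub> x"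
  by (simp_all add: restrict_scalars_def)

lemma restrict_scalars_minus: "x \<ominus>\<^bsub>restrict_scalars \<phi> M\<^esub> y = x \<ominus>\<^bsub>M\<^esub> y"
  by (simp add: restrict_scalars_def a_minus_def a_inv_def m_inv_def)

lemma free_rmodule_simps:
  "carrier (free_rmodule A X) = {f. (\<forall>i\<in>X. f i \<in> carrier A) \<and> (\<forall>i. i \<notin> X \<longrightarrow> f i = \<zero>\<^bsub>A\<^esub>) \<and>
                   finite {i. f i \<noteq> \<zero>\<^bsub>A\<^esub>}}"
  "\<zero>\<^bsub>free_rmodule A X\<^esub> = (\<lambda>i. \<zero>\<^bsub>A\<^esub>)" "f \<oplus>\<^bsub>free_rmodule A X\<^esub> g = (\<lambda>i. f i \<oplus>\<^bsub>A\<^esub> g i)"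
  "a \<odot>\<^bsub>free_rmodule A X\<^esub> f = (\<lambda>i. f i \<otimes>\<^bsub>A\<^esub> a)"
  by (simp_all add: free_rmodule_def)

context ring
begin

lemma free_rmodule_closed: "f \<in> carrier (free_rmodule R X) \<Longrightarrow> f i \<in> carrier R"
  by (cases "i \<in> X") (auto simp: free_rmodule_simps)

lemma free_rmodule_add_closed:
  assumes "f \<in> carrier (free_rmodule R X)" "g \<in> carrier (free_rmodule R X)"
  shows "(\<lambda>i. f i \<oplus> g i) \<in> carrier (free_rmodule R X)"
proof -
  have "{i. f i \<oplus> g i \<noteq> \<zero>} \<subseteq> {i. f i \<noteq> \<zero>} \<union> {i. g i \<noteq> \<zero>}"
    by auto
  then show ?thesis
    using assms by (auto simp: free_rmodule_simps intro: finite_subset)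
qed

lemma free_rmodule_abelian_group: "abelian_group (free_rmodule R X)"
proof (rule abelian_groupI)
  fix f assume f: "f \<in> carrier (free_rmodule R X)"
  then have "{i. \<ominus> f i \<noteq> \<zero>} \<subseteq> {i. f i \<noteq> \<zero>}"
    by auto
  then have "(\<lambda>i. \<ominus> f i) \<in> carrier (free_rmodule R X)"
    using f by (auto simp: free_rmodule_simps intro: finite_subset)
  then show "\<exists>g\<in>carrier (free_rmodule R X). g \<oplus>\<^bsub>free_rmodule R X\<^esub> f = \<zero>\<^bsub>free_rmodule R X\<^esub>"
    using free_rmodule_closed[OF f]
    by (intro bexI[of _ "\<lambda>i. \<ominus> f i"]) (auto simp: free_rmodule_simps(2,3) l_neg)
next
  show "\<zero>\<^bsub>free_rmodule R X\<^esub> \<in> carrier (free_rmodule R X)"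
    by (simp add: free_rmodule_simps)
qed (simp_all add: free_rmodule_add_closed free_rmodule_simps(2,3) free_rmodule_closed a_ac)

lemma free_rmodule_eval_additive: "additive_map (free_rmodule R X) R (\<lambda>f. f i)"
  by (rule additive_mapI)
    (simp_all add: free_rmodule_abelian_group abelian_group_axioms free_rmodule_closed free_rmodule_simps(3))

definition basis_elem :: "'i \<Rightarrow> 'i \<Rightarrow> 'a" where
  "basis_elem i = (\<lambda>j. if j = i then \<one> else \<zero>)"

lemma basis_elem_closed: "i \<in> X \<Longrightarrow> basis_elem i \<in> carrier (free_rmodule R X)"
  by (auto simp: free_rmodule_simps basis_elem_def)

lemma basis_smult_closed:
  assumes "i \<in> X" "a \<in> carrier R"
  shows "a \<odot>\<^bsub>free_rmodule R X\<^esub> basis_elem i \<in> carrier (free_rmodule R X)"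
proof -
  have "finite {j. (if j = i then \<one> else \<zero>) \<otimes> a \<noteq> \<zero>}"
    by (rule finite_subset[of _ "{i}"]) (use assms in auto)
  then show ?thesis
    using assms by (auto simp: free_rmodule_simps basis_elem_def)
qed

lemma free_rmodule_expand:
  assumes f: "f \<in> carrier (free_rmodule R X)" and B: "finite B" "B \<subseteq> X" "\<And>i. f i \<noteq> \<zero> \<Longrightarrow> i \<in> B"
  shows "f = (\<Oplus>\<^bsub>free_rmodule R X\<^esub>i\<in>B. f i \<odot>\<^bsub>free_rmodule R X\<^esub> basis_elem i)"
proof
  fix j
  have cl: "(\<lambda>i. f i \<odot>\<^bsub>free_rmodule R X\<^esub> basis_elem i) \<in> B \<rightarrow> carrier (free_rmodule R X)"
    using B f by (auto simp: free_rmodule_closed basis_smult_closed)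
  have "(\<Oplus>\<^bsub>free_rmodule R X\<^esub>i\<in>B. f i \<odot>\<^bsub>free_rmodule R X\<^esub> basis_elem i) j
      = (\<Oplus>i\<in>B. (f i \<odot>\<^bsub>free_rmodule R X\<^esub> basis_elem i) j)"
    by (rule additive_map_finsum[OF free_rmodule_eval_additive B(1) cl])
  also have "\<dots> = (\<Oplus>i\<in>B. if j = i then f i else \<zero>)"
    using f by (intro finsum_cong') (auto simp: free_rmodule_simps(4) basis_elem_def free_rmodule_closed)
  also have "\<dots> = f j"
  proof (cases "j \<in> B")
    case True
    then show ?thesis using f B by (intro finsum_singleton) (auto simp: free_rmodule_closed)
  next
    case False
    then have "(\<Oplus>i\<in>B. if j = i then f i else \<zero>) = (\<Oplus>i\<in>B. \<zero>)"
      by (intro finsum_cong') auto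
    then show ?thesis using False B(3)[of j] by (metis finsum_zero)
  qed
  finally show "f j = (\<Oplus>\<^bsub>free_rmodule R X\<^esub>i\<in>B. f i \<odot>\<^bsub>free_rmodule R X\<^esub> basis_elem i) j" by simp
qed

end

text \<open>A retraction of a free module onto M. The images \<open>gen\<close> of the basis and the
  coordinates of \<iota> form a dual basis of M.\<close>

locale projective_data = M: right_module A M
  for A :: "('a, 'r) ring_scheme" and M :: "('a, 'm) module" +
  fixes X :: "'m set" and \<iota> p
  assumes emb: "\<iota> \<in> rmod_hom A M (free_rmodule A X)"
    and proj: "p \<in> rmod_hom A (free_rmodule A X) M"
    and proj_emb: "x \<in> carrier M \<Longrightarrow> p (\<iota> x) = x"
begin

lemma emb_closed: "x \<in> carrier M \<Longrightarrow> \<iota> x \<in> carrier (free_rmodule A X)"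
  by (rule rmod_homD(1)[OF emb])

lemma emb_elem: "x \<in> carrier M \<Longrightarrow> \<iota> x i \<in> carrier A"
  by (rule M.R.free_rmodule_closed[OF emb_closed])

lemma emb_outside: "\<lbrakk>x \<in> carrier M; i \<notin> X\<rbrakk> \<Longrightarrow> \<iota> x i = \<zero>\<^bsub>A\<^esub>"
  using emb_closed by (auto simp: free_rmodule_simps)

lemma emb_finite: "x \<in> carrier M \<Longrightarrow> finite {i. \<iota> x i \<noteq> \<zero>\<^bsub>A\<^esub>}"
  using emb_closed by (auto simp: free_rmodule_simps)

lemma emb_add: "\<lbrakk>x \<in> carrier M; y \<in> carrier M\<rbrakk> \<Longrightarrow> \<iota> (x \<oplus>\<^bsub>M\<^esub> y) i = \<iota> x i \<oplus>\<^bsub>A\<^esub> \<iota> y i"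
  by (simp add: rmod_homD[OF emb] free_rmodule_simps)

lemma emb_smult: "\<lbrakk>a \<in> carrier A; x \<in> carrier M\<rbrakk> \<Longrightarrow> \<iota> (a \<odot>\<^bsub>M\<^esub> x) i = \<iota> x i \<otimes>\<^bsub>A\<^esub> a"
  by (simp add: rmod_homD[OF emb] free_rmodule_simps)

definition gen :: "'m \<Rightarrow> 'm" where
  "gen i = p (M.R.basis_elem i)"

lemma gen_closed: "i \<in> X \<Longrightarrow> gen i \<in> carrier M"
  by (simp add: gen_def rmod_homD(1)[OF proj] M.R.basis_elem_closed)

lemma gen_expand:
  assumes x: "x \<in> carrier M" and B: "finite B" "B \<subseteq> X" "\<And>i. \<iota> x i \<noteq> \<zero>\<^bsub>A\<^esub> \<Longrightarrow> i \<in> B"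
  shows "x = (\<Oplus>\<^bsub>M\<^esub>i\<in>B. \<iota> x i \<odot>\<^bsub>M\<^esub> gen i)"
proof -
  have add: "additive_map (free_rmodule A X) M p"
    by (rule additive_mapI)
      (simp_all add: M.M.abelian_group_axioms M.R.free_rmodule_abelian_group rmod_homD[OF proj])
  have "x = p (\<iota> x)" using proj_emb[OF x] by simp
  also have "\<dots> = p (\<Oplus>\<^bsub>free_rmodule A X\<^esub>i\<in>B. \<iota> x i \<odot>\<^bsub>free_rmodule A X\<^esub> M.R.basis_elem i)"
    using M.R.free_rmodule_expand[OF emb_closed[OF x] B] by simp
  also have "\<dots> = (\<Oplus>\<^bsub>M\<^esub>i\<in>B. p (\<iota> x i \<odot>\<^bsub>free_rmodule A X\<^esub> M.R.basis_elem i))"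
    using B emb_elem[OF x]
    by (intro additive_map_finsum[OF add]) (auto simp: M.R.basis_smult_closed)
  also have "\<dots> = (\<Oplus>\<^bsub>M\<^esub>i\<in>B. \<iota> x i \<odot>\<^bsub>M\<^esub> gen i)"
    using B emb_elem[OF x]
    by (intro M.M.finsum_cong')
      (auto simp: rmod_homD(3)[OF proj] M.R.basis_elem_closed gen_def M.smult_closed gen_closed[unfolded gen_def])
  finally show ?thesis .
qed

text \<open>Preimages in U of the images of the generators determine the lift. U is a subset closed
  under the module operations, not a module record, so that a submodule can be used without being
  made into a type of its own.\<close>

lemma lift:
  assumes N: "right_module A N" and N': "right_module A N'"
    and d: "d \<in> rmod_hom A N N'" and f: "f \<in> rmod_hom A M N'"
    and U: "U \<subseteq> carrier N" "\<zero>\<^bsub>N\<^esub> \<in> U" "\<And>x y. \<lbrakk>x \<in> U; y \<in> U\<rbrakk> \<Longrightarrow> x \<oplus>\<^bsub>N\<^esub> y \<in> U"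
      "\<And>a x. \<lbrakk>a \<in> carrier A; x \<in> U\<rbrakk> \<Longrightarrow> a \<odot>\<^bsub>N\<^esub> x \<in> U"
    and ex: "\<And>x. x \<in> carrier M \<Longrightarrow> \<exists>w\<in>U. d w = f x"
  shows "\<exists>\<sigma>\<in>rmod_hom A M N. \<forall>x\<in>carrier M. \<sigma> x \<in> U \<and> d (\<sigma> x) = f x"
proof -
  interpret N: right_module A N by (rule N)
  interpret N': right_module A N' by (rule N')
  have "\<exists>w. \<forall>i\<in>X. w i \<in> U \<and> d (w i) = f (gen i)"
    using ex[OF gen_closed] by (intro bchoice) blast
  then obtain w where w: "\<And>i. i \<in> X \<Longrightarrow> w i \<in> U" "\<And>i. i \<in> X \<Longrightarrow> d (w i) = f (gen i)"
    by blast
  have w_cl: "i \<in> X \<Longrightarrow> w i \<in> carrier N" for i using w U by auto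
  \<comment> \<open>The expansion of x in the dual basis, with \<open>w i\<close> in place of
    \<open>gen i\<close>. It is linear because the coordinates are linear in x, even though the
    generators may satisfy relations.\<close>
  define \<sigma> where "\<sigma> x = (\<Oplus>\<^bsub>N\<^esub>i\<in>{i. \<iota> x i \<noteq> \<zero>\<^bsub>A\<^esub>}. \<iota> x i \<odot>\<^bsub>N\<^esub> w i)" for x
  have eq: "\<sigma> x = (\<Oplus>\<^bsub>N\<^esub>i\<in>B. \<iota> x i \<odot>\<^bsub>N\<^esub> w i)"
    if x: "x \<in> carrier M" and B: "finite B" "B \<subseteq> X" "\<And>i. \<iota> x i \<noteq> \<zero>\<^bsub>A\<^esub> \<Longrightarrow> i \<in> B" for x B
    unfolding \<sigma>_def
    by (rule N.add.finprod_mono_neutral_cong_left[OF B(1)])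
      (use B w_cl emb_elem[OF x] in \<open>auto simp: N.smult_zero_left N.smult_closed\<close>)
  have sub: "{i. \<iota> x i \<noteq> \<zero>\<^bsub>A\<^esub>} \<subseteq> X" if "x \<in> carrier M" for x
    using emb_outside[OF that] by auto
  have closed: "\<sigma> x \<in> U" if x: "x \<in> carrier M" for x
  proof -
    have "(\<Oplus>\<^bsub>N\<^esub>i\<in>B. \<iota> x i \<odot>\<^bsub>N\<^esub> w i) \<in> U" if "finite B" "B \<subseteq> X" for B
      using that
    proof (induction B rule: finite_induct)
      case (insert i B)
      then show ?case
        using U w_cl w(1) emb_elem[OF x]
        by (subst N.finsum_insert) (auto simp: N.smult_closed intro!: U(3,4))
    qed (simp add: U)
    then show ?thesis unfolding \<sigma>_def using emb_finite[OF x] sub[OF x] by blast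
  qed
  have "\<sigma> \<in> rmod_hom A M N"
  proof (rule rmod_homI)
    show "\<sigma> x \<in> carrier N" if "x \<in> carrier M" for x
      using closed[OF that] U(1) by blast
  next
    fix x y assume xy: "x \<in> carrier M" "y \<in> carrier M"
    let ?B = "{i. \<iota> x i \<noteq> \<zero>\<^bsub>A\<^esub>} \<union> {i. \<iota> y i \<noteq> \<zero>\<^bsub>A\<^esub>}"
    have B: "finite ?B" "?B \<subseteq> X" using xy emb_finite sub by auto
    have "\<sigma> (x \<oplus>\<^bsub>M\<^esub> y) = (\<Oplus>\<^bsub>N\<^esub>i\<in>?B. \<iota> (x \<oplus>\<^bsub>M\<^esub> y) i \<odot>\<^bsub>N\<^esub> w i)"
      by (rule eq[OF _ B]) (use xy in \<open>auto simp: emb_add\<close>)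
    also have "\<dots> = (\<Oplus>\<^bsub>N\<^esub>i\<in>?B. \<iota> x i \<odot>\<^bsub>N\<^esub> w i \<oplus>\<^bsub>N\<^esub> \<iota> y i \<odot>\<^bsub>N\<^esub> w i)"
      using xy B(2) w_cl
      by (intro N.finsum_cong') (auto simp: emb_add emb_elem N.smult_l_distr N.smult_closed subset_iff)
    also have "\<dots> = (\<Oplus>\<^bsub>N\<^esub>i\<in>?B. \<iota> x i \<odot>\<^bsub>N\<^esub> w i) \<oplus>\<^bsub>N\<^esub> (\<Oplus>\<^bsub>N\<^esub>i\<in>?B. \<iota> y i \<odot>\<^bsub>N\<^esub> w i)"
      using xy B(2) w_cl
      by (intro N.finsum_addf) (auto simp: emb_elem N.smult_closed subset_iff)
    also have "\<dots> = \<sigma> x \<oplus>\<^bsub>N\<^esub> \<sigma> y"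
      using eq[OF xy(1) B] eq[OF xy(2) B] by simp
    finally show "\<sigma> (x \<oplus>\<^bsub>M\<^esub> y) = \<sigma> x \<oplus>\<^bsub>N\<^esub> \<sigma> y" .
  next
    fix a x assume a: "a \<in> carrier A" and x: "x \<in> carrier M"
    let ?B = "{i. \<iota> x i \<noteq> \<zero>\<^bsub>A\<^esub>}"
    note B = emb_finite[OF x] sub[OF x]
    have "\<sigma> (a \<odot>\<^bsub>M\<^esub> x) = (\<Oplus>\<^bsub>N\<^esub>i\<in>?B. \<iota> (a \<odot>\<^bsub>M\<^esub> x) i \<odot>\<^bsub>N\<^esub> w i)"
      by (rule eq[OF _ B]) (use a x in \<open>auto simp: emb_smult M.smult_closed\<close>)
    also have "\<dots> = (\<Oplus>\<^bsub>N\<^esub>i\<in>?B. a \<odot>\<^bsub>N\<^esub> (\<iota> x i \<odot>\<^bsub>N\<^esub> w i))"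
      using a x B(2) w_cl
      by (intro N.finsum_cong') (auto simp: emb_smult emb_elem N.smult_assoc N.smult_closed subset_iff)
    also have "\<dots> = a \<odot>\<^bsub>N\<^esub> (\<Oplus>\<^bsub>N\<^esub>i\<in>?B. \<iota> x i \<odot>\<^bsub>N\<^esub> w i)"
      using a x B w_cl
      by (intro additive_map_finsum[OF N.smult_additive, symmetric])
        (auto simp: emb_elem N.smult_closed subset_iff)
    finally show "\<sigma> (a \<odot>\<^bsub>M\<^esub> x) = a \<odot>\<^bsub>N\<^esub> \<sigma> x" by (simp add: \<sigma>_def)
  qed
  moreover have "d (\<sigma> x) = f x" if x: "x \<in> carrier M" for x
  proof -
    let ?B = "{i. \<iota> x i \<noteq> \<zero>\<^bsub>A\<^esub>}"
    note B = emb_finite[OF x] sub[OF x]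
    have "d (\<sigma> x) = (\<Oplus>\<^bsub>N'\<^esub>i\<in>?B. d (\<iota> x i \<odot>\<^bsub>N\<^esub> w i))"
      unfolding \<sigma>_def using x B w_cl
      by (intro additive_map_finsum[OF rmod_hom_additive[OF d N N']])
        (auto simp: emb_elem N.smult_closed subset_iff)
    also have "\<dots> = (\<Oplus>\<^bsub>N'\<^esub>i\<in>?B. f (\<iota> x i \<odot>\<^bsub>M\<^esub> gen i))"
      using x B(2) w_cl
      by (intro N'.finsum_cong')
        (auto simp: emb_elem rmod_homD[OF d] rmod_homD[OF f] w M.smult_closed N'.smult_closed gen_closed subset_iff)
    also have "\<dots> = f (\<Oplus>\<^bsub>M\<^esub>i\<in>?B. \<iota> x i \<odot>\<^bsub>M\<^esub> gen i)"
      using x B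
      by (intro additive_map_finsum[OF rmod_hom_additive[OF f M.right_module_axioms N'], symmetric])
        (auto simp: emb_elem M.smult_closed gen_closed subset_iff)
    also have "\<dots> = f x"
      using gen_expand[OF x B] by simp
    finally show ?thesis .
  qed
  ultimately show ?thesis using closed by blast
qed

end

section \<open>Formal Laurent series with coefficients in a module\<close>

lemma (in abelian_group) a_inv_zero: "\<ominus> \<zero> = \<zero>"
  by (rule minus_equality) auto

lemma laurent_const_eq: "laurent_const R r = monomial R 0 r"
  by (simp add: laurent_const_def monomial_def)

locale laurent_module = R: ring R + tensor "laurent_ring R" "novikov_ring R" "\<lambda>f. f" M
  for R :: "('a, 'r) ring_scheme" and M :: "(int ^ 'n::finite \<Rightarrow> 'a, 'm) module" +
  fixes k :: 'n
begin

abbreviation rsmult :: "'a \<Rightarrow> 'm \<Rightarrow> 'm" where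
  "rsmult r x \<equiv> monomial R 0 r \<odot>\<^bsub>M\<^esub> x"

definition X :: "int ^ 'n \<Rightarrow> 'a" where "X = monomial R (axis k 1) \<one>\<^bsub>R\<^esub>"
definition X_inv :: "int ^ 'n \<Rightarrow> 'a" where "X_inv = monomial R (axis k (- 1)) \<one>\<^bsub>R\<^esub>"

abbreviation ser :: "(int \<Rightarrow> 'a) \<Rightarrow> int ^ 'n \<Rightarrow> 'a" where
  "ser \<equiv> series_in R k"

definition bounded_below :: "(int \<Rightarrow> 'm) \<Rightarrow> bool" where
  "bounded_below u \<longleftrightarrow> (\<forall>l. u l \<in> carrier M) \<and> (\<exists>b. \<forall>l<b. u l = \<zero>\<^bsub>M\<^esub>)"

text \<open>
  \<open>rep u z\<close>: the series \<open>\<Sum>l. u l Y\<^sup>l\<close> is a finite sum of series \<open>x \<phi>(Y)\<close> with \<open>x\<close> in \<open>M\<close> and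
  \<open>\<phi>\<close> in \<open>R((Y))\<close>, and \<open>z\<close> is the corresponding sum of the tensors \<open>x \<otimes> \<phi>(X)\<close>. Not every series bounded
  below is of this form unless \<open>M\<close> is finitely generated over \<open>R\<close>.
\<close>

inductive rep :: "(int \<Rightarrow> 'm) \<Rightarrow> ('m \<times> (int ^ 'n \<Rightarrow> 'a) \<Rightarrow>\<^sub>0 int) set \<Rightarrow> bool" where
  zero: "rep (\<lambda>l. \<zero>\<^bsub>M\<^esub>) \<zero>\<^bsub>T\<^esub>"
| add: "\<lbrakk>rep u z; x \<in> carrier M; \<phi> \<in> laurent_series R\<rbrakk> \<Longrightarrow>
        rep (\<lambda>l. u l \<oplus>\<^bsub>M\<^esub> rsmult (\<phi> l) x) (z \<oplus>\<^bsub>T\<^esub> tens x (ser \<phi>))"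

lemma const_closed [simp]: "r \<in> carrier R \<Longrightarrow> monomial R a r \<in> carrier (laurent_ring R)"
  by (rule R.monomial_Lau)

lemma series_closed [simp]: "\<phi> \<in> laurent_series R \<Longrightarrow> ser \<phi> \<in> carrier (novikov_ring R)"
  by (rule R.series_in_Nov)

lemma series_elem: "\<phi> \<in> laurent_series R \<Longrightarrow> \<phi> l \<in> carrier R"
  by (simp add: R.laurent_series_iff)

lemma rsmult_closed [simp]: "\<lbrakk>r \<in> carrier R; x \<in> carrier M\<rbrakk> \<Longrightarrow> rsmult r x \<in> carrier M"
  by (simp add: M.smult_closed)

lemma rsmult_zero: "x \<in> carrier M \<Longrightarrow> rsmult \<zero>\<^bsub>R\<^esub> x = \<zero>\<^bsub>M\<^esub>"
  by (simp add: R.monomial_zero R.Lau_simps(2)[symmetric] M.smult_zero_left)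

lemma monomial_smult_smult:
  assumes "r \<in> carrier R" "s \<in> carrier R" "x \<in> carrier M"
  shows "monomial R a r \<odot>\<^bsub>M\<^esub> (monomial R b s \<odot>\<^bsub>M\<^esub> x) = monomial R (a + b) (s \<otimes>\<^bsub>R\<^esub> r) \<odot>\<^bsub>M\<^esub> x"
proof -
  have "monomial R b s \<otimes>\<^bsub>laurent_ring R\<^esub> monomial R a r = monomial R (a + b) (s \<otimes>\<^bsub>R\<^esub> r)"
    using assms
    by (simp add: R.Lau_simps R.monomial_mult R.Lau_closed[OF R.monomial_Lau])
      (auto simp: monomial_def algebra_simps)
  then show ?thesis
    using assms by (simp flip: M.smult_assoc)
qed

lemma X_closed [simp]: "X \<in> carrier (laurent_ring R)" "X_inv \<in> carrier (laurent_ring R)"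
  by (simp_all add: X_def X_inv_def)

lemma X_smult_closed [simp]:
  "x \<in> carrier M \<Longrightarrow> X \<odot>\<^bsub>M\<^esub> x \<in> carrier M" "x \<in> carrier M \<Longrightarrow> X_inv \<odot>\<^bsub>M\<^esub> x \<in> carrier M"
  by (simp_all add: M.smult_closed)

lemma X_X_inv: "x \<in> carrier M \<Longrightarrow> X \<odot>\<^bsub>M\<^esub> (X_inv \<odot>\<^bsub>M\<^esub> x) = x"
proof -
  assume x: "x \<in> carrier M"
  have "axis k 1 + axis k (- 1) = (0 :: int ^ 'n)"
    by (simp add: vec_eq_iff axis_def)
  then show ?thesis
    using x M.smult_one[OF x]
    by (simp add: X_def X_inv_def monomial_smult_smult R.Lau_simps R.Nov_simps)
qed

lemma X_rsmult:
  "\<lbrakk>r \<in> carrier R; x \<in> carrier M\<rbrakk> \<Longrightarrow> X \<odot>\<^bsub>M\<^esub> rsmult r x = rsmult r (X \<odot>\<^bsub>M\<^esub> x)"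
  by (simp add: X_def monomial_smult_smult)

lemma bounded_belowI: "\<lbrakk>\<And>l. u l \<in> carrier M; \<And>l. l < b \<Longrightarrow> u l = \<zero>\<^bsub>M\<^esub>\<rbrakk> \<Longrightarrow> bounded_below u"
  by (auto simp: bounded_below_def)

lemma bounded_below_closed: "bounded_below u \<Longrightarrow> u l \<in> carrier M"
  by (simp add: bounded_below_def)

lemma rep_props: "rep u z \<Longrightarrow> bounded_below u \<and> z \<in> carrier T"
proof (induction rule: rep.induct)
  case zero
  then show ?case by (simp add: bounded_below_def)
next
  case (add u z x \<phi>)
  then obtain b c where *: "\<And>l. l < b \<Longrightarrow> u l = \<zero>\<^bsub>M\<^esub>" "\<And>l. l < c \<Longrightarrow> \<phi> l = \<zero>\<^bsub>R\<^esub>"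
    by (auto simp: bounded_below_def R.laurent_series_iff)
  have "bounded_below (\<lambda>l. u l \<oplus>\<^bsub>M\<^esub> rsmult (\<phi> l) x)"
    by (rule bounded_belowI[of _ "min b c"])
      (use add * in \<open>auto simp: bounded_below_closed series_elem rsmult_zero\<close>)
  then show ?case using add by (simp add: tens_closed)
qed

lemma rep_closed: "rep u z \<Longrightarrow> u l \<in> carrier M" and rep_tensor: "rep u z \<Longrightarrow> z \<in> carrier T"
  using rep_props bounded_below_closed by auto

lemma rep_add: "\<lbrakk>rep v w; rep u z\<rbrakk> \<Longrightarrow> rep (\<lambda>l. u l \<oplus>\<^bsub>M\<^esub> v l) (z \<oplus>\<^bsub>T\<^esub> w)"
proof (induction rule: rep.induct)
  case zero
  then show ?case by (simp add: rep_closed rep_tensor)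
next
  case (add v w x \<phi>)
  have "rep (\<lambda>l. (u l \<oplus>\<^bsub>M\<^esub> v l) \<oplus>\<^bsub>M\<^esub> rsmult (\<phi> l) x) ((z \<oplus>\<^bsub>T\<^esub> w) \<oplus>\<^bsub>T\<^esub> tens x (ser \<phi>))"
    using add by (intro rep.add) auto
  then show ?case
    using add by (simp add: M.M.a_assoc T.a_assoc rep_closed rep_tensor series_elem tens_closed)
qed

lemma rep_tens: "\<lbrakk>x \<in> carrier M; \<phi> \<in> laurent_series R\<rbrakk> \<Longrightarrow> rep (\<lambda>l. rsmult (\<phi> l) x) (tens x (ser \<phi>))"
  using rep.add[OF rep.zero, of x \<phi>] by (simp add: series_elem tens_closed)

lemma rep_neg: "rep u z \<Longrightarrow> rep (\<lambda>l. \<ominus>\<^bsub>M\<^esub> u l) (\<ominus>\<^bsub>T\<^esub> z)"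
proof (induction rule: rep.induct)
  case zero
  then show ?case using rep.zero by (simp add: M.M.a_inv_zero T.a_inv_zero)
next
  case (add u z x \<phi>)
  have "rep (\<lambda>l. (\<ominus>\<^bsub>M\<^esub> u l) \<oplus>\<^bsub>M\<^esub> rsmult (\<phi> l) (\<ominus>\<^bsub>M\<^esub> x)) (\<ominus>\<^bsub>T\<^esub> z \<oplus>\<^bsub>T\<^esub> tens (\<ominus>\<^bsub>M\<^esub> x) (ser \<phi>))"
    using add by (intro rep.add) auto
  then show ?case
    using add
    by (simp add: additive_map_neg[OF M.smult_additive] additive_map_neg[OF tens_left_additive]
        series_elem rep_closed rep_tensor tens_closed M.M.minus_add T.minus_add)
qed

lemma rep_diff: "\<lbrakk>rep u z; rep v w\<rbrakk> \<Longrightarrow> rep (\<lambda>l. u l \<ominus>\<^bsub>M\<^esub> v l) (z \<ominus>\<^bsub>T\<^esub> w)"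
  unfolding a_minus_def by (intro rep_add rep_neg)

lemma rep_sum:
  assumes "finite J" "\<And>j. j \<in> J \<Longrightarrow> e j \<in> carrier M" "\<And>j. j \<in> J \<Longrightarrow> \<phi> j \<in> laurent_series R"
  shows "rep (\<lambda>l. \<Oplus>\<^bsub>M\<^esub>j\<in>J. rsmult (\<phi> j l) (e j)) (\<Oplus>\<^bsub>T\<^esub>j\<in>J. tens (e j) (ser (\<phi> j)))"
  using assms
proof (induction J rule: finite_induct)
  case empty
  then show ?case using rep.zero by simp
next
  case (insert j J)
  have "rep (\<lambda>l. rsmult (\<phi> j l) (e j) \<oplus>\<^bsub>M\<^esub> (\<Oplus>\<^bsub>M\<^esub>j\<in>J. rsmult (\<phi> j l) (e j)))
     (tens (e j) (ser (\<phi> j)) \<oplus>\<^bsub>T\<^esub> (\<Oplus>\<^bsub>T\<^esub>j\<in>J. tens (e j) (ser (\<phi> j))))"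
    using insert by (intro rep_add rep_tens) auto
  moreover have "(\<Oplus>\<^bsub>M\<^esub>j\<in>insert j J. rsmult (\<phi> j l) (e j)) =
      rsmult (\<phi> j l) (e j) \<oplus>\<^bsub>M\<^esub> (\<Oplus>\<^bsub>M\<^esub>j\<in>J. rsmult (\<phi> j l) (e j))" for l
    using insert by (intro M.M.finsum_insert) (auto simp: series_elem)
  moreover have "(\<Oplus>\<^bsub>T\<^esub>j\<in>insert j J. tens (e j) (ser (\<phi> j))) =
      tens (e j) (ser (\<phi> j)) \<oplus>\<^bsub>T\<^esub> (\<Oplus>\<^bsub>T\<^esub>j\<in>J. tens (e j) (ser (\<phi> j)))"
    using insert by (intro T.finsum_insert) (auto simp: tens_closed)
  ultimately show ?case by simp
qed

lemma shift_series: "\<phi> \<in> laurent_series R \<Longrightarrow> (\<lambda>l. \<phi> (l - 1)) \<in> laurent_series R"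
  unfolding R.laurent_series_iff by (metis diff_less_eq less_add_one order_less_trans)

text \<open>In the tensor product X x \<otimes> \<phi>(X) = x \<otimes> X \<phi>(X), so X and Y have
  the same effect after the substitution. The index l - 1 is multiplication by Y.\<close>

lemma rep_shift: "rep u z \<Longrightarrow> rep (\<lambda>l. X \<odot>\<^bsub>M\<^esub> u l \<ominus>\<^bsub>M\<^esub> u (l - 1)) \<zero>\<^bsub>T\<^esub>"
proof (induction rule: rep.induct)
  case zero
  then show ?case
    using rep.zero by (simp add: additive_map_zero[OF M.smult_additive] a_minus_def M.M.a_inv_zero)
next
  case (add u z x \<phi>)
  have "tens (X \<odot>\<^bsub>M\<^esub> x) (ser \<phi>) = tens x (ser (\<lambda>l. \<phi> (l - 1)))"
    using add by (simp add: tens_balanced X_def R.variable_mult_series_in)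
  moreover have "rep (\<lambda>l. rsmult (\<phi> l) (X \<odot>\<^bsub>M\<^esub> x) \<ominus>\<^bsub>M\<^esub> rsmult (\<phi> (l - 1)) x)
      (tens (X \<odot>\<^bsub>M\<^esub> x) (ser \<phi>) \<ominus>\<^bsub>T\<^esub> tens x (ser (\<lambda>l. \<phi> (l - 1))))"
    using add by (intro rep_diff rep_tens shift_series) auto
  ultimately have "rep (\<lambda>l. rsmult (\<phi> l) (X \<odot>\<^bsub>M\<^esub> x) \<ominus>\<^bsub>M\<^esub> rsmult (\<phi> (l - 1)) x) \<zero>\<^bsub>T\<^esub>"
    using add by (simp add: a_minus_def T.r_neg tens_closed shift_series)
  from rep_add[OF this add.IH]
  have "rep (\<lambda>l. (X \<odot>\<^bsub>M\<^esub> u l \<ominus>\<^bsub>M\<^esub> u (l - 1)) \<oplus>\<^bsub>M\<^esub>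
      (rsmult (\<phi> l) (X \<odot>\<^bsub>M\<^esub> x) \<ominus>\<^bsub>M\<^esub> rsmult (\<phi> (l - 1)) x)) \<zero>\<^bsub>T\<^esub>"
    by simp
  moreover have "X \<odot>\<^bsub>M\<^esub> (u l \<oplus>\<^bsub>M\<^esub> rsmult (\<phi> l) x) \<ominus>\<^bsub>M\<^esub> (u (l - 1) \<oplus>\<^bsub>M\<^esub> rsmult (\<phi> (l - 1)) x) =
      (X \<odot>\<^bsub>M\<^esub> u l \<ominus>\<^bsub>M\<^esub> u (l - 1)) \<oplus>\<^bsub>M\<^esub> (rsmult (\<phi> l) (X \<odot>\<^bsub>M\<^esub> x) \<ominus>\<^bsub>M\<^esub> rsmult (\<phi> (l - 1)) x)" for l
    using add
    by (simp add: rep_closed series_elem M.smult_r_distr X_rsmult a_minus_def M.M.minus_add M.M.a_ac)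
  ultimately show ?case by simp
qed

text \<open>The subcomplex of the overview in one degree, the image of A under the substitution of X
  for Y; \<open>repd_smult\<close> shows that L acts on it.\<close>

definition repd :: "('m \<times> (int ^ 'n \<Rightarrow> 'a) \<Rightarrow>\<^sub>0 int) set set" where
  "repd = {z. \<exists>u. rep u z}"

lemma repd_subset: "repd \<subseteq> carrier T"
  by (auto simp: repd_def rep_tensor)

lemma repd_zero: "\<zero>\<^bsub>T\<^esub> \<in> repd"
  using rep.zero by (auto simp: repd_def)

lemma repd_add: "\<lbrakk>z \<in> repd; w \<in> repd\<rbrakk> \<Longrightarrow> z \<oplus>\<^bsub>T\<^esub> w \<in> repd"
  using rep_add by (fastforce simp: repd_def)

lemma repd_diff: "\<lbrakk>z \<in> repd; w \<in> repd\<rbrakk> \<Longrightarrow> z \<ominus>\<^bsub>T\<^esub> w \<in> repd"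
  using rep_diff by (fastforce simp: repd_def)

lemma repd_tens: "\<lbrakk>x \<in> carrier M; \<phi> \<in> laurent_series R\<rbrakk> \<Longrightarrow> tens x (ser \<phi>) \<in> repd"
  using rep_tens by (auto simp: repd_def)

lemma Lau_Nov [simp]: "f \<in> carrier (laurent_ring R) \<Longrightarrow> f \<in> carrier (novikov_ring R)"
  by (rule R.Lau_subset_Nov)

text \<open>L is a subset of the Novikov ring with the same operations, so \<open>T\<close> is an
  L-module without any change of its record.\<close>

lemma T_Lau_module: "right_module (laurent_ring R) T"
proof -
  interpret L: ring "laurent_ring R :: (int ^ 'n \<Rightarrow> 'a) ring"
    by (rule right_module.axioms(1)[OF M.right_module_axioms])
  show ?thesis
    by unfold_locales
      (simp_all add: T.smult_closed T.smult_l_distr T.smult_r_distr T.smult_assoc T.smult_one R.Lau_simps)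
qed

lemma repd_smult:
  assumes "f \<in> carrier (laurent_ring R)" "z \<in> repd"
  shows "f \<odot>\<^bsub>T\<^esub> z \<in> repd"
proof -
  interpret TL: right_module "laurent_ring R" T by (rule T_Lau_module)
  have mono: "monomial R a r \<odot>\<^bsub>T\<^esub> z \<in> repd" if r: "r \<in> carrier R" and "rep u z" for a r u z
    using that(2)
  proof (induction rule: rep.induct)
    case zero
    then show ?case
      using r by (simp add: additive_map_zero[OF TL.smult_additive] repd_zero)
  next
    case (add u z x \<phi>)
    have *: "(\<lambda>l. \<phi> l \<otimes>\<^bsub>R\<^esub> r) \<in> laurent_series R"
      using add r unfolding R.laurent_series_iff by (metis R.l_null R.m_closed)
    \<comment> \<open>The monomial \<open>x^a\<close> passes the series and the tensor sign and acts
      on x, while r is absorbed into the coefficients of \<phi>.\<close>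
    have "monomial R a r \<odot>\<^bsub>T\<^esub> tens x (ser \<phi>) = tens (monomial R a \<one>\<^bsub>R\<^esub> \<odot>\<^bsub>M\<^esub> x) (ser (\<lambda>l. \<phi> l \<otimes>\<^bsub>R\<^esub> r))"
      using add r * by (simp add: T_smult_tens R.series_in_mult_monomial tens_balanced)
    then show ?case
      using add r * by (simp add: TL.smult_r_distr rep_tensor tens_closed repd_add repd_tens M.smult_closed)
  qed
  show ?thesis
    using assms(1)
  proof (induction rule: R.Lau_induct)
    case zero
    have "(\<lambda>a :: int ^ 'n. \<zero>\<^bsub>R\<^esub>) = \<zero>\<^bsub>laurent_ring R\<^esub>"
      by (simp add: R.Lau_simps R.Nov_simps)
    then show ?case
      using assms(2) repd_subset repd_zero by (auto simp: TL.smult_zero_left)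
  next
    case (add f a r)
    obtain u where "rep u z" using assms(2) by (auto simp: repd_def)
    then have "monomial R a r \<odot>\<^bsub>T\<^esub> z \<in> repd" "z \<in> carrier T"
      using mono[OF add(2)] by (simp_all add: rep_tensor)
    then show ?case
      using add by (simp add: TL.smult_l_distr repd_add)
  qed
qed

text \<open>Finite generation enters here: the coefficients of all \<open>c l\<close> with respect
  to one finite generating set make up finitely many series, one for each generator.\<close>

lemma rep_of_bounded:
  assumes C: "fg_rmodule R C"
    and g: "g \<in> rmod_hom R C (restrict_scalars (laurent_const R) M)"
    and c: "\<And>l. c l \<in> carrier C" "\<And>l. l < b \<Longrightarrow> c l = \<zero>\<^bsub>C\<^esub>"
  shows "\<exists>z. rep (\<lambda>l. g (c l)) z"
proof -
  interpret C: right_module R C using C by (simp add: fg_rmodule_def)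
  obtain S where S: "finite S" "S \<subseteq> carrier C"
    and span: "\<And>x. x \<in> carrier C \<Longrightarrow> \<exists>r\<in>S \<rightarrow> carrier R. x = (\<Oplus>\<^bsub>C\<^esub>s\<in>S. r s \<odot>\<^bsub>C\<^esub> s)"
    using C by (auto simp: fg_rmodule_def)
  \<comment> \<open>Below b the coefficients are chosen to be zero. An arbitrary expansion of zero
    could be nontrivial, and the coefficient series would then not be bounded below.\<close>
  have "\<exists>r. r \<in> S \<rightarrow> carrier R \<and> c l = (\<Oplus>\<^bsub>C\<^esub>s\<in>S. r s \<odot>\<^bsub>C\<^esub> s) \<and> (l < b \<longrightarrow> (\<forall>s. r s = \<zero>\<^bsub>R\<^esub>))" for l
  proof (cases "l < b")
    case True
    have "(\<Oplus>\<^bsub>C\<^esub>s\<in>S. \<zero>\<^bsub>R\<^esub> \<odot>\<^bsub>C\<^esub> s) = (\<Oplus>\<^bsub>C\<^esub>s\<in>S. \<zero>\<^bsub>C\<^esub>)"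
      using S by (intro C.M.finsum_cong') (auto simp: C.smult_zero_left)
    then show ?thesis
      using True c(2) by (intro exI[of _ "\<lambda>_. \<zero>\<^bsub>R\<^esub>"]) auto
  qed (use span[OF c(1)] in blast)
  then obtain r where r: "\<And>l. r l \<in> S \<rightarrow> carrier R" "\<And>l. c l = (\<Oplus>\<^bsub>C\<^esub>s\<in>S. r l s \<odot>\<^bsub>C\<^esub> s)"
    "\<And>l s. l < b \<Longrightarrow> r l s = \<zero>\<^bsub>R\<^esub>"
    by metis
  have rS: "s \<in> S \<Longrightarrow> r l s \<in> carrier R" for l s using r(1) by blast
  have g_cl: "s \<in> S \<Longrightarrow> g s \<in> carrier M" for s using rmod_homD(1)[OF g] S by auto
  have gadd: "additive_map C M g"
    by (rule additive_mapI)
      (use rmod_homD[OF g] in \<open>simp_all add: C.M.abelian_group_axioms M.M.abelian_group_axioms\<close>)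
  have "g (c l) = (\<Oplus>\<^bsub>M\<^esub>s\<in>S. rsmult (r l s) (g s))" for l
  proof -
    have "g (c l) = (\<Oplus>\<^bsub>M\<^esub>s\<in>S. g (r l s \<odot>\<^bsub>C\<^esub> s))"
      unfolding r(2) using rS S by (intro additive_map_finsum[OF gadd]) (auto simp: C.smult_closed)
    also have "\<dots> = (\<Oplus>\<^bsub>M\<^esub>s\<in>S. rsmult (r l s) (g s))"
      using rS S g_cl rmod_homD(3)[OF g]
      by (intro M.M.finsum_cong') (auto simp: laurent_const_eq subset_iff)
    finally show ?thesis .
  qed
  moreover have "(\<lambda>l. r l s) \<in> laurent_series R" if "s \<in> S" for s
    using rS[OF that] r(3) by (auto simp: R.laurent_series_iff)
  ultimately show ?thesis
    using rep_sum[OF S(1), of g "\<lambda>s l. r l s"] g_cl by auto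
qed

text \<open>
  The solution is the geometric series \<open>\<Sum>n\<ge>0. X\<^sup>-\<^sup>n\<^sup>-\<^sup>1 Y\<^sup>n\<close> applied to \<open>u\<close>, with \<open>Y\<close> the shift; it converges
  because \<open>u\<close> is bounded below.
\<close>

lemma shift_solve:
  assumes "bounded_below u"
  shows "\<exists>v. bounded_below v \<and> (\<forall>l. u l = X \<odot>\<^bsub>M\<^esub> v l \<ominus>\<^bsub>M\<^esub> v (l - 1))"
proof -
  obtain b where u: "\<And>l. u l \<in> carrier M" "\<And>l. l < b \<Longrightarrow> u l = \<zero>\<^bsub>M\<^esub>"
    using assms by (auto simp: bounded_below_def)
  define w where "w = rec_nat \<zero>\<^bsub>M\<^esub> (\<lambda>n y. X_inv \<odot>\<^bsub>M\<^esub> (u (b + int n) \<oplus>\<^bsub>M\<^esub> y))"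
  have w_simps: "w 0 = \<zero>\<^bsub>M\<^esub>" "\<And>n. w (Suc n) = X_inv \<odot>\<^bsub>M\<^esub> (u (b + int n) \<oplus>\<^bsub>M\<^esub> w n)"
    by (simp_all add: w_def)
  have w_cl: "w n \<in> carrier M" for n
    by (induction n) (auto simp: w_simps u)
  define v where "v l = w (nat (l + 1 - b))" for l
  have "u l = X \<odot>\<^bsub>M\<^esub> v l \<ominus>\<^bsub>M\<^esub> v (l - 1)" for l
  proof (cases "l < b")
    case True
    then show ?thesis
      by (simp add: v_def w_simps u additive_map_zero[OF M.smult_additive] a_minus_def M.M.a_inv_zero)
  next
    case False
    then have n: "nat (l + 1 - b) = Suc (nat (l - b))" "b + int (nat (l - b)) = l" "l - 1 + 1 - b = l - b"
      by auto
    have "X \<odot>\<^bsub>M\<^esub> v l = u l \<oplus>\<^bsub>M\<^esub> v (l - 1)"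
      using n(2) by (simp only: v_def n w_simps X_X_inv u w_cl M.M.a_closed)
    moreover have "v (l - 1) \<in> carrier M" by (simp add: v_def w_cl)
    ultimately show ?thesis
      by (simp add: u a_minus_def M.M.a_assoc M.M.r_neg)
  qed
  moreover have "bounded_below v"
    by (rule bounded_belowI[of _ b]) (auto simp: v_def w_cl w_simps)
  ultimately show ?thesis by blast
qed

end

lemma finite_axis_preimage: "finite A \<Longrightarrow> finite {l. a - axis k l \<in> A}"
  for a :: "int ^ 'n::finite"
proof -
  assume "finite A"
  moreover have "inj (\<lambda>l. a - axis k l)"
    by (auto simp: inj_def axis_eq_axis)
  ultimately have "finite ((\<lambda>l. a - axis k l) -` A)"
    by (rule finite_vimageI)
  then show ?thesis by (simp add: vimage_def)
qed

section \<open>Coordinates over R of a projective L-module\<close>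

locale projective_laurent_module =
  laurent_module R M k + projective_data "laurent_ring R" M Y \<iota> p
  for R :: "('a, 'r) ring_scheme" and M :: "(int ^ 'n::finite \<Rightarrow> 'a, 'm) module" and k :: 'n
    and Y \<iota> p
begin

text \<open>The free L-module on Y is free over R on pairs of a generator and an exponent vector.
  \<open>coord\<close> and \<open>mgen\<close> are the dual basis over R that M inherits as a direct
  summand.\<close>

definition coord :: "'m \<times> (int ^ 'n) \<Rightarrow> 'm \<Rightarrow> 'a" where
  "coord g x = \<iota> x (fst g) (snd g)"

definition mgen :: "'m \<times> (int ^ 'n) \<Rightarrow> 'm" where
  "mgen g = monomial R (snd g) \<one>\<^bsub>R\<^esub> \<odot>\<^bsub>M\<^esub> gen (fst g)"

lemma mgen_closed: "fst g \<in> Y \<Longrightarrow> mgen g \<in> carrier M"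
  by (simp add: mgen_def M.smult_closed gen_closed)

lemma coord_closed: "x \<in> carrier M \<Longrightarrow> coord g x \<in> carrier R"
  by (simp add: coord_def emb_elem R.Lau_closed)

lemma coord_add:
  "\<lbrakk>x \<in> carrier M; y \<in> carrier M\<rbrakk> \<Longrightarrow> coord g (x \<oplus>\<^bsub>M\<^esub> y) = coord g x \<oplus>\<^bsub>R\<^esub> coord g y"
  by (simp add: coord_def emb_add R.Lau_simps R.Nov_simps)

lemma coord_additive: "additive_map M R (coord g)"
  by (rule additive_mapI)
    (simp_all add: M.M.abelian_group_axioms R.abelian_group_axioms coord_closed coord_add)

lemma coord_monomial:
  assumes "r \<in> carrier R" "x \<in> carrier M"
  shows "coord (i, a) (monomial R b r \<odot>\<^bsub>M\<^esub> x) = coord (i, a - b) x \<otimes>\<^bsub>R\<^esub> r"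
proof -
  have "\<And>a. \<iota> x i a \<in> carrier R" using emb_elem[OF assms(2)] R.Lau_closed by blast
  then show ?thesis
    using assms by (simp add: coord_def emb_smult R.Lau_simps R.monomial_mult)
qed

lemma coord_rsmult:
  "\<lbrakk>r \<in> carrier R; x \<in> carrier M\<rbrakk> \<Longrightarrow> coord g (rsmult r x) = coord g x \<otimes>\<^bsub>R\<^esub> r"
  by (cases g) (simp add: coord_monomial)

lemma coord_X: "x \<in> carrier M \<Longrightarrow> coord (i, a) (X \<odot>\<^bsub>M\<^esub> x) = coord (i, a - axis k 1) x"
  by (simp add: X_def coord_monomial coord_closed)

lemma coord_finite: "x \<in> carrier M \<Longrightarrow> finite {g. coord g x \<noteq> \<zero>\<^bsub>R\<^esub>}"
proof -
  assume x: "x \<in> carrier M"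
  have "{g. coord g x \<noteq> \<zero>\<^bsub>R\<^esub>} \<subseteq> (SIGMA i:{i. \<iota> x i \<noteq> \<zero>\<^bsub>laurent_ring R\<^esub>}. {a. \<iota> x i a \<noteq> \<zero>\<^bsub>R\<^esub>})"
    by (auto simp: coord_def R.Lau_simps R.Nov_simps)
  moreover have "finite \<dots>"
    using emb_finite[OF x] emb_elem[OF x] by (intro finite_SigmaI) (auto simp: R.Lau_carrier_iff)
  ultimately show ?thesis by (rule finite_subset)
qed

lemma coord_subset: "x \<in> carrier M \<Longrightarrow> {g. coord g x \<noteq> \<zero>\<^bsub>R\<^esub>} \<subseteq> Y \<times> UNIV"
  using emb_outside by (force simp: coord_def R.Lau_simps R.Nov_simps)

text \<open>The expansion is verified coefficientwise for \<iota> x in the free module and then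
  carried to M by p.\<close>

lemma coord_expand:
  assumes x: "x \<in> carrier M" and G: "finite G" "G \<subseteq> Y \<times> UNIV" "{g. coord g x \<noteq> \<zero>\<^bsub>R\<^esub>} \<subseteq> G"
  shows "x = (\<Oplus>\<^bsub>M\<^esub>g\<in>G. rsmult (coord g x) (mgen g))"
proof -
  let ?F = "free_rmodule (laurent_ring R :: (int ^ 'n \<Rightarrow> 'a) ring) Y"
  have F: "abelian_group ?F" by (rule M.R.free_rmodule_abelian_group)
  define m where "m g = monomial R (snd g) (coord g x) \<odot>\<^bsub>?F\<^esub> M.R.basis_elem (fst g)" for g
  have m_cl: "m g \<in> carrier ?F" if "g \<in> G" for g
    using that G x unfolding m_def by (intro M.R.basis_smult_closed) (auto simp: coord_closed)
  have m_eval: "m g i a = (if (i, a) = g then coord g x else \<zero>\<^bsub>R\<^esub>)" for g i a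
  proof -
    have mono: "monomial R (snd g) (coord g x) \<in> carrier (laurent_ring R)"
      using x by (simp add: coord_closed)
    have "m g i = (if i = fst g then monomial R (snd g) (coord g x) else \<zero>\<^bsub>laurent_ring R\<^esub>)"
      using M.R.l_one[OF mono] M.R.l_null[OF mono]
      by (simp add: m_def free_rmodule_simps M.R.basis_elem_def)
    then show ?thesis
      by (cases g) (auto simp: monomial_def R.Lau_simps R.Nov_simps)
  qed
  have add_p: "additive_map ?F M p"
    by (rule additive_mapI) (simp_all add: F M.M.abelian_group_axioms rmod_homD[OF proj])
  have "\<iota> x = (\<Oplus>\<^bsub>?F\<^esub>g\<in>G. m g)"
  proof (intro ext)
    fix i a
    have ev: "additive_map ?F R (\<lambda>f. f i a)"
      by (rule additive_mapI)
        (simp_all add: F R.abelian_group_axioms R.Lau_closed[OF M.R.free_rmodule_closed]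
          free_rmodule_simps(3) R.Lau_simps R.Nov_simps)
    have "(\<Oplus>\<^bsub>?F\<^esub>g\<in>G. m g) i a = (\<Oplus>\<^bsub>R\<^esub>g\<in>G. m g i a)"
      by (rule additive_map_finsum[OF ev G(1)]) (auto simp: m_cl)
    also have "\<dots> = (\<Oplus>\<^bsub>R\<^esub>g\<in>G. if (i, a) = g then coord g x else \<zero>\<^bsub>R\<^esub>)"
      by (simp add: m_eval)
    also have "\<dots> = coord (i, a) x"
    proof (cases "(i, a) \<in> G")
      case True
      then show ?thesis using x G by (intro R.finsum_singleton) (auto simp: coord_closed)
    next
      case False
      then have "(\<Oplus>\<^bsub>R\<^esub>g\<in>G. if (i, a) = g then coord g x else \<zero>\<^bsub>R\<^esub>) = (\<Oplus>\<^bsub>R\<^esub>g\<in>G. \<zero>\<^bsub>R\<^esub>)"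
        by (intro R.finsum_cong') auto
      moreover have "coord (i, a) x = \<zero>\<^bsub>R\<^esub>" using False G(3) by blast
      ultimately show ?thesis by (simp add: R.finsum_zero)
    qed
    finally show "\<iota> x i a = (\<Oplus>\<^bsub>?F\<^esub>g\<in>G. m g) i a" by (simp add: coord_def)
  qed
  then have "x = p (\<Oplus>\<^bsub>?F\<^esub>g\<in>G. m g)" using proj_emb[OF x] by simp
  also have "\<dots> = (\<Oplus>\<^bsub>M\<^esub>g\<in>G. p (m g))"
    by (rule additive_map_finsum[OF add_p G(1)]) (auto simp: m_cl)
  also have "\<dots> = (\<Oplus>\<^bsub>M\<^esub>g\<in>G. rsmult (coord g x) (mgen g))"
  proof (rule M.M.finsum_cong')
    fix g assume g: "g \<in> G"
    then have "fst g \<in> Y" using G by auto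
    then show "p (m g) = rsmult (coord g x) (mgen g)"
      using coord_closed[OF x] gen_closed[of "fst g"]
      by (simp add: m_def rmod_homD(3)[OF proj] M.R.basis_elem_closed mgen_def monomial_smult_smult)
        (simp add: gen_def)
  qed (use G x in \<open>auto simp: coord_closed mgen_closed\<close>)
  finally show ?thesis .
qed

lemma coord_series: "bounded_below u \<Longrightarrow> (\<lambda>l. coord g (u l)) \<in> laurent_series R"
  unfolding R.laurent_series_iff bounded_below_def
  using coord_closed additive_map_zero[OF coord_additive] by metis

text \<open>A single x has finitely many coordinates, and so have all coefficients of x \<phi>(Y)
  together. Expanding each x over \<open>mgen\<close> and moving the coordinates across the tensor
  sign recovers z from the coordinates of u alone. Stating this for all larger sets lets the
  induction enlarge G by each new summand.\<close>

lemma rep_coords: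
  "rep u z \<Longrightarrow> \<exists>G. finite G \<and> G \<subseteq> Y \<times> UNIV \<and> (\<forall>l. {g. coord g (u l) \<noteq> \<zero>\<^bsub>R\<^esub>} \<subseteq> G) \<and>
     (\<forall>G'. finite G' \<and> G \<subseteq> G' \<and> G' \<subseteq> Y \<times> UNIV \<longrightarrow>
        z = (\<Oplus>\<^bsub>T\<^esub>g\<in>G'. tens (mgen g) (ser (\<lambda>l. coord g (u l)))))"
proof (induction rule: rep.induct)
  case zero
  have z: "tens (mgen g) (ser (\<lambda>l. \<zero>\<^bsub>R\<^esub>)) = \<zero>\<^bsub>T\<^esub>" if "g \<in> Y \<times> UNIV" for g
    using that additive_map_zero[OF tens_right_additive, of "mgen g"]
    by (auto simp: R.series_in_zero mgen_closed)
  have "(\<Oplus>\<^bsub>T\<^esub>g\<in>G'. tens (mgen g) (ser (\<lambda>l. \<zero>\<^bsub>R\<^esub>))) = \<zero>\<^bsub>T\<^esub>" if "G' \<subseteq> Y \<times> UNIV" for G'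
  proof -
    have "(\<Oplus>\<^bsub>T\<^esub>g\<in>G'. tens (mgen g) (ser (\<lambda>l. \<zero>\<^bsub>R\<^esub>))) = (\<Oplus>\<^bsub>T\<^esub>g\<in>G'. \<zero>\<^bsub>T\<^esub>)"
      using that z by (intro T.finsum_cong') auto
    then show ?thesis by simp
  qed
  then show ?case
    by (intro exI[of _ "{}"]) (auto simp: additive_map_zero[OF coord_additive])
next
  case (add u z x \<phi>)
  from add.IH obtain G where G: "finite G" "G \<subseteq> Y \<times> UNIV"
    and G3: "\<forall>l. {g. coord g (u l) \<noteq> \<zero>\<^bsub>R\<^esub>} \<subseteq> G"
    and G4: "\<forall>G'. finite G' \<and> G \<subseteq> G' \<and> G' \<subseteq> Y \<times> UNIV \<longrightarrow>
        z = (\<Oplus>\<^bsub>T\<^esub>g\<in>G'. tens (mgen g) (ser (\<lambda>l. coord g (u l))))"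
    by (elim exE conjE) (rule that)
  have u: "bounded_below u" using add rep_props by blast
  note u_cl = bounded_below_closed[OF u]
  have co: "coord g (u l \<oplus>\<^bsub>M\<^esub> rsmult (\<phi> l) x) = coord g (u l) \<oplus>\<^bsub>R\<^esub> coord g x \<otimes>\<^bsub>R\<^esub> \<phi> l" for g l
    using add u_cl by (simp add: coord_add coord_rsmult series_elem)
  let ?G = "G \<union> {g. coord g x \<noteq> \<zero>\<^bsub>R\<^esub>}"
  have "{g. coord g (u l \<oplus>\<^bsub>M\<^esub> rsmult (\<phi> l) x) \<noteq> \<zero>\<^bsub>R\<^esub>} \<subseteq> ?G" for l
  proof
    fix g assume "g \<in> {g. coord g (u l \<oplus>\<^bsub>M\<^esub> rsmult (\<phi> l) x) \<noteq> \<zero>\<^bsub>R\<^esub>}"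
    then have "coord g (u l) \<noteq> \<zero>\<^bsub>R\<^esub> \<or> coord g x \<noteq> \<zero>\<^bsub>R\<^esub>"
      using series_elem[OF add.hyps(3), of l] by (auto simp: co)
    then show "g \<in> ?G" using G3 by blast
  qed
  moreover have "z \<oplus>\<^bsub>T\<^esub> tens x (ser \<phi>) =
      (\<Oplus>\<^bsub>T\<^esub>g\<in>G'. tens (mgen g) (ser (\<lambda>l. coord g (u l \<oplus>\<^bsub>M\<^esub> rsmult (\<phi> l) x))))"
    if G': "finite G'" "?G \<subseteq> G'" "G' \<subseteq> Y \<times> UNIV" for G'
  proof -
    have m: "mgen g \<in> carrier M" if "g \<in> G'" for g
      using subsetD[OF G'(3) that] by (intro mgen_closed) auto
    have ser1: "(\<lambda>l. coord g (u l)) \<in> laurent_series R" for g by (rule coord_series[OF u])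
    have ser2: "(\<lambda>l. coord g x \<otimes>\<^bsub>R\<^esub> \<phi> l) \<in> laurent_series R" for g
      using add.hyps(2,3) coord_closed[of x g] unfolding R.laurent_series_iff by (metis R.r_null R.m_closed)
    have "tens x (ser \<phi>) = tens (\<Oplus>\<^bsub>M\<^esub>g\<in>G'. rsmult (coord g x) (mgen g)) (ser \<phi>)"
      using coord_expand[of x G'] add.hyps(2) G' by simp
    also have "\<dots> = (\<Oplus>\<^bsub>T\<^esub>g\<in>G'. tens (rsmult (coord g x) (mgen g)) (ser \<phi>))"
      using add.hyps m coord_closed
      by (intro additive_map_finsum[OF tens_left_additive] G') auto
    also have "\<dots> = (\<Oplus>\<^bsub>T\<^esub>g\<in>G'. tens (mgen g) (ser (\<lambda>l. coord g x \<otimes>\<^bsub>R\<^esub> \<phi> l)))"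
      using add.hyps m ser2
      by (intro T.finsum_cong') (auto simp: tens_balanced coord_closed R.const_mult_series_in)
    finally have 1: "tens x (ser \<phi>) = (\<Oplus>\<^bsub>T\<^esub>g\<in>G'. tens (mgen g) (ser (\<lambda>l. coord g x \<otimes>\<^bsub>R\<^esub> \<phi> l)))" .
    have 2: "z = (\<Oplus>\<^bsub>T\<^esub>g\<in>G'. tens (mgen g) (ser (\<lambda>l. coord g (u l))))"
      by (rule G4[rule_format]) (use G' in auto)
    have "(\<Oplus>\<^bsub>T\<^esub>g\<in>G'. tens (mgen g) (ser (\<lambda>l. coord g (u l \<oplus>\<^bsub>M\<^esub> rsmult (\<phi> l) x)))) =
      (\<Oplus>\<^bsub>T\<^esub>g\<in>G'. tens (mgen g) (ser (\<lambda>l. coord g (u l))) \<oplus>\<^bsub>T\<^esub>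
                 tens (mgen g) (ser (\<lambda>l. coord g x \<otimes>\<^bsub>R\<^esub> \<phi> l)))"
      using m ser1 ser2
      by (intro T.finsum_cong') (auto simp: co R.series_in_add tens_add_right tens_closed)
    also have "\<dots> = z \<oplus>\<^bsub>T\<^esub> tens x (ser \<phi>)"
      unfolding 1 by (subst 2, rule T.finsum_addf) (use m ser1 ser2 in auto)
    finally show ?thesis by simp
  qed
  ultimately show ?case
    using G(1,2) coord_finite[OF add.hyps(2)] coord_subset[OF add.hyps(2)]
    by (intro exI[of _ ?G]) auto
qed

lemma rep_zero_unique:
  assumes "rep (\<lambda>l. \<zero>\<^bsub>M\<^esub>) z" shows "z = \<zero>\<^bsub>T\<^esub>"
proof -
  from rep_coords[OF assms] obtain G where G: "finite G" "G \<subseteq> Y \<times> UNIV"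
    and G4: "\<forall>G'. finite G' \<and> G \<subseteq> G' \<and> G' \<subseteq> Y \<times> UNIV \<longrightarrow>
        z = (\<Oplus>\<^bsub>T\<^esub>g\<in>G'. tens (mgen g) (ser (\<lambda>l. coord g \<zero>\<^bsub>M\<^esub>)))"
    by (elim exE conjE) (rule that)
  have eq: "z = (\<Oplus>\<^bsub>T\<^esub>g\<in>G. tens (mgen g) (ser (\<lambda>l. coord g \<zero>\<^bsub>M\<^esub>)))"
    by (rule G4[rule_format]) (use G in auto)
  have "tens (mgen g) (ser (\<lambda>l. coord g \<zero>\<^bsub>M\<^esub>)) = \<zero>\<^bsub>T\<^esub>" if "g \<in> G" for g
    using that G additive_map_zero[OF tens_right_additive, of "mgen g"]
    by (auto simp: R.series_in_zero mgen_closed additive_map_zero[OF coord_additive])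
  then have "z = (\<Oplus>\<^bsub>T\<^esub>g\<in>G. \<zero>\<^bsub>T\<^esub>)"
    unfolding eq by (intro T.finsum_cong') auto
  then show ?thesis by simp
qed

text \<open>By additivity this reduces to the zero series, whose coordinates vanish. The
  substitution of X for Y is thus a well-defined map on represented series.\<close>

lemma rep_unique:
  assumes "rep u z" "rep u w" shows "z = w"
proof -
  have "rep (\<lambda>l. \<zero>\<^bsub>M\<^esub>) (z \<ominus>\<^bsub>T\<^esub> w)"
    using rep_diff[OF assms] rep_closed[OF assms(1)] by (simp add: a_minus_def M.M.r_neg)
  then have "z \<oplus>\<^bsub>T\<^esub> \<ominus>\<^bsub>T\<^esub> w = \<zero>\<^bsub>T\<^esub>"
    unfolding a_minus_def[symmetric] by (rule rep_zero_unique)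
  then show ?thesis
    using assms by (metis rep_tensor T.minus_equality T.minus_minus T.a_inv_closed)
qed

text \<open>The coefficient at a of the i-th coordinate, extended to the Novikov tensor product.
  Balancedness is associativity of multiplication in the Novikov ring.\<close>

lemma tensor_coord:
  obtains h where "additive_map T R h"
    "\<And>x s. \<lbrakk>x \<in> carrier M; s \<in> carrier (novikov_ring R)\<rbrakk> \<Longrightarrow> h (tens x s) = (\<iota> x i \<otimes>\<^bsub>novikov_ring R\<^esub> s) a"
proof (rule tens_lift[OF R.abelian_group_axioms, of "\<lambda>x s. (\<iota> x i \<otimes>\<^bsub>novikov_ring R\<^esub> s) a"])
  note cl = emb_elem[THEN Lau_Nov]
  show "(\<iota> x i \<otimes>\<^bsub>novikov_ring R\<^esub> s) a \<in> carrier R"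
    if "x \<in> carrier M" "s \<in> carrier (novikov_ring R)" for x s
    using that cl by (intro R.Nov_closed) simp
  show "(\<iota> (x \<oplus>\<^bsub>M\<^esub> y) i \<otimes>\<^bsub>novikov_ring R\<^esub> s) a =
        (\<iota> x i \<otimes>\<^bsub>novikov_ring R\<^esub> s) a \<oplus>\<^bsub>R\<^esub> (\<iota> y i \<otimes>\<^bsub>novikov_ring R\<^esub> s) a"
    if "x \<in> carrier M" "y \<in> carrier M" "s \<in> carrier (novikov_ring R)" for x y s
    using that cl by (simp add: emb_add R.Lau_simps S.l_distr) (simp add: R.Nov_simps)
  show "(\<iota> x i \<otimes>\<^bsub>novikov_ring R\<^esub> (s \<oplus>\<^bsub>novikov_ring R\<^esub> t)) a =
        (\<iota> x i \<otimes>\<^bsub>novikov_ring R\<^esub> s) a \<oplus>\<^bsub>R\<^esub> (\<iota> x i \<otimes>\<^bsub>novikov_ring R\<^esub> t) a"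
    if "x \<in> carrier M" "s \<in> carrier (novikov_ring R)" "t \<in> carrier (novikov_ring R)" for x s t
    using that cl by (simp add: S.r_distr) (simp add: R.Nov_simps)
  show "(\<iota> (f \<odot>\<^bsub>M\<^esub> x) i \<otimes>\<^bsub>novikov_ring R\<^esub> s) a =
        (\<iota> x i \<otimes>\<^bsub>novikov_ring R\<^esub> (f \<otimes>\<^bsub>novikov_ring R\<^esub> s)) a"
    if "f \<in> carrier (laurent_ring R)" "x \<in> carrier M" "s \<in> carrier (novikov_ring R)" for f x s
    using that cl by (simp add: emb_smult R.Lau_simps S.m_assoc)
qed (rule that)

text \<open>With X for Y, the series u becomes the formal sum of the X^l \<open>u l\<close>, and the
  coefficient of X^l \<open>u l\<close> at a is that of \<open>u l\<close> at a - l on the axis of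
  X. For each summand x \<phi>(Y) only finitely many l matter, because the coordinates of x are
  Laurent polynomials.\<close>

lemma rep_tensor_coord:
  assumes h: "additive_map T R h"
    "\<And>x s. \<lbrakk>x \<in> carrier M; s \<in> carrier (novikov_ring R)\<rbrakk> \<Longrightarrow> h (tens x s) = (\<iota> x i \<otimes>\<^bsub>novikov_ring R\<^esub> s) a"
  shows "rep u z \<Longrightarrow> \<exists>B. finite B \<and>
    (\<forall>B'. finite B' \<and> B \<subseteq> B' \<longrightarrow> h z = (\<Oplus>\<^bsub>R\<^esub>l\<in>B'. coord (i, a - axis k l) (u l)))"
proof (induction rule: rep.induct)
  case zero
  then show ?case
    by (intro exI[of _ "{}"]) (auto simp: additive_map_zero[OF coord_additive] additive_map_zero[OF h(1)])
next
  case (add u z x \<phi>)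
  then obtain B where B: "finite B"
    "\<And>B'. \<lbrakk>finite B'; B \<subseteq> B'\<rbrakk> \<Longrightarrow> h z = (\<Oplus>\<^bsub>R\<^esub>l\<in>B'. coord (i, a - axis k l) (u l))"
    by blast
  have u_cl: "u l \<in> carrier M" for l using add rep_closed by blast
  let ?B = "B \<union> {l. a - axis k l \<in> {b. \<iota> x i b \<noteq> \<zero>\<^bsub>R\<^esub>}}"
  have "finite ?B"
    using B(1) emb_elem[OF add.hyps(2)] by (intro finite_UnI finite_axis_preimage) (auto simp: R.Lau_carrier_iff)
  moreover have "h (z \<oplus>\<^bsub>T\<^esub> tens x (ser \<phi>)) =
      (\<Oplus>\<^bsub>R\<^esub>l\<in>B'. coord (i, a - axis k l) (u l \<oplus>\<^bsub>M\<^esub> rsmult (\<phi> l) x))"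
    if B': "finite B'" "?B \<subseteq> B'" for B'
  proof -
    have "h (tens x (ser \<phi>)) = (\<Oplus>\<^bsub>R\<^esub>l\<in>B'. \<iota> x i (a - axis k l) \<otimes>\<^bsub>R\<^esub> \<phi> l)"
      unfolding h(2)[OF add.hyps(2) series_closed[OF add.hyps(3)]]
      by (rule R.Lau_mult_series_in) (use add.hyps emb_elem B' in auto)
    also have "\<dots> = (\<Oplus>\<^bsub>R\<^esub>l\<in>B'. coord (i, a - axis k l) (rsmult (\<phi> l) x))"
      using add.hyps coord_closed
      by (intro R.finsum_cong') (auto simp: coord_rsmult series_elem, simp add: coord_def)
    finally have "h (z \<oplus>\<^bsub>T\<^esub> tens x (ser \<phi>)) = (\<Oplus>\<^bsub>R\<^esub>l\<in>B'. coord (i, a - axis k l) (u l)) \<oplus>\<^bsub>R\<^esub>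
        (\<Oplus>\<^bsub>R\<^esub>l\<in>B'. coord (i, a - axis k l) (rsmult (\<phi> l) x))"
      using B(2)[of B'] B' add.hyps by (simp add: additive_map_add[OF h(1)] rep_tensor tens_closed)
    also have "\<dots> = (\<Oplus>\<^bsub>R\<^esub>l\<in>B'. coord (i, a - axis k l) (u l) \<oplus>\<^bsub>R\<^esub> coord (i, a - axis k l) (rsmult (\<phi> l) x))"
      using add.hyps u_cl by (intro R.finsum_addf[symmetric]) (auto simp: coord_closed series_elem)
    also have "\<dots> = (\<Oplus>\<^bsub>R\<^esub>l\<in>B'. coord (i, a - axis k l) (u l \<oplus>\<^bsub>M\<^esub> rsmult (\<phi> l) x))"
      using add.hyps u_cl by (intro R.finsum_cong') (auto simp: coord_add coord_closed series_elem)
    finally show ?thesis .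
  qed
  ultimately show ?case by blast
qed

end

lemma (in abelian_group) finsum_telescope:
  fixes W :: "int \<Rightarrow> 'a"
  assumes W: "\<And>l. W l \<in> carrier G" "\<And>l. l < b \<Longrightarrow> W l = \<zero>" and m: "b - 1 \<le> m"
  shows "(\<Oplus>l\<in>{b..m}. W l \<ominus> W (l - 1)) = W m"
  using m
proof (induction m rule: int_ge_induct)
  case base
  then show ?case using W(2) by simp
next
  case (step m)
  then have "{b..m + 1} = insert (m + 1) {b..m}" by auto
  then have "(\<Oplus>l\<in>{b..m + 1}. W l \<ominus> W (l - 1)) = (W (m + 1) \<ominus> W m) \<oplus> (\<Oplus>l\<in>{b..m}. W l \<ominus> W (l - 1))"
    using W(1) by (simp add: finsum_insert Pi_def)
  also have "\<dots> = W (m + 1)"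
    unfolding step.IH using W(1) by (simp add: a_minus_def a_assoc l_neg)
  finally show ?case .
qed

context projective_laurent_module
begin

text \<open>
  If \<open>(X - Y) v\<close> maps to zero, then \<open>v\<close> is represented. In coordinates,
  \<open>v m = \<Sum>l\<le>m. X\<^sup>l\<^sup>-\<^sup>m\<^sup>-\<^sup>1 u l = - (\<Sum>l>m. X\<^sup>l\<^sup>-\<^sup>m\<^sup>-\<^sup>1 u l)\<close>, where all \<open>u l\<close> have support in one finite set.
  The first expression bounds the exponents of \<open>X\<close> in all \<open>v m\<close> from above, the second from below.
\<close>

lemma rep_shift_inverse:
  assumes u: "rep u \<zero>\<^bsub>T\<^esub>" and v: "bounded_below v"
    and uv: "\<And>l. u l = X \<odot>\<^bsub>M\<^esub> v l \<ominus>\<^bsub>M\<^esub> v (l - 1)"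
  shows "\<exists>w. rep v w"
proof -
  from rep_coords[OF u] obtain G where G: "finite G" "G \<subseteq> Y \<times> UNIV"
    and G3: "\<forall>l. {g. coord g (u l) \<noteq> \<zero>\<^bsub>R\<^esub>} \<subseteq> G"
    by (elim exE conjE) (rule that)
  obtain b where vb: "\<And>l. l < b \<Longrightarrow> v l = \<zero>\<^bsub>M\<^esub>" and v_cl: "\<And>l. v l \<in> carrier M"
    using v by (auto simp: bounded_below_def)
  have axis_add: "axis k l + axis k l' = (axis k (l + l') :: int ^ 'n)" for l l'
    by (simp add: vec_eq_iff axis_def)
  have between: "\<exists>s t. 0 \<le> s \<and> 0 \<le> t \<and> (i, c + axis k s) \<in> G \<and> (i, c - axis k t) \<in> G"
    if nz: "coord (i, c) (v m) \<noteq> \<zero>\<^bsub>R\<^esub>" for i c m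
  proof -
    \<comment> \<open>Multiplying \<open>u l = X v l - v (l - 1)\<close> by X^l gives a telescoping
      difference. \<open>U l\<close> and \<open>W l\<close> are the coefficients at a of X^l
      \<open>u l\<close> and X^(l+1) \<open>v l\<close>, and a is chosen so that \<open>W m\<close>
      is the given coordinate of \<open>v m\<close>.\<close>
    define a where "a = c + axis k (m + 1)"
    define W where "W l = coord (i, a - axis k (l + 1)) (v l)" for l
    define U where "U l = coord (i, a - axis k l) (u l)" for l
    have W_cl: "W l \<in> carrier R" for l by (simp add: W_def coord_closed v_cl)
    have W0: "W l = \<zero>\<^bsub>R\<^esub>" if "l < b" for l
      using vb[OF that] by (simp add: W_def additive_map_zero[OF coord_additive])
    have UW: "U l = W l \<ominus>\<^bsub>R\<^esub> W (l - 1)" for l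
      using v_cl
      by (simp add: U_def W_def uv additive_map_diff[OF coord_additive] coord_X diff_diff_eq axis_add)
    have U_G: "(i, a - axis k l) \<in> G" if "U l \<noteq> \<zero>\<^bsub>R\<^esub>" for l
      using that G3 unfolding U_def by blast
    have Wm: "W m \<noteq> \<zero>\<^bsub>R\<^esub>" using nz by (simp add: W_def a_def)
    then have "b \<le> m" using W0 by force
    then have sum: "(\<Oplus>\<^bsub>R\<^esub>l\<in>{b..m}. U l) = W m"
      unfolding UW using R.finsum_telescope[of W b m] W_cl W0 by simp
    have U_cl: "U l \<in> carrier R" for l by (simp add: UW W_cl)
    have "\<exists>l\<in>{b..m}. U l \<noteq> \<zero>\<^bsub>R\<^esub>"
    proof (rule ccontr)
      assume "\<not> ?thesis"
      then have "(\<Oplus>\<^bsub>R\<^esub>l\<in>{b..m}. U l) = (\<Oplus>\<^bsub>R\<^esub>l\<in>{b..m}. \<zero>\<^bsub>R\<^esub>)"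
        by (intro R.finsum_cong') auto
      then show False using sum Wm by (simp add: R.finsum_zero)
    qed
    then obtain l where l: "l \<le> m" "(i, a - axis k l) \<in> G" using U_G by auto
    \<comment> \<open>Otherwise the sum of \<open>U l\<close> over all relevant l would stop at m
      and equal \<open>W m\<close>. But it is a coefficient of the tensor represented by u, which is
      zero.\<close>
    have "\<exists>l>m. U l \<noteq> \<zero>\<^bsub>R\<^esub>"
    proof (rule ccontr)
      assume neg: "\<not> ?thesis"
      obtain h where h: "additive_map T R h"
        "\<And>x s. \<lbrakk>x \<in> carrier M; s \<in> carrier (novikov_ring R)\<rbrakk> \<Longrightarrow> h (tens x s) = (\<iota> x i \<otimes>\<^bsub>novikov_ring R\<^esub> s) a"
        by (rule tensor_coord[of i a]) (rule that)
      have "\<exists>B. finite B \<and>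
          (\<forall>B'. finite B' \<and> B \<subseteq> B' \<longrightarrow> h \<zero>\<^bsub>T\<^esub> = (\<Oplus>\<^bsub>R\<^esub>l\<in>B'. coord (i, a - axis k l) (u l)))"
        by (rule rep_tensor_coord[OF h(1) _ u]) (rule h(2))
      then obtain B where B: "finite B"
        and B2: "\<forall>B'. finite B' \<and> B \<subseteq> B' \<longrightarrow> h \<zero>\<^bsub>T\<^esub> = (\<Oplus>\<^bsub>R\<^esub>l\<in>B'. coord (i, a - axis k l) (u l))"
        by (elim exE conjE) (rule that)
      have "\<zero>\<^bsub>R\<^esub> = (\<Oplus>\<^bsub>R\<^esub>l\<in>B \<union> {b..m}. U l)"
        using B2[rule_format, of "B \<union> {b..m}"] B by (simp add: U_def additive_map_zero[OF h(1)])
      also have "\<dots> = (\<Oplus>\<^bsub>R\<^esub>l\<in>{b..m}. U l)"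
      proof (rule R.add.finprod_mono_neutral_cong_right)
        show "U l = \<zero>\<^bsub>R\<^esub>" if "l \<in> B \<union> {b..m} - {b..m}" for l
        proof (cases "l < b")
          case True
          then show ?thesis using W0[of l] W0[of "l - 1"] by (simp add: UW a_minus_def)
        next
          case False
          then show ?thesis using that neg by auto
        qed
      qed (auto simp: B U_cl)
      finally show False using sum Wm by simp
    qed
    then obtain l' where l': "m < l'" "(i, a - axis k l') \<in> G" using U_G by auto
    have "a - axis k l = c + axis k (m + 1 - l)" "a - axis k l' = c - axis k (l' - m - 1)"
      by (simp_all add: a_def vec_eq_iff axis_def)
    then show ?thesis
      using l l' by (intro exI[of _ "m + 1 - l"] exI[of _ "l' - m - 1"]) auto
  qed
  \<comment> \<open>The exponents lying between two points of G on a line parallel to the axis of X.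
    Such a point is the lower end of its segment plus t, where t is at most the difference of the
    two ends, whence finiteness.\<close>
  define G' where "G' = {(i, c). \<exists>s t. 0 \<le> s \<and> 0 \<le> t \<and> (i, c + axis k s) \<in> G \<and> (i, c - axis k t) \<in> G}"
  have "G' \<subseteq> (\<lambda>(g, t). (fst g, snd g + axis k t)) ` (SIGMA g:G. \<Union>g'\<in>G. {0..(snd g' - snd g) $ k})"
  proof
    fix g assume "g \<in> G'"
    then obtain i c s t where g: "g = (i, c)" "0 \<le> s" "0 \<le> t" "(i, c + axis k s) \<in> G" "(i, c - axis k t) \<in> G"
      by (auto simp: G'_def)
    then have "((i, c - axis k t), t) \<in> (SIGMA g:G. \<Union>g'\<in>G. {0..(snd g' - snd g) $ k})"
      by (auto intro!: bexI[of _ "(i, c + axis k s)"] simp: axis_def)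
    then show "g \<in> (\<lambda>(g, t). (fst g, snd g + axis k t)) ` (SIGMA g:G. \<Union>g'\<in>G. {0..(snd g' - snd g) $ k})"
      using g by (intro image_eqI[of _ _ "((i, c - axis k t), t)"]) auto
  qed
  then have G'_fin: "finite G'"
    by (rule finite_subset) (use G(1) in auto)
  have G'_sub: "G' \<subseteq> Y \<times> UNIV" using G(2) by (auto simp: G'_def)
  have "{g. coord g (v l) \<noteq> \<zero>\<^bsub>R\<^esub>} \<subseteq> G'" for l
    using between by (auto simp: G'_def)
  then have "v l = (\<Oplus>\<^bsub>M\<^esub>g\<in>G'. rsmult (coord g (v l)) (mgen g))" for l
    by (intro coord_expand v_cl G'_fin G'_sub)
  moreover have "rep (\<lambda>l. \<Oplus>\<^bsub>M\<^esub>g\<in>G'. rsmult (coord g (v l)) (mgen g))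
      (\<Oplus>\<^bsub>T\<^esub>g\<in>G'. tens (mgen g) (ser (\<lambda>l. coord g (v l))))"
    using G'_sub by (intro rep_sum[OF G'_fin] coord_series[OF v] mgen_closed) auto
  ultimately show ?thesis by auto
qed

end

section \<open>Linear maps acting on represented series\<close>

lemma laurent_module_intro:
  fixes M :: "(int ^ 'n::finite \<Rightarrow> 'a, 'm) module"
  assumes "ring R" "right_module (laurent_ring R) M"
  shows "laurent_module R M"
proof -
  interpret R: ring R by fact
  have "ring (novikov_ring R :: (int ^ 'n \<Rightarrow> 'a) ring)" by (rule R.Nov_ring)
  then show ?thesis
    using assms
    by (auto simp: laurent_module_def tensor_def tensor_axioms_def intro: R.Lau_subset_Nov)
qed

text \<open>The map acts on the factor x of each summand x \<phi>(Y). As it is only R-linear, it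
  need not respect tensors over L, so nothing relates w to z.\<close>

lemma rep_map:
  fixes M :: "(int ^ 'n::finite \<Rightarrow> 'a, 'm) module" and M' :: "(int ^ 'n::finite \<Rightarrow> 'a, 'p) module"
  assumes M: "laurent_module R M" and M': "laurent_module R M'"
    and h: "h \<in> rmod_hom R (restrict_scalars (laurent_const R) M) (restrict_scalars (laurent_const R) M')"
    and rep: "laurent_module.rep R M k u z"
  shows "\<exists>w. laurent_module.rep R M' k (\<lambda>l. h (u l)) w"
proof -
  interpret M: laurent_module R M k by (rule M)
  interpret M': laurent_module R M' k by (rule M')
  have add: "additive_map M M' h"
    by (rule additive_mapI)
      (use rmod_homD[OF h] in \<open>simp_all add: M.M.M.abelian_group_axioms M'.M.M.abelian_group_axioms\<close>)
  have smult: "h (M.rsmult r x) = M'.rsmult r (h x)" if "r \<in> carrier R" "x \<in> carrier M" for r x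
    using rmod_homD(3)[OF h, of r x] that by (simp add: laurent_const_eq)
  from rep show ?thesis
  proof (induction rule: M.rep.induct)
    case zero
    then show ?case using M'.rep.zero by (auto simp: additive_map_zero[OF add])
  next
    case (add u z x \<phi>)
    then obtain w where "M'.rep (\<lambda>l. h (u l)) w" by blast
    then have "M'.rep (\<lambda>l. h (u l) \<oplus>\<^bsub>M'\<^esub> M'.rsmult (\<phi> l) (h x)) (w \<oplus>\<^bsub>M'.T\<^esub> M'.tens (h x) (M'.ser \<phi>))"
      using add.hyps additive_map_closed[OF \<open>additive_map M M' h\<close>] by (intro M'.rep.add) auto
    moreover have "h (u l \<oplus>\<^bsub>M\<^esub> M.rsmult (\<phi> l) x) = h (u l) \<oplus>\<^bsub>M'\<^esub> M'.rsmult (\<phi> l) (h x)" for l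
      using add.hyps
      by (simp add: additive_map_add[OF \<open>additive_map M M' h\<close>] M.rep_closed M.series_elem smult)
    ultimately show ?case by auto
  qed
qed

text \<open>For an L-linear map, acting on coefficients is compatible with the substitution of X for
  Y.\<close>

lemma rep_extend_map:
  fixes M :: "(int ^ 'n::finite \<Rightarrow> 'a, 'm) module" and M' :: "(int ^ 'n::finite \<Rightarrow> 'a, 'p) module"
  assumes M: "laurent_module R M" and M': "laurent_module R M'"
    and h: "h \<in> rmod_hom (laurent_ring R) M M'"
    and rep: "laurent_module.rep R M k u z"
  shows "laurent_module.rep R M' k (\<lambda>l. h (u l))
           (extend_map (laurent_ring R) (novikov_ring R) (\<lambda>f. f) M' h z)"
proof -
  interpret M: laurent_module R M k by (rule M)
  interpret M': laurent_module R M' k by (rule M')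
  interpret h: tensor_map "laurent_ring R" "novikov_ring R" "\<lambda>f. f" M M' h
    by unfold_locales (rule h)
  note add = rmod_hom_additive[OF h M.M.right_module_axioms M'.M.right_module_axioms]
  from rep show ?thesis
  proof (induction rule: M.rep.induct)
    case zero
    then show ?case
      using M'.rep.zero by (simp add: additive_map_zero[OF add] additive_map_zero[OF h.extend_map_additive])
  next
    case step: (add u z x \<phi>)
    let ?h = "extend_map (laurent_ring R) (novikov_ring R) (\<lambda>f. f) M' h"
    have "M'.rep (\<lambda>l. h (u l) \<oplus>\<^bsub>M'\<^esub> M'.rsmult (\<phi> l) (h x)) (?h z \<oplus>\<^bsub>M'.T\<^esub> M'.tens (h x) (M'.ser \<phi>))"
      using step additive_map_closed[OF add] by (intro M'.rep.add) auto
    moreover have "h (u l \<oplus>\<^bsub>M\<^esub> M.rsmult (\<phi> l) x) = h (u l) \<oplus>\<^bsub>M'\<^esub> M'.rsmult (\<phi> l) (h x)" for l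
      using step.hyps
      by (simp add: additive_map_add[OF add] M.rep_closed M.series_elem rmod_homD(3)[OF h])
    moreover have "?h (z \<oplus>\<^bsub>M.T\<^esub> M.tens x (M.ser \<phi>)) = ?h z \<oplus>\<^bsub>M'.T\<^esub> M'.tens (h x) (M'.ser \<phi>)"
      using step.hyps
      by (simp add: additive_map_add[OF h.extend_map_additive] M.rep_tensor M.tens_closed h.extend_map_tens)
    ultimately show ?case by simp
  qed
qed

section \<open>Acyclicity\<close>

text \<open>
  With \<open>w = (X - Y)\<^sup>-\<^sup>1 u\<close>, which need not be represented, the series \<open>w + d0 (s1 w) = t1 w - s2 (d1 w)\<close>
  is. Applying \<open>X - Y\<close> shows that \<open>u\<close> is homologous to a series mapping to zero, via the bounding
  series \<open>m = (X - Y) (s1 w)\<close>, which is then replaced by the represented \<open>t0 m - s1 (d0 m)\<close>.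
\<close>

lemma repd_cycle_is_boundary:
  fixes P Q N :: "(int ^ 'n::finite \<Rightarrow> 'a, 'm) module" and k :: 'n
  assumes P: "laurent_module R P"
    and Q: "projective_laurent_module R Q YQ \<iota>Q pQ" and N: "projective_laurent_module R N YN \<iota>N pN"
    and d0: "d0 \<in> rmod_hom (laurent_ring R) P Q" and d1: "d1 \<in> rmod_hom (laurent_ring R) Q N"
    and s1: "s1 \<in> rmod_hom R (restrict_scalars (laurent_const R) Q) (restrict_scalars (laurent_const R) P)"
    and s2: "s2 \<in> rmod_hom R (restrict_scalars (laurent_const R) N) (restrict_scalars (laurent_const R) Q)"
    and t0: "\<And>u. laurent_module.bounded_below P u \<Longrightarrow> \<exists>z. laurent_module.rep R P k (\<lambda>l. t0 (u l)) z"
    and t1: "\<And>u. laurent_module.bounded_below Q u \<Longrightarrow> \<exists>z. laurent_module.rep R Q k (\<lambda>l. t1 (u l)) z"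
    and t1_eq: "\<And>x. x \<in> carrier Q \<Longrightarrow> t1 x \<ominus>\<^bsub>Q\<^esub> s2 (d1 x) = x \<oplus>\<^bsub>Q\<^esub> d0 (s1 x)"
    and t0_eq: "\<And>x. x \<in> carrier P \<Longrightarrow> d0 (t0 x \<ominus>\<^bsub>P\<^esub> s1 (d0 x)) = d0 x"
    and z: "z \<in> laurent_module.repd R Q k"
      "extend_map (laurent_ring R) (novikov_ring R) (\<lambda>f. f) N d1 z =
       \<zero>\<^bsub>extend_scalars (laurent_ring R) (novikov_ring R) (\<lambda>f. f) N\<^esub>"
  shows "\<exists>w\<in>laurent_module.repd R P k.
           extend_map (laurent_ring R) (novikov_ring R) (\<lambda>f. f) Q d0 w = z"
proof -
  interpret P: laurent_module R P k by (rule P)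
  interpret Q: projective_laurent_module R Q k YQ \<iota>Q pQ by (rule Q)
  interpret N: projective_laurent_module R N k YN \<iota>N pN by (rule N)
  interpret d0: tensor_map "laurent_ring R" "novikov_ring R" "\<lambda>f. f" P Q d0
    by unfold_locales (rule d0)
  note Qm = Q.laurent_module_axioms and Nm = N.laurent_module_axioms
  note d0_add = rmod_hom_additive[OF d0 P.M.right_module_axioms Q.M.right_module_axioms]
  note d1_add = rmod_hom_additive[OF d1 Q.M.right_module_axioms N.M.right_module_axioms]
  have s1_add: "additive_map Q P s1"
    by (rule additive_mapI)
      (use rmod_homD[OF s1] in \<open>simp_all add: Q.M.M.abelian_group_axioms P.M.M.abelian_group_axioms\<close>)
  define x where "x = (monomial R (axis k 1) \<one>\<^bsub>R\<^esub> :: int ^ 'n \<Rightarrow> 'a)"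
  have x_cl: "x \<in> carrier (laurent_ring R)" by (simp add: x_def)
  have x_eq: "P.X = x" "Q.X = x" "N.X = x"
    by (simp_all add: P.X_def Q.X_def N.X_def x_def)
  obtain u where u: "Q.rep u z" using z(1) by (auto simp: Q.repd_def)
  then have u_bb: "Q.bounded_below u" using Q.rep_props by blast
  obtain w where w: "Q.bounded_below w" "\<And>l. u l = x \<odot>\<^bsub>Q\<^esub> w l \<ominus>\<^bsub>Q\<^esub> w (l - 1)"
    using Q.shift_solve[OF u_bb] by (auto simp: x_eq)
  note w_cl = Q.bounded_below_closed[OF w(1)]
  obtain b where wb: "\<And>l. l < b \<Longrightarrow> w l = \<zero>\<^bsub>Q\<^esub>" using w(1) by (auto simp: Q.bounded_below_def)
  \<comment> \<open>Since z is a cycle, the image of u represents zero. As d1 commutes with X, this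
    image is X - Y applied to the image of w, which is therefore represented.\<close>
  have "N.rep (\<lambda>l. d1 (u l)) \<zero>\<^bsub>N.T\<^esub>"
    using rep_extend_map[OF Qm Nm d1 u] z(2) by simp
  moreover have "N.bounded_below (\<lambda>l. d1 (w l))"
    by (rule N.bounded_belowI[of _ b])
      (use w_cl wb in \<open>simp_all add: additive_map_closed[OF d1_add] additive_map_zero[OF d1_add]\<close>)
  moreover have "d1 (u l) = N.X \<odot>\<^bsub>N\<^esub> d1 (w l) \<ominus>\<^bsub>N\<^esub> d1 (w (l - 1))" for l
    using w_cl x_cl by (simp add: w(2) x_eq additive_map_diff[OF d1_add] rmod_homD(3)[OF d1] Q.M.smult_closed)
  ultimately obtain y where y: "N.rep (\<lambda>l. d1 (w l)) y"
    using N.rep_shift_inverse by blast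
  obtain y' where y': "Q.rep (\<lambda>l. s2 (d1 (w l))) y'"
    using rep_map[OF Nm Qm s2 y] by blast
  obtain y'' where y'': "Q.rep (\<lambda>l. t1 (w l)) y''"
    using t1[OF w(1)] by blast
  have a: "Q.rep (\<lambda>l. w l \<oplus>\<^bsub>Q\<^esub> d0 (s1 (w l))) (y'' \<ominus>\<^bsub>Q.T\<^esub> y')"
    using Q.rep_diff[OF y'' y'] w_cl by (simp add: t1_eq)
  \<comment> \<open>As s1 is only R-linear, it does not pass through the factor X, and m need not be
    the coefficientwise image of u under s1.\<close>
  define m where "m l = x \<odot>\<^bsub>P\<^esub> s1 (w l) \<ominus>\<^bsub>P\<^esub> s1 (w (l - 1))" for l
  have s1w: "s1 (w l) \<in> carrier P" for l using additive_map_closed[OF s1_add] w_cl by simp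
  have xs1w: "x \<odot>\<^bsub>P\<^esub> s1 (w l) \<in> carrier P" for l using s1w x_cl by (simp add: P.M.smult_closed)
  have m_bb: "P.bounded_below m"
    by (rule P.bounded_belowI[of _ b])
      (use s1w xs1w wb x_cl in \<open>simp_all add: m_def additive_map_zero[OF s1_add]
        additive_map_zero[OF P.M.smult_additive] a_minus_def P.M.M.a_inv_zero\<close>)
  note m_cl = P.bounded_below_closed[OF m_bb]
  have d0s: "d0 (s1 (w l)) \<in> carrier Q" for l using additive_map_closed[OF d0_add] s1w by simp
  have shifted: "x \<odot>\<^bsub>Q\<^esub> (w l \<oplus>\<^bsub>Q\<^esub> d0 (s1 (w l))) \<ominus>\<^bsub>Q\<^esub> (w (l - 1) \<oplus>\<^bsub>Q\<^esub> d0 (s1 (w (l - 1))))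
      = u l \<oplus>\<^bsub>Q\<^esub> d0 (m l)" for l
  proof -
    have "d0 (m l) = x \<odot>\<^bsub>Q\<^esub> d0 (s1 (w l)) \<ominus>\<^bsub>Q\<^esub> d0 (s1 (w (l - 1)))"
      using s1w xs1w x_cl by (simp add: m_def additive_map_diff[OF d0_add] rmod_homD(3)[OF d0])
    then show ?thesis
      using w_cl d0s x_cl
      by (simp add: w(2) Q.M.smult_r_distr Q.M.smult_closed a_minus_def Q.M.M.minus_add Q.M.M.a_ac)
  qed
  have d0m: "d0 (m l) \<in> carrier Q" for l using additive_map_closed[OF d0_add] m_cl by simp
  \<comment> \<open>This series is X - Y applied to a represented one, so it maps to zero.
    Subtracting u then shows that d0 of m represents -z.\<close>
  have "Q.rep (\<lambda>l. u l \<oplus>\<^bsub>Q\<^esub> d0 (m l)) \<zero>\<^bsub>Q.T\<^esub>"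
    using Q.rep_shift[OF a] by (simp add: x_eq shifted)
  from Q.rep_diff[OF this u]
  have "Q.rep (\<lambda>l. (u l \<oplus>\<^bsub>Q\<^esub> d0 (m l)) \<ominus>\<^bsub>Q\<^esub> u l) (\<ominus>\<^bsub>Q.T\<^esub> z)"
    using Q.rep_tensor[OF u] by (simp add: a_minus_def)
  moreover have "(u l \<oplus>\<^bsub>Q\<^esub> d0 (m l)) \<ominus>\<^bsub>Q\<^esub> u l = d0 (m l)" for l
  proof -
    have "(u l \<oplus>\<^bsub>Q\<^esub> d0 (m l)) \<ominus>\<^bsub>Q\<^esub> u l = d0 (m l) \<oplus>\<^bsub>Q\<^esub> (u l \<ominus>\<^bsub>Q\<^esub> u l)"
      using Q.rep_closed[OF u] d0m by (simp add: a_minus_def Q.M.M.a_ac)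
    then show ?thesis
      using Q.rep_closed[OF u] d0m by (simp add: a_minus_def Q.M.M.r_neg)
  qed
  ultimately have dm: "Q.rep (\<lambda>l. d0 (m l)) (\<ominus>\<^bsub>Q.T\<^esub> z)" by simp
  obtain v where v: "P.rep (\<lambda>l. s1 (d0 (m l))) v"
    using rep_map[OF Qm P s1 dm] by blast
  obtain v' where v': "P.rep (\<lambda>l. t0 (m l)) v'"
    using t0[OF m_bb] by blast
  note e = P.rep_diff[OF v' v]
  \<comment> \<open>The represented replacement has the same image under d0 as m. Uniqueness
    identifies the boundary obtained from it with -z, which explains the final change of
    sign.\<close>
  have "Q.rep (\<lambda>l. d0 (m l)) (extend_map (laurent_ring R) (novikov_ring R) (\<lambda>f. f) Q d0 (v' \<ominus>\<^bsub>P.T\<^esub> v))"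
    using rep_extend_map[OF P Qm d0 e] m_cl by (simp add: t0_eq)
  from Q.rep_unique[OF this dm]
  have "extend_map (laurent_ring R) (novikov_ring R) (\<lambda>f. f) Q d0 (\<ominus>\<^bsub>P.T\<^esub> (v' \<ominus>\<^bsub>P.T\<^esub> v)) = z"
    using P.rep_tensor[OF e] Q.rep_tensor[OF u] by (simp add: additive_map_neg[OF d0.extend_map_additive])
  moreover have "\<ominus>\<^bsub>P.T\<^esub> (v' \<ominus>\<^bsub>P.T\<^esub> v) \<in> P.repd"
    using P.rep_neg[OF e] by (auto simp: P.repd_def)
  ultimately show ?thesis by blast
qed

lemma (in ring) series_in_one:
  fixes i :: "'n::finite"
  shows "series_in R i (\<lambda>l. if l = 0 then \<one> else \<zero>) = \<one>\<^bsub>novikov_ring R\<^esub>"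
proof
  fix a :: "int ^ 'n"
  have "a = axis i (a $ i) \<and> a $ i = 0 \<longleftrightarrow> a = 0"
    by (auto simp: vec_eq_iff axis_def)
  then show "series_in R i (\<lambda>l. if l = 0 then \<one> else \<zero>) a = \<one>\<^bsub>novikov_ring R\<^esub> a"
    by (auto simp: series_in_def Nov_simps monomial_def)
qed

section \<open>From exactness of the subcomplex to a contraction\<close>

locale laurent_complex =
  fixes R :: "('a, 'r) ring_scheme" and D :: "(int ^ 'n::finite \<Rightarrow> 'a, 'm) mod_complex" and i :: 'n
  assumes ring: "ring R"
    and complex: "cochain_complex (laurent_ring R) D"
begin

abbreviation L :: "(int ^ 'n \<Rightarrow> 'a) ring" where "L \<equiv> laurent_ring R"
abbreviation S :: "(int ^ 'n \<Rightarrow> 'a) ring" where "S \<equiv> novikov_ring R"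
abbreviation tp where "tp j \<equiv> extend_scalars L S (\<lambda>f. f) (obj D j)"
abbreviation "ts j \<equiv> tensor.tens L S (\<lambda>f. f) (obj D j)"
abbreviation "rp j \<equiv> laurent_module.repd R (obj D j) i"
abbreviation bd where "bd j \<equiv> extend_map L S (\<lambda>f. f) (obj D (j + 1)) (differential D j)"

definition unit_map where "unit_map j x = ts j x \<one>\<^bsub>S\<^esub>"

lemma obj_module: "right_module L (obj D j)"
  and diff_hom: "differential D j \<in> rmod_hom L (obj D j) (obj D (j + 1))"
  and diff_diff: "x \<in> carrier (obj D j) \<Longrightarrow>
    differential D (j + 1) (differential D j x) = \<zero>\<^bsub>obj D (j + 1 + 1)\<^esub>"
  using complex by (auto simp: cochain_complex_def)

lemma obj_laurent: "laurent_module R (obj D j)"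
  by (rule laurent_module_intro[OF ring obj_module])

lemma diff_tensor_map: "tensor_map L S (\<lambda>f. f) (obj D j) (obj D (j + 1)) (differential D j)"
  using obj_laurent[of j] obj_laurent[of "j + 1"] diff_hom[of j]
  by (simp add: tensor_map_def tensor_map_axioms_def laurent_module_def)

lemma tp_module: "right_module S (tp j)"
proof -
  interpret M: laurent_module R "obj D j" i by (rule obj_laurent)
  show ?thesis by (rule M.T_right_module)
qed

lemma bd_hom: "bd j \<in> rmod_hom S (tp j) (tp (j + 1))"
  by (rule tensor_map.extend_map_hom[OF diff_tensor_map])

lemma bd_tens:
  "\<lbrakk>x \<in> carrier (obj D j); s \<in> carrier S\<rbrakk> \<Longrightarrow> bd j (ts j x s) = ts (j + 1) (differential D j x) s"
  by (rule tensor_map.extend_map_tens[OF diff_tensor_map])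

lemma bd_additive: "additive_map (tp j) (tp (j + 1)) (bd j)"
  by (rule tensor_map.extend_map_additive[OF diff_tensor_map])

lemma S_ring: "ring S"
  by (rule ring.Nov_ring[OF ring])

lemma L_subset_S: "f \<in> carrier L \<Longrightarrow> f \<in> carrier S"
  by (rule ring.Lau_subset_Nov[OF ring])

lemma bd_Lau_hom: "bd j \<in> rmod_hom L (tp j) (tp (j + 1))"
  using bd_hom[of j] L_subset_S by (auto simp: rmod_hom_def)

lemma bd_bd: "U \<in> carrier (tp j) \<Longrightarrow> bd (j + 1) (bd j U) = \<zero>\<^bsub>tp (j + 1 + 1)\<^esub>"
proof -
  interpret M: laurent_module R "obj D j" i by (rule obj_laurent)
  interpret M2: laurent_module R "obj D (j + 1 + 1)" i by (rule obj_laurent)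
  note add = bd_additive[of j] bd_additive[of "j + 1"]
  assume "U \<in> carrier (tp j)"
  then show ?thesis
  proof (induction rule: M.T_induct)
    case (tens x s)
    then have "bd (j + 1) (bd j (ts j x s)) = ts (j + 1 + 1) \<zero>\<^bsub>obj D (j + 1 + 1)\<^esub> s"
      using rmod_homD(1)[OF diff_hom, of x j] by (simp only: bd_tens diff_diff)
    also have "\<dots> = \<zero>\<^bsub>tp (j + 1 + 1)\<^esub>"
      by (rule additive_map_zero[OF M2.tens_left_additive[OF tens(2)]])
    finally show ?case .
  next
    case (add U V)
    then show ?case
      using additive_map_closed[OF bd_additive[of j]]
      by (simp only: additive_map_add[OF bd_additive] M2.T.l_zero M2.T.zero_closed)
  qed
qed

lemma unit_map_hom: "unit_map j \<in> rmod_hom L (obj D j) (tp j)"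
proof -
  interpret M: laurent_module R "obj D j" i by (rule obj_laurent)
  show ?thesis
  proof (rule rmod_homI)
    show "unit_map j (f \<odot>\<^bsub>obj D j\<^esub> x) = f \<odot>\<^bsub>tp j\<^esub> unit_map j x"
      if "f \<in> carrier L" "x \<in> carrier (obj D j)" for f x
      using that by (simp add: unit_map_def M.tens_balanced M.T_smult_tens)
  qed (simp_all add: unit_map_def M.tens_closed M.tens_add_left)
qed

lemma unit_map_rp: "x \<in> carrier (obj D j) \<Longrightarrow> unit_map j x \<in> rp j"
proof -
  interpret M: laurent_module R "obj D j" i by (rule obj_laurent)
  assume x: "x \<in> carrier (obj D j)"
  have "(\<lambda>l. if l = 0 then \<one>\<^bsub>R\<^esub> else \<zero>\<^bsub>R\<^esub>) \<in> laurent_series R"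
    by (auto simp: M.R.laurent_series_iff intro!: exI[of _ 0])
  from M.repd_tens[OF x this] show ?thesis
    by (simp add: unit_map_def M.R.series_in_one)
qed

lemma bd_unit_map:
  "x \<in> carrier (obj D j) \<Longrightarrow> bd j (unit_map j x) = unit_map (j + 1) (differential D j x)"
  using ring.ring_simprules(6)[OF S_ring] by (simp add: unit_map_def bd_tens)

text \<open>The last condition is the homotopy equation on boundaries, where the term from the next
  higher degree drops out. It involves a single map and is exactly what the construction one degree
  lower requires.\<close>

definition partial_contraction where
  "partial_contraction j \<sigma> \<longleftrightarrow> \<sigma> \<in> rmod_hom L (obj D j) (tp (j - 1)) \<and>
     (\<forall>x\<in>carrier (obj D j). \<sigma> x \<in> rp (j - 1)) \<and>
     (\<forall>y\<in>carrier (obj D (j - 1)). bd (j - 1) (\<sigma> (differential D (j - 1) y)) =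
        unit_map j (differential D (j - 1) y))"

text \<open>The difference of x \<otimes> 1 and \<sigma> (d x) is a cycle by the condition on
  \<sigma>, hence a boundary inside the subcomplex. Projectivity turns the choice of bounding
  elements into a linear map.\<close>

lemma partial_contraction_step:
  assumes proj: "projective_rmodule L (obj D j)"
    and exact: "\<And>z. \<lbrakk>z \<in> rp j; bd j z = \<zero>\<^bsub>tp (j + 1)\<^esub>\<rbrakk> \<Longrightarrow> \<exists>w\<in>rp (j - 1). bd (j - 1) w = z"
    and \<sigma>: "partial_contraction (j + 1) \<sigma>"
  shows "\<exists>\<sigma>'. partial_contraction j \<sigma>' \<and>
    (\<forall>x\<in>carrier (obj D j). bd (j - 1) (\<sigma>' x) = unit_map j x \<ominus>\<^bsub>tp j\<^esub> \<sigma> (differential D j x))"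
proof -
  interpret M: laurent_module R "obj D j" i by (rule obj_laurent)
  interpret M': laurent_module R "obj D (j - 1)" i by (rule obj_laurent)
  interpret TL: right_module L "tp j" by (rule M.T_Lau_module)
  obtain Y \<iota> p where "projective_data L (obj D j) Y \<iota> p"
    using proj by (auto simp: projective_rmodule_def projective_data_def projective_data_axioms_def)
  then interpret pd: projective_data L "obj D j" Y \<iota> p .
  let ?d = "differential D j"
  note d_cl = rmod_homD(1)[OF diff_hom[of j]]
  have \<sigma>_hom: "\<sigma> \<in> rmod_hom L (obj D (j + 1)) (tp j)"
    and \<sigma>_rp: "\<And>x. x \<in> carrier (obj D (j + 1)) \<Longrightarrow> \<sigma> x \<in> rp j"
    and \<sigma>_bd: "\<And>y. y \<in> carrier (obj D j) \<Longrightarrow> bd j (\<sigma> (?d y)) = unit_map (j + 1) (?d y)"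
    using \<sigma> by (auto simp: partial_contraction_def)
  let ?f = "\<lambda>x. unit_map j x \<ominus>\<^bsub>tp j\<^esub> \<sigma> (?d x)"
  have \<sigma>d: "\<sigma> (?d x) \<in> carrier (tp j)" if "x \<in> carrier (obj D j)" for x
    using rmod_homD(1)[OF \<sigma>_hom d_cl[OF that]] .
  note un = rmod_homD[OF unit_map_hom[of j]]
  have f: "?f \<in> rmod_hom L (obj D j) (tp j)"
  proof (rule rmod_homI)
    fix x y assume xy: "x \<in> carrier (obj D j)" "y \<in> carrier (obj D j)"
    show "?f x \<in> carrier (tp j)" using xy un \<sigma>d by simp
    show "?f (x \<oplus>\<^bsub>obj D j\<^esub> y) = ?f x \<oplus>\<^bsub>tp j\<^esub> ?f y"
      using xy un(1) \<sigma>d d_cl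
      by (simp add: un rmod_homD(2)[OF diff_hom[of j]] rmod_homD(2)[OF \<sigma>_hom] a_minus_def
          M.T.minus_add M.T.a_ac)
  next
    fix a x assume a: "a \<in> carrier L" "x \<in> carrier (obj D j)"
    show "?f (a \<odot>\<^bsub>obj D j\<^esub> x) = a \<odot>\<^bsub>tp j\<^esub> ?f x"
      using a un(1) \<sigma>d d_cl
      by (simp add: un rmod_homD(3)[OF diff_hom[of j]] rmod_homD(3)[OF \<sigma>_hom]
          additive_map_diff[OF TL.smult_additive])
  qed
  have ex: "\<exists>w\<in>rp (j - 1). bd (j - 1) w = ?f x" if x: "x \<in> carrier (obj D j)" for x
  proof (rule exact)
    show "?f x \<in> rp j"
      using unit_map_rp[OF x] \<sigma>_rp[OF d_cl[OF x]] by (rule M.repd_diff)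
    interpret M1: laurent_module R "obj D (j + 1)" i by (rule obj_laurent)
    have "bd j (?f x) = unit_map (j + 1) (?d x) \<ominus>\<^bsub>tp (j + 1)\<^esub> unit_map (j + 1) (?d x)"
      using additive_map_diff[OF bd_additive un(1)[OF x] \<sigma>d[OF x]] x
      by (simp only: bd_unit_map \<sigma>_bd)
    then show "bd j (?f x) = \<zero>\<^bsub>tp (j + 1)\<^esub>"
      using rmod_homD(1)[OF unit_map_hom d_cl[OF x]] by (simp only: a_minus_def M1.T.r_neg)
  qed
  have "\<exists>\<sigma>'\<in>rmod_hom L (obj D j) (tp (j - 1)). \<forall>x\<in>carrier (obj D j). \<sigma>' x \<in> rp (j - 1) \<and> bd (j - 1) (\<sigma>' x) = ?f x"
  proof (rule pd.lift[OF M'.T_Lau_module M.T_Lau_module _ f])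
    show "bd (j - 1) \<in> rmod_hom L (tp (j - 1)) (tp j)"
      using bd_Lau_hom[of "j - 1"] by simp
  qed (use M'.repd_subset M'.repd_zero M'.repd_add M'.repd_smult ex in auto)
  then obtain \<sigma>' where \<sigma>': "\<sigma>' \<in> rmod_hom L (obj D j) (tp (j - 1))"
    "\<And>x. x \<in> carrier (obj D j) \<Longrightarrow> \<sigma>' x \<in> rp (j - 1)" "\<And>x. x \<in> carrier (obj D j) \<Longrightarrow> bd (j - 1) (\<sigma>' x) = ?f x"
    by blast
  have "bd (j - 1) (\<sigma>' (differential D (j - 1) y)) = unit_map j (differential D (j - 1) y)"
    if y: "y \<in> carrier (obj D (j - 1))" for y
  proof -
    have dy: "differential D (j - 1) y \<in> carrier (obj D j)"
      using rmod_homD(1)[OF diff_hom[of "j - 1"] y] by simp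
    have "?d (differential D (j - 1) y) = \<zero>\<^bsub>obj D (j + 1)\<^esub>"
      using diff_diff[OF y] by simp
    moreover have "\<sigma> \<zero>\<^bsub>obj D (j + 1)\<^esub> = \<zero>\<^bsub>tp j\<^esub>"
      by (rule additive_map_zero[OF rmod_hom_additive[OF \<sigma>_hom obj_module M.T_Lau_module]])
    ultimately show ?thesis
      using \<sigma>'(3)[OF dy] un(1)[OF dy] by (simp add: a_minus_def M.T.a_inv_zero)
  qed
  then show ?thesis
    using \<sigma>' by (intro exI[of _ \<sigma>']) (simp add: partial_contraction_def)
qed

lemma zero_partial_contraction:
  assumes "carrier (obj D j) = {\<zero>\<^bsub>obj D j\<^esub>}"
  shows "partial_contraction j (\<lambda>x. \<zero>\<^bsub>tp (j - 1)\<^esub>)"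
proof -
  interpret M: laurent_module R "obj D j" i by (rule obj_laurent)
  interpret M': laurent_module R "obj D (j - 1)" i by (rule obj_laurent)
  interpret TL: right_module L "tp (j - 1)" by (rule M'.T_Lau_module)
  have "(\<lambda>x. \<zero>\<^bsub>tp (j - 1)\<^esub>) \<in> rmod_hom L (obj D j) (tp (j - 1))"
    by (rule rmod_homI) (simp_all add: additive_map_zero[OF TL.smult_additive])
  moreover have "bd (j - 1) \<zero>\<^bsub>tp (j - 1)\<^esub> = unit_map j (differential D (j - 1) y)"
    if y: "y \<in> carrier (obj D (j - 1))" for y
  proof -
    have "differential D (j - 1) y = \<zero>\<^bsub>obj D j\<^esub>"
      using rmod_homD(1)[OF diff_hom[of "j - 1"] y] assms by simp
    then show ?thesis
      using additive_map_zero[OF bd_additive[of "j - 1"]]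
        additive_map_zero[OF rmod_hom_additive[OF unit_map_hom obj_module M.T_Lau_module]]
      by simp
  qed
  ultimately show ?thesis
    by (simp add: partial_contraction_def M'.repd_zero)
qed

text \<open>The null homotopy starts with zero in a degree where D vanishes and is constructed
  downwards, each map being lifted with respect to the preceding one.\<close>

lemma linear_contraction:
  assumes bounded: "bounded_complex D"
    and proj: "\<And>j. projective_rmodule L (obj D j)"
    and exact: "\<And>j z. \<lbrakk>z \<in> rp j; bd j z = \<zero>\<^bsub>tp (j + 1)\<^esub>\<rbrakk> \<Longrightarrow> \<exists>w\<in>rp (j - 1). bd (j - 1) w = z"
  shows "\<exists>\<sigma>. (\<forall>j. \<sigma> j \<in> rmod_hom L (obj D j) (tp (j - 1))) \<and>
    (\<forall>j. \<forall>x\<in>carrier (obj D j).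
       bd (j - 1) (\<sigma> j x) \<oplus>\<^bsub>tp j\<^esub> \<sigma> (j + 1) (differential D j x) = unit_map j x)"
proof -
  obtain b where b: "\<And>j. b < j \<Longrightarrow> carrier (obj D j) = {\<zero>\<^bsub>obj D j\<^esub>}"
    using bounded by (auto simp: bounded_complex_def)
  define B where "B = b + 1"
  have B: "carrier (obj D j) = {\<zero>\<^bsub>obj D j\<^esub>}" if "B \<le> j" for j using b that by (simp add: B_def)
  \<comment> \<open>Degrees are counted down from B so that dependent choice over the natural
    numbers applies. The second clause records the homotopy equation between consecutive
    choices.\<close>
  have "\<exists>f. \<forall>n. partial_contraction (B - int n) (f n) \<and>
    (\<forall>x\<in>carrier (obj D (B - int (Suc n))). bd (B - int (Suc n) - 1) (f (Suc n) x) =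
       unit_map (B - int (Suc n)) x \<ominus>\<^bsub>tp (B - int (Suc n))\<^esub> f n (differential D (B - int (Suc n)) x))"
  proof (rule dependent_nat_choice)
    show "\<exists>\<sigma>. partial_contraction (B - int 0) \<sigma>"
      using zero_partial_contraction[OF B, of B] by auto
    show "\<exists>\<sigma>'. partial_contraction (B - int (Suc n)) \<sigma>' \<and>
      (\<forall>x\<in>carrier (obj D (B - int (Suc n))). bd (B - int (Suc n) - 1) (\<sigma>' x) =
       unit_map (B - int (Suc n)) x \<ominus>\<^bsub>tp (B - int (Suc n))\<^esub> \<sigma> (differential D (B - int (Suc n)) x))"
      if "partial_contraction (B - int n) \<sigma>" for \<sigma> n
    proof (rule partial_contraction_step[OF proj exact])
      have "B - int (Suc n) + 1 = B - int n" by simp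
      then show "partial_contraction (B - int (Suc n) + 1) \<sigma>" using that by metis
    qed
  qed
  then obtain f where f: "\<And>n. partial_contraction (B - int n) (f n)"
    "\<And>n x. x \<in> carrier (obj D (B - int (Suc n))) \<Longrightarrow> bd (B - int (Suc n) - 1) (f (Suc n) x) =
       unit_map (B - int (Suc n)) x \<ominus>\<^bsub>tp (B - int (Suc n))\<^esub> f n (differential D (B - int (Suc n)) x)"
    by blast
  define \<sigma> where "\<sigma> j = (if j \<le> B then f (nat (B - j)) else (\<lambda>x. \<zero>\<^bsub>tp (j - 1)\<^esub>))" for j
  have \<sigma>_pc: "partial_contraction j (\<sigma> j)" for j
    using f(1)[of "nat (B - j)"] zero_partial_contraction[OF B, of j] by (auto simp: \<sigma>_def)
  then have \<sigma>_hom: "\<sigma> j \<in> rmod_hom L (obj D j) (tp (j - 1))" for j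
    by (simp add: partial_contraction_def)
  have "bd (j - 1) (\<sigma> j x) \<oplus>\<^bsub>tp j\<^esub> \<sigma> (j + 1) (differential D j x) = unit_map j x"
    if x: "x \<in> carrier (obj D j)" for j x
  proof -
    interpret M: laurent_module R "obj D j" i by (rule obj_laurent)
    interpret M': laurent_module R "obj D (j - 1)" i by (rule obj_laurent)
    have s: "\<sigma> (j + 1) (differential D j x) \<in> carrier (tp j)"
      using rmod_homD(1)[OF \<sigma>_hom[of "j + 1"] rmod_homD(1)[OF diff_hom x]] by simp
    have un: "unit_map j x \<in> carrier (tp j)" by (rule rmod_homD(1)[OF unit_map_hom x])
    have "bd (j - 1) (\<sigma> j x) = unit_map j x \<ominus>\<^bsub>tp j\<^esub> \<sigma> (j + 1) (differential D j x)"
    proof (cases "j < B")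
      case True
      define n where "n = nat (B - (j + 1))"
      have j: "B - int (Suc n) = j" "\<sigma> j = f (Suc n)" "\<sigma> (j + 1) = f n"
        using True by (auto simp: n_def \<sigma>_def nat_diff_distrib' Suc_nat_eq_nat_zadd1 algebra_simps)
      show ?thesis using f(2)[of x n] x unfolding j by simp
    next
      case False
      then have x0: "x = \<zero>\<^bsub>obj D j\<^esub>" using B[of j] x by auto
      have 1: "\<sigma> j \<zero>\<^bsub>obj D j\<^esub> = \<zero>\<^bsub>tp (j - 1)\<^esub>"
        by (rule additive_map_zero[OF rmod_hom_additive[OF \<sigma>_hom obj_module M'.T_Lau_module]])
      have 2: "unit_map j \<zero>\<^bsub>obj D j\<^esub> = \<zero>\<^bsub>tp j\<^esub>"
        by (rule additive_map_zero[OF rmod_hom_additive[OF unit_map_hom obj_module M.T_Lau_module]])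
      have 3: "bd (j - 1) \<zero>\<^bsub>tp (j - 1)\<^esub> = \<zero>\<^bsub>tp j\<^esub>"
        using additive_map_zero[OF bd_additive[of "j - 1"]] by simp
      show ?thesis using False by (simp add: \<sigma>_def[of "j + 1"] x0 1 2 3[simplified] a_minus_def M.T.a_inv_zero)
    qed
    then show ?thesis
      using s un by (simp add: a_minus_def M.T.a_assoc M.T.l_neg)
  qed
  then show ?thesis using \<sigma>_hom by blast
qed

text \<open>The extension sends x \<otimes> s to \<sigma>(x) s; linearity of \<sigma> over L is what
  makes this balanced.\<close>

lemma contraction_extends:
  assumes \<sigma>: "\<sigma> \<in> rmod_hom L (obj D j) (tp j')"
  shows "\<exists>h\<in>rmod_hom S (tp j) (tp j').
    \<forall>x\<in>carrier (obj D j). \<forall>s\<in>carrier S. h (ts j x s) = s \<odot>\<^bsub>tp j'\<^esub> \<sigma> x"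
proof -
  interpret M: laurent_module R "obj D j" i by (rule obj_laurent)
  interpret M': laurent_module R "obj D j'" i by (rule obj_laurent)
  note \<sigma>' = rmod_homD[OF \<sigma>]
  obtain h where h: "additive_map (tp j) (tp j') h"
    "\<And>x s. \<lbrakk>x \<in> carrier (obj D j); s \<in> carrier S\<rbrakk> \<Longrightarrow> h (ts j x s) = s \<odot>\<^bsub>tp j'\<^esub> \<sigma> x"
  proof (rule M.tens_lift[OF M'.T_abelian_group, of "\<lambda>x s. s \<odot>\<^bsub>tp j'\<^esub> \<sigma> x"])
    show "s \<odot>\<^bsub>tp j'\<^esub> \<sigma> (a \<odot>\<^bsub>obj D j\<^esub> x) = (a \<otimes>\<^bsub>S\<^esub> s) \<odot>\<^bsub>tp j'\<^esub> \<sigma> x"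
      if "a \<in> carrier L" "x \<in> carrier (obj D j)" "s \<in> carrier S" for a x s
      using that by (simp add: \<sigma>' M'.T.smult_assoc L_subset_S)
  qed (use \<sigma>' in \<open>simp_all add: M'.T.smult_closed M'.T.smult_r_distr M'.T.smult_l_distr\<close>)
  have "h (t \<odot>\<^bsub>tp j\<^esub> U) = t \<odot>\<^bsub>tp j'\<^esub> h U" if t: "t \<in> carrier S" and U: "U \<in> carrier (tp j)" for t U
    using U
  proof (induction rule: M.T_induct)
    case (tens x s)
    then show ?case
      using t \<sigma>'(1) by (simp add: M.T_smult_tens h(2) M'.T.smult_assoc)
  next
    case (add U V)
    then show ?case
      using t additive_map_closed[OF h(1)]
      by (simp add: M.T.smult_r_distr M'.T.smult_r_distr additive_map_add[OF h(1)] M.T.smult_closed)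
  qed
  then have "h \<in> rmod_hom S (tp j) (tp j')"
    by (intro rmod_homI additive_map_closed[OF h(1)] additive_map_add[OF h(1)])
  then show ?thesis using h(2) by blast
qed

text \<open>An elementary tensor x \<otimes> s is (x \<otimes> 1) s, so on it the homotopy equation
  is the given one multiplied by s; additivity does the rest.\<close>

lemma novikov_contraction:
  assumes \<sigma>: "\<And>j. \<sigma> j \<in> rmod_hom L (obj D j) (tp (j - 1))"
    and eq: "\<And>j x. x \<in> carrier (obj D j) \<Longrightarrow>
       bd (j - 1) (\<sigma> j x) \<oplus>\<^bsub>tp j\<^esub> \<sigma> (j + 1) (differential D j x) = unit_map j x"
  shows "\<exists>h. (\<forall>j. h j \<in> rmod_hom S (tp j) (tp (j - 1))) \<and>
    (\<forall>j. \<forall>U\<in>carrier (tp j). bd (j - 1) (h j U) \<oplus>\<^bsub>tp j\<^esub> h (j + 1) (bd j U) = U)"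
proof -
  have "\<forall>j. \<exists>h. h \<in> rmod_hom S (tp j) (tp (j - 1)) \<and>
    (\<forall>x\<in>carrier (obj D j). \<forall>s\<in>carrier S. h (ts j x s) = s \<odot>\<^bsub>tp (j - 1)\<^esub> \<sigma> j x)"
    using contraction_extends[OF \<sigma>] by blast
  then obtain h where h: "\<And>j. h j \<in> rmod_hom S (tp j) (tp (j - 1))"
    "\<And>j x s. \<lbrakk>x \<in> carrier (obj D j); s \<in> carrier S\<rbrakk> \<Longrightarrow> h j (ts j x s) = s \<odot>\<^bsub>tp (j - 1)\<^esub> \<sigma> j x"
    by metis
  have "bd (j - 1) (h j U) \<oplus>\<^bsub>tp j\<^esub> h (j + 1) (bd j U) = U" if "U \<in> carrier (tp j)" for j U
  proof -
    interpret M: laurent_module R "obj D j" i by (rule obj_laurent)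
    have bd': "bd (j - 1) \<in> rmod_hom S (tp (j - 1)) (tp j)" using bd_hom[of "j - 1"] by simp
    have h': "h (j + 1) \<in> rmod_hom S (tp (j + 1)) (tp j)" using h(1)[of "j + 1"] by simp
    note cl = rmod_homD(1)[OF bd' rmod_homD(1)[OF h(1)]] rmod_homD(1)[OF h' rmod_homD(1)[OF bd_hom]]
    show ?thesis
      using that
    proof (induction rule: M.T_induct)
      case (tens x s)
      note dx = rmod_homD(1)[OF diff_hom tens(1)]
      have \<sigma>x: "\<sigma> j x \<in> carrier (tp (j - 1))" by (rule rmod_homD(1)[OF \<sigma> tens(1)])
      have \<sigma>dx: "\<sigma> (j + 1) (differential D j x) \<in> carrier (tp j)"
        using rmod_homD(1)[OF \<sigma> dx] by simp
      have "bd (j - 1) (h j (ts j x s)) = s \<odot>\<^bsub>tp j\<^esub> bd (j - 1) (\<sigma> j x)"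
        using tens \<sigma>x by (simp only: h(2) rmod_homD(3)[OF bd'])
      moreover have "h (j + 1) (bd j (ts j x s)) = s \<odot>\<^bsub>tp j\<^esub> \<sigma> (j + 1) (differential D j x)"
        using tens dx h(2)[OF dx tens(2)] by (simp add: bd_tens)
      moreover have "s \<odot>\<^bsub>tp j\<^esub> bd (j - 1) (\<sigma> j x) \<oplus>\<^bsub>tp j\<^esub> s \<odot>\<^bsub>tp j\<^esub> \<sigma> (j + 1) (differential D j x) =
          s \<odot>\<^bsub>tp j\<^esub> unit_map j x"
        using M.T.smult_r_distr[OF tens(2) rmod_homD(1)[OF bd' \<sigma>x] \<sigma>dx] eq[OF tens(1)] by simp
      moreover have "s \<odot>\<^bsub>tp j\<^esub> unit_map j x = ts j x s"
        using tens by (simp add: unit_map_def M.T_smult_tens)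
      ultimately show ?case by simp
    next
      case (add U V)
      have "bd (j - 1) (h j (U \<oplus>\<^bsub>tp j\<^esub> V)) = bd (j - 1) (h j U) \<oplus>\<^bsub>tp j\<^esub> bd (j - 1) (h j V)"
        using add by (simp only: rmod_homD(2)[OF h(1)] rmod_homD(2)[OF bd'] rmod_homD(1)[OF h(1)])
      moreover have "h (j + 1) (bd j (U \<oplus>\<^bsub>tp j\<^esub> V)) = h (j + 1) (bd j U) \<oplus>\<^bsub>tp j\<^esub> h (j + 1) (bd j V)"
        using add by (simp only: rmod_homD(2)[OF bd_hom] rmod_homD(2)[OF h'] rmod_homD(1)[OF bd_hom])
      moreover have "bd (j - 1) (h j U) \<oplus>\<^bsub>tp j\<^esub> bd (j - 1) (h j V) \<oplus>\<^bsub>tp j\<^esub>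
          (h (j + 1) (bd j U) \<oplus>\<^bsub>tp j\<^esub> h (j + 1) (bd j V)) =
          (bd (j - 1) (h j U) \<oplus>\<^bsub>tp j\<^esub> h (j + 1) (bd j U)) \<oplus>\<^bsub>tp j\<^esub>
          (bd (j - 1) (h j V) \<oplus>\<^bsub>tp j\<^esub> h (j + 1) (bd j V))"
        using cl[OF add(1)] cl[OF add(2)] by (simp add: M.T.a_ac)
      ultimately show ?case using add by simp
    qed
  qed
  then show ?thesis using h(1) by blast
qed

end

section \<open>Finite domination implies exactness of the subcomplex\<close>

lemma projective_laurent_moduleE:
  fixes M :: "(int ^ 'n::finite \<Rightarrow> 'a, 'm) module"
  assumes "ring R" "projective_rmodule (laurent_ring R) M"
  obtains Y \<iota> p where "projective_laurent_module R M Y \<iota> p"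
proof -
  obtain Y \<iota> p where "projective_data (laurent_ring R) M Y \<iota> p"
    using assms(2) by (auto simp: projective_rmodule_def projective_data_def projective_data_axioms_def)
  moreover have "laurent_module R M"
    using assms by (intro laurent_module_intro) (auto simp: projective_rmodule_def)
  ultimately show thesis
    using that by (auto simp: projective_laurent_module_def)
qed

context laurent_complex
begin

text \<open>The composites g f factor through finitely generated modules, so they turn every series
  bounded below into a represented one. They play the parts of t0 and t1 in
  \<open>repd_cycle_is_boundary\<close>, with s supplying s1 and s2.\<close>

lemma dominated_exact:
  fixes C :: "('a, 'c) mod_complex"
  assumes proj: "\<And>j. projective_rmodule L (obj D j)"
    and C: "cochain_complex R C" "\<And>j. fg_rmodule R (obj C j)"
    and f: "cochain_map R (restrict_complex (laurent_const R) D) C f"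
    and g: "cochain_map R C (restrict_complex (laurent_const R) D) g"
    and gf: "cochain_homotopic R (restrict_complex (laurent_const R) D)
      (restrict_complex (laurent_const R) D) (\<lambda>j. g j \<circ> f j) (\<lambda>j. id)"
    and z: "z \<in> rp j" "bd j z = \<zero>\<^bsub>tp (j + 1)\<^esub>"
  shows "\<exists>w\<in>rp (j - 1). bd (j - 1) w = z"
proof -
  let ?r = "restrict_scalars (laurent_const R)"
  obtain s where s: "\<And>j. s j \<in> rmod_hom R (?r (obj D j)) (?r (obj D (j - 1)))"
    and s_eq: "\<And>j x. x \<in> carrier (obj D j) \<Longrightarrow> g j (f j x) \<ominus>\<^bsub>obj D j\<^esub> x =
      differential D (j - 1) (s j x) \<oplus>\<^bsub>obj D j\<^esub> s (j + 1) (differential D j x)"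
    using gf by (auto simp: cochain_homotopic_def restrict_complex_def restrict_scalars_minus)
  have f_hom: "f j \<in> rmod_hom R (?r (obj D j)) (obj C j)"
    and g_hom: "g j \<in> rmod_hom R (obj C j) (?r (obj D j))" for j
    using f g by (auto simp: cochain_map_def restrict_complex_def)
  have f_cl: "x \<in> carrier (obj D j) \<Longrightarrow> f j x \<in> carrier (obj C j)" for j x
    using rmod_homD(1)[OF f_hom] by simp
  have gf_cl: "x \<in> carrier (obj D j) \<Longrightarrow> g j (f j x) \<in> carrier (obj D j)" for j x
    using rmod_homD(1)[OF g_hom f_cl] by simp
  have s_cl: "x \<in> carrier (obj D j) \<Longrightarrow> s j x \<in> carrier (obj D (j - 1))" for j x
    using rmod_homD(1)[OF s] by simp
  have t: "\<exists>z. laurent_module.rep R (obj D j) i (\<lambda>l. g j (f j (u l))) z"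
    if u: "laurent_module.bounded_below (obj D j) u" for j u
  proof -
    interpret M: laurent_module R "obj D j" i by (rule obj_laurent)
    interpret C: right_module R "obj C j" using C by (simp add: cochain_complex_def)
    have "additive_map (obj D j) (obj C j) (f j)"
      by (rule additive_mapI)
        (use rmod_homD[OF f_hom] in \<open>simp_all add: M.M.M.abelian_group_axioms C.M.abelian_group_axioms\<close>)
    note f0 = additive_map_zero[OF this]
    obtain b where b: "\<And>l. l < b \<Longrightarrow> u l = \<zero>\<^bsub>obj D j\<^esub>" using u by (auto simp: M.bounded_below_def)
    show ?thesis
      by (rule M.rep_of_bounded[OF C(2) g_hom, of _ b])
        (use b f0 f_cl M.bounded_below_closed[OF u] in auto)
  qed
  obtain Y \<iota> p where Q: "projective_laurent_module R (obj D j) Y \<iota> p"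
    by (rule projective_laurent_moduleE[OF ring proj])
  obtain Y' \<iota>' p' where N: "projective_laurent_module R (obj D (j + 1)) Y' \<iota>' p'"
    by (rule projective_laurent_moduleE[OF ring proj])
  interpret M: laurent_module R "obj D j" i by (rule obj_laurent)
  interpret M': laurent_module R "obj D (j - 1)" i by (rule obj_laurent)
  have d0: "differential D (j - 1) \<in> rmod_hom L (obj D (j - 1)) (obj D j)"
    using diff_hom[of "j - 1"] by simp
  note d0_add = rmod_hom_additive[OF d0 M'.M.right_module_axioms M.M.right_module_axioms]
  have s2: "s (j + 1) \<in> rmod_hom R (?r (obj D (j + 1))) (?r (obj D j))"
    using s[of "j + 1"] by simp
  have "\<exists>w\<in>rp (j - 1). extend_map L S (\<lambda>f. f) (obj D j) (differential D (j - 1)) w = z"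
  proof (rule repd_cycle_is_boundary[OF obj_laurent Q N d0 diff_hom s s2, where ?t0.0 = "\<lambda>x. g (j - 1) (f (j - 1) x)"
        and ?t1.0 = "\<lambda>x. g j (f j x)"])
    \<comment> \<open>The homotopy equation g f = 1 + d s + s d, with the last term moved to the
      other side.\<close>
    show "g j (f j x) \<ominus>\<^bsub>obj D j\<^esub> s (j + 1) (differential D j x) =
        x \<oplus>\<^bsub>obj D j\<^esub> differential D (j - 1) (s j x)" if x: "x \<in> carrier (obj D j)" for x
    proof -
      have c: "differential D (j - 1) (s j x) \<in> carrier (obj D j)"
        "s (j + 1) (differential D j x) \<in> carrier (obj D j)"
        using rmod_homD(1)[OF d0 s_cl[OF x]] rmod_homD(1)[OF s2, of "differential D j x"]
          rmod_homD(1)[OF diff_hom x] by simp_all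
      have "g j (f j x) = (g j (f j x) \<ominus>\<^bsub>obj D j\<^esub> x) \<oplus>\<^bsub>obj D j\<^esub> x"
        using x gf_cl[OF x] by (simp add: a_minus_def M.M.M.a_assoc M.M.M.l_neg)
      then have "g j (f j x) = x \<oplus>\<^bsub>obj D j\<^esub> differential D (j - 1) (s j x) \<oplus>\<^bsub>obj D j\<^esub>
          s (j + 1) (differential D j x)"
        using x c by (simp add: s_eq M.M.M.a_ac)
      then show ?thesis
        using x c by (simp add: a_minus_def M.M.M.a_assoc M.M.M.r_neg)
    qed
    \<comment> \<open>By the homotopy equation the argument is x plus the boundary y = d (s x),
      which d annihilates.\<close>
    show "differential D (j - 1) (g (j - 1) (f (j - 1) x) \<ominus>\<^bsub>obj D (j - 1)\<^esub> s j (differential D (j - 1) x)) =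
        differential D (j - 1) x" if x: "x \<in> carrier (obj D (j - 1))" for x
    proof -
      let ?d = "differential D (j - 1)"
      define y where "y = differential D (j - 1 - 1) (s (j - 1) x)"
      have sx: "s (j - 1) x \<in> carrier (obj D (j - 1 - 1))" by (rule s_cl[OF x])
      have y: "y \<in> carrier (obj D (j - 1))" and dy: "?d y = \<zero>\<^bsub>obj D j\<^esub>"
        using rmod_homD(1)[OF diff_hom sx] diff_diff[OF sx] by (simp_all add: y_def)
      have dx: "?d x \<in> carrier (obj D j)" by (rule rmod_homD(1)[OF d0 x])
      have sdx: "s j (?d x) \<in> carrier (obj D (j - 1))" by (rule s_cl[OF dx])
      have "g (j - 1) (f (j - 1) x) = (g (j - 1) (f (j - 1) x) \<ominus>\<^bsub>obj D (j - 1)\<^esub> x) \<oplus>\<^bsub>obj D (j - 1)\<^esub> x"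
        using x gf_cl[OF x] by (simp add: a_minus_def M'.M.M.a_assoc M'.M.M.l_neg)
      also have "\<dots> = y \<oplus>\<^bsub>obj D (j - 1)\<^esub> s j (?d x) \<oplus>\<^bsub>obj D (j - 1)\<^esub> x"
        using s_eq[OF x] by (simp add: y_def)
      finally have "g (j - 1) (f (j - 1) x) \<ominus>\<^bsub>obj D (j - 1)\<^esub> s j (?d x) =
          y \<oplus>\<^bsub>obj D (j - 1)\<^esub> x \<oplus>\<^bsub>obj D (j - 1)\<^esub> (s j (?d x) \<oplus>\<^bsub>obj D (j - 1)\<^esub> \<ominus>\<^bsub>obj D (j - 1)\<^esub> s j (?d x))"
        using x y sdx by (simp add: a_minus_def M'.M.M.a_ac)
      then have "g (j - 1) (f (j - 1) x) \<ominus>\<^bsub>obj D (j - 1)\<^esub> s j (?d x) = y \<oplus>\<^bsub>obj D (j - 1)\<^esub> x"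
        using x y sdx by (simp add: M'.M.M.r_neg)
      then show ?thesis
        using x y dx by (simp add: additive_map_add[OF d0_add] dy)
    qed
  qed (use t z in auto)
  then show ?thesis by simp
qed

end

theorem mainTheorem2:
  fixes R :: "('a, 'r) ring_scheme"
    and D :: "(int ^ 'n::finite \<Rightarrow> 'a, 'm) mod_complex"
  assumes "ring R"
    and "cochain_complex (laurent_ring R) D"
    and "bounded_complex D"
    and "\<forall>k. projective_rmodule (laurent_ring R) (obj D k)"
    and "finitely_dominated TYPE('c) R D"
  shows "acyclic_complex (novikov_complex R D) \<and>
         contractible_complex (novikov_ring R) (novikov_complex R D)"
proof -
  \<comment> \<open>Any variable may be distinguished; the index type is inhabited, so there is
    one.\<close>
  interpret laurent_complex R D "undefined :: 'n"
    using assms(1,2) by (rule laurent_complex.intro)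
  obtain C :: "('a, 'c) mod_complex" and f g where C: "cochain_complex R C" "\<And>j. fg_rmodule R (obj C j)"
    and fg: "cochain_map R (restrict_complex (laurent_const R) D) C f"
      "cochain_map R C (restrict_complex (laurent_const R) D) g"
      "cochain_homotopic R (restrict_complex (laurent_const R) D)
        (restrict_complex (laurent_const R) D) (\<lambda>j. g j \<circ> f j) (\<lambda>j. id)"
    using assms(5) by (auto simp: finitely_dominated_def homotopy_equivalent_def)
  have proj: "\<And>j. projective_rmodule L (obj D j)" using assms(4) by blast
  have "\<exists>\<sigma>. (\<forall>j. \<sigma> j \<in> rmod_hom L (obj D j) (tp (j - 1))) \<and>
    (\<forall>j. \<forall>x\<in>carrier (obj D j).
       bd (j - 1) (\<sigma> j x) \<oplus>\<^bsub>tp j\<^esub> \<sigma> (j + 1) (differential D j x) = unit_map j x)"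
    by (rule linear_contraction[OF assms(3) proj]) (rule dominated_exact[OF proj C fg])
  then obtain \<sigma> where \<sigma>: "\<forall>j. \<sigma> j \<in> rmod_hom L (obj D j) (tp (j - 1))"
    "\<forall>j. \<forall>x\<in>carrier (obj D j).
       bd (j - 1) (\<sigma> j x) \<oplus>\<^bsub>tp j\<^esub> \<sigma> (j + 1) (differential D j x) = unit_map j x"
    by (elim exE conjE) (rule that)
  have "\<exists>h. (\<forall>j. h j \<in> rmod_hom S (tp j) (tp (j - 1))) \<and>
    (\<forall>j. \<forall>U\<in>carrier (tp j). bd (j - 1) (h j U) \<oplus>\<^bsub>tp j\<^esub> h (j + 1) (bd j U) = U)"
    by (rule novikov_contraction[of \<sigma>]) (simp_all only: \<sigma>)
  then obtain h where h_all: "\<forall>j. h j \<in> rmod_hom S (tp j) (tp (j - 1))"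
    "\<forall>j. \<forall>U\<in>carrier (tp j). bd (j - 1) (h j U) \<oplus>\<^bsub>tp j\<^esub> h (j + 1) (bd j U) = U"
    by (elim exE conjE) (rule that)
  note h = h_all[rule_format]
  have E: "obj (novikov_complex R D) j = tp j" "differential (novikov_complex R D) j = bd j" for j
    by (simp_all add: novikov_complex_def extend_complex_def)
  have minus_zero: "U \<ominus>\<^bsub>tp j\<^esub> \<zero>\<^bsub>tp j\<^esub> = U" if "U \<in> carrier (tp j)" for U j
  proof -
    interpret T: right_module S "tp j" by (rule tp_module)
    show ?thesis using that by (simp add: a_minus_def T.M.a_inv_zero)
  qed
  have "contractible_complex (novikov_ring R) (novikov_complex R D)"
    unfolding contractible_complex_def cochain_homotopic_def E
    by (intro exI[of _ h] conjI allI ballI) (simp_all only: id_apply h minus_zero)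
  \<comment> \<open>For a cycle U the homotopy equation loses its second term and exhibits U as the
    boundary of \<open>h j U\<close>.\<close>
  moreover have "{x \<in> carrier (tp j). bd j x = \<zero>\<^bsub>tp (j + 1)\<^esub>} = bd (j - 1) ` carrier (tp (j - 1))" for j
  proof (intro equalityI subsetI)
    fix U assume U: "U \<in> {x \<in> carrier (tp j). bd j x = \<zero>\<^bsub>tp (j + 1)\<^esub>}"
    interpret T: right_module S "tp j" by (rule tp_module)
    have h': "h (j + 1) \<in> rmod_hom S (tp (j + 1)) (tp j)" using h(1)[of "j + 1"] by simp
    have "h (j + 1) \<zero>\<^bsub>tp (j + 1)\<^esub> = \<zero>\<^bsub>tp j\<^esub>"
      by (rule additive_map_zero[OF rmod_hom_additive[OF h' tp_module tp_module]])
    moreover have hU: "h j U \<in> carrier (tp (j - 1))" using rmod_homD(1)[OF h(1)] U by blast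
    moreover have "bd (j - 1) (h j U) \<in> carrier (tp j)"
      using rmod_homD(1)[OF bd_hom hU] by simp
    ultimately have "bd (j - 1) (h j U) = U"
      using h(2)[of U j] U by simp
    then show "U \<in> bd (j - 1) ` carrier (tp (j - 1))" using hU by blast
  next
    fix U assume "U \<in> bd (j - 1) ` carrier (tp (j - 1))"
    then obtain V where V: "V \<in> carrier (tp (j - 1))" "U = bd (j - 1) V" by (rule imageE)
    have "bd (j - 1) V \<in> carrier (tp j)" "bd j (bd (j - 1) V) = \<zero>\<^bsub>tp (j + 1)\<^esub>"
      using rmod_homD(1)[OF bd_hom V(1)] bd_bd[OF V(1)] by simp_all
    then show "U \<in> {x \<in> carrier (tp j). bd j x = \<zero>\<^bsub>tp (j + 1)\<^esub>}"
      unfolding V(2) by (intro CollectI conjI)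
  qed
  then have "acyclic_complex (novikov_complex R D)"
    unfolding acyclic_complex_def E by (rule allI)
  ultimately show ?thesis by blast
qed

end
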